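(* Let $\sigma^2,\tau>0$, $R>0$ and $\alpha>1/2$ be constants. Let $X_1,\ldots,X_n$ ($n\ge 2$) be i.i.d. from $P_{\theta^*}$ in the infinite dimensional exponential family on $[0,1]$, and let $\Pi^{(\widehat{k})}(\cdot|X_1,\ldots,X_n)$ be the empirical Bayes posterior defined by the priors $\Pi^{(k)}=\left(\bigotimes_{j\leq k}N(0,\sigma^2)\right)\otimes\left(\bigotimes_{j>k}\delta_0\right)$ and the weights $w(k)=\tau^k/k!$, that is, $$d\Pi^{(k)}(\theta|X_1,\ldots,X_n)\propto\prod_{i=1}^np(X_i|\theta)\,d\Pi^{(k)}(\theta),\qquad \widehat{k}=\mathop{\rm argmax}_{k\in\{1,\ldots,n\}}\log\left[w(k)\int\prod_{i=1}^np(X_i|\theta)\,d\Pi^{(k)}(\theta)\right].$$ Then $$P_{\theta^*}^n\int H^2(P_\theta,P_{\theta^*})\,d\Pi^{(\widehat{k})}(\theta|X_1,\ldots,X_n)\leq M\,n^{-\frac{2\alpha}{2\alpha+1}}(\log n)^{\frac{2\alpha}{2\alpha+1}},$$ for some constant $M>0$ (not depending on $n$) uniformly over all $\theta^*\in\Theta_\alpha(R)$.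
   Context: Infinite dimensional exponential family: for $\theta=(\theta_1,\theta_2,\ldots)$ the probability measure $P_\theta$ on $[0,1]$ has density with respect to Lebesgue measure $$p(x|\theta)=\exp\left(\sum_{j=1}^\infty\theta_j\phi_j(x)-c(\theta)\right),\qquad c(\theta)=\log\int_0^1\exp\left(\sum_{j=1}^\infty\theta_j\phi_j(x)\right)dx,$$ where $\phi_0=1,\phi_1,\phi_2,\ldots$ is the (orthonormal, trigonometric) Fourier basis of $L^2[0,1]$; the coefficient $\theta_0$ of $\phi_0$ is set to $0$. Sobolev ball: $\Theta_\alpha(R)=\{\theta=(\theta_j)_{j=1}^\infty:\sum_{j=1}^\infty j^{2\alpha}\theta_j^2\leq R^2\}$. $\delta_0$ is the point mass at $0$: under $\Pi^{(k)}$, the $\theta_j$ with $j\le k$ are independent $N(0,\sigma^2)$ and $\theta_j=0$ for $j>k$. $P_{\theta^*}^n$ is the $n$-fold product measure, and $P_{\theta^*}^n f$ denotes the expectation of $f(X_1,\ldots,X_n)$ under it. $H(P,Q)=\sqrt{\frac12\int(\sqrt{dP}-\sqrt{dQ})^2}$ is the Hellinger distance. *)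

theory Defs
  imports "HOL-Probability.Probability"
begin

text \<open>Enumeration of the trigonometric basis of \<open>L\<^sup>2[0,1]\<close>: the constant, then cosine and sine
  alternating, so that indices \<open>2m - 1\<close> and \<open>2m\<close> carry frequency \<open>m\<close>.\<close>

definition fourier_basis :: "nat \<Rightarrow> real \<Rightarrow> real" where
  "fourier_basis j x =
     (if j = 0 then 1
      else if odd j then sqrt 2 * cos (2 * pi * real ((j + 1) div 2) * x)
      else sqrt 2 * sin (2 * pi * real (j div 2) * x))"

definition unit_lborel :: "real measure" where
  "unit_lborel = restrict_space lborel {0..1}"

text \<open>Parameters are sequences \<open>\<theta> :: nat \<Rightarrow> real\<close> indexed as in the mathematics: the genuine
  coordinates are \<open>\<theta> 1, \<theta> 2, \<dots>\<close> and \<open>\<theta> 0\<close>, the coefficient of the constant function, is \<open>0\<close>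
  (on the Sobolev ball and almost surely under the priors).\<close>

definition exponent :: "(nat \<Rightarrow> real) \<Rightarrow> real \<Rightarrow> real" where
  "exponent \<theta> x = (\<Sum>j. \<theta> (Suc j) * fourier_basis (Suc j) x)"

definition log_normalizer :: "(nat \<Rightarrow> real) \<Rightarrow> real" where
  "log_normalizer \<theta> = ln (LINT x|unit_lborel. exp (exponent \<theta> x))"

definition expfam_density :: "(nat \<Rightarrow> real) \<Rightarrow> real \<Rightarrow> real" where
  "expfam_density \<theta> x = exp (exponent \<theta> x - log_normalizer \<theta>)"

definition expfam :: "(nat \<Rightarrow> real) \<Rightarrow> real measure" where
  "expfam \<theta> = density unit_lborel (\<lambda>x. ennreal (expfam_density \<theta> x))"

definition sobolev_ball :: "real \<Rightarrow> real \<Rightarrow> (nat \<Rightarrow> real) set" where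
  "sobolev_ball \<alpha> R =
     {\<theta>. \<theta> 0 = 0 \<and>
         summable (\<lambda>j. real (Suc j) powr (2 * \<alpha>) * (\<theta> (Suc j))\<^sup>2) \<and>
         (\<Sum>j. real (Suc j) powr (2 * \<alpha>) * (\<theta> (Suc j))\<^sup>2) \<le> R\<^sup>2}"

text \<open>Hellinger distance of \<open>P\<close> and \<open>Q\<close>, both absolutely continuous with respect to the
  sigma-finite measure \<open>\<mu>\<close>; the value does not depend on the choice of such a \<open>\<mu>\<close>.\<close>

definition hellinger :: "'a measure \<Rightarrow> 'a measure \<Rightarrow> 'a measure \<Rightarrow> real" where
  "hellinger \<mu> P Q =
     sqrt (1 / 2 * (LINT x|\<mu>. (sqrt (enn2real (RN_deriv \<mu> P x)) - sqrt (enn2real (RN_deriv \<mu> Q x)))\<^sup>2))"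

text \<open>\<open>\<sigma>\<close> is the standard deviation, as in \<^const>\<open>normal_density\<close>.\<close>

definition sieve_prior :: "real \<Rightarrow> nat \<Rightarrow> (nat \<Rightarrow> real) measure" where
  "sieve_prior \<sigma> k =
     (\<Pi>\<^sub>M j\<in>UNIV. if j \<in> {1..k} then density lborel (\<lambda>t. ennreal (normal_density 0 \<sigma> t))
                  else return borel 0)"

text \<open>A sample \<open>X\<^sub>1, \<dots>, X\<^sub>n\<close> is a function \<open>X\<close> on \<open>{1..n}\<close>.\<close>

definition likelihood :: "nat \<Rightarrow> (nat \<Rightarrow> real) \<Rightarrow> (nat \<Rightarrow> real) \<Rightarrow> real" where
  "likelihood n X \<theta> = (\<Prod>i=1..n. expfam_density \<theta> (X i))"

definition evidence :: "real \<Rightarrow> nat \<Rightarrow> (nat \<Rightarrow> real) \<Rightarrow> nat \<Rightarrow> real" where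
  "evidence \<sigma> n X k = (LINT \<theta>|sieve_prior \<sigma> k. likelihood n X \<theta>)"

definition posterior :: "real \<Rightarrow> nat \<Rightarrow> (nat \<Rightarrow> real) \<Rightarrow> nat \<Rightarrow> (nat \<Rightarrow> real) measure" where
  "posterior \<sigma> n X k =
     density (sieve_prior \<sigma> k) (\<lambda>\<theta>. ennreal (likelihood n X \<theta> / evidence \<sigma> n X k))"

definition model_weight :: "real \<Rightarrow> nat \<Rightarrow> real" where
  "model_weight \<tau> k = \<tau> ^ k / fact k"

text \<open>Ties are broken by an unspecified choice depending only on the set of maximizers.\<close>

definition k_hat :: "real \<Rightarrow> real \<Rightarrow> nat \<Rightarrow> (nat \<Rightarrow> real) \<Rightarrow> nat" where
  "k_hat \<sigma> \<tau> n X = arg_max_on (\<lambda>k. ln (model_weight \<tau> k * evidence \<sigma> n X k)) {1..n}"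

end

theory Submission
  imports Defs
begin

text \<open>Write \<open>Z\<close> for the weighted evidence of a fixed dimension \<open>k\<^sub>0\<close>, relative to the likelihood of the true
  parameter. Since the selected dimension maximizes the weighted evidence, the posterior mass of a set
  of far parameters is at most the sum over all \<open>k\<close> of \<open>w k\<close> times the integral of the likelihood ratio
  over the far parameters, divided by \<open>Z\<close>.

  The numerator is small. Dimensions beyond a multiple of \<open>k\<^sub>0\<close> are controlled in expectation by the
  factorial decay of \<open>w\<close>. In the remaining dimensions the far parameters with coordinates bounded by
  \<open>n\<close> are covered by at most \<open>(8 n\<^sup>3 + 1)\<^sup>k\<close> boxes so small that the likelihood varies on each of them
  by the factor \<open>e\<close> only; on one box the square root of the likelihood ratio has expectation at most
  \<open>exp (- n H\<^sup>2)\<close>. No tests are needed: the covering is so fine that its cardinality costs the logarithmic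
  factor of the rate.

  The denominator is not small. By the Cauchy-Schwarz inequality the expectation of \<open>1 / Z\<close> is bounded by the
  inverse prior mass of a box around the truncated true parameter times the maximal \<open>n\<close>-th power of
  the chi-square affinity on that box.\<close>

section \<open>The trigonometric basis\<close>

text \<open>The obstacle is that the sieve parameters are unbounded, so that their densities have no
  uniform bound; only the true parameter is controlled, since \<alpha> > 1/2 bounds its l1 norm over
  the Sobolev ball. Hence far parameters meet only the Hellinger affinity, which asks for no such
  bound, and the chi-square affinity is used only near the truth. The box centres are picked inside
  the far set, so that they inherit its separation.

  Neither the far set nor the selected dimension, as a function of the sample, is shown to be
  measurable: finite unions of boxes replace the first and a sum over all dimensions the second, so
  that the integrands are dominated by measurable ones.

  The numerator and 1 / Z are dependent, so the expectation of their product does not factor. A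
  threshold t for 1 / Z separates them: exceeding it costs the expectation of 1 / Z divided by t,
  and below it a half moment of the likelihood ratio suffices. With A = n times the rate, every cost
  is of the form exp (const * A); t and the radius are chosen so that each remainder is a constant
  times exp (- A), which is at most 1 / n.\<close>

lemma space_unit_lborel [simp]: "space unit_lborel = {0..1}"
  by (simp add: unit_lborel_def space_restrict_space)

lemma measurable_unit_lborel [measurable (raw)]:
  "f \<in> borel_measurable borel \<Longrightarrow> f \<in> borel_measurable unit_lborel"
  unfolding unit_lborel_def by (rule measurable_restrict_space1) simp

interpretation unit: prob_space unit_lborel
proof
  show "emeasure unit_lborel (space unit_lborel) = 1"
    by (simp add: unit_lborel_def emeasure_restrict_space space_restrict_space)
qed

lemma integral_unit_lborel:
  fixes f :: "real \<Rightarrow> real"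
  shows "(LINT x|unit_lborel. f x) = (LINT x|lborel. f x * indicator {0..1} x)"
  unfolding unit_lborel_def by (subst integral_restrict_space) (auto simp: mult.commute)

lemma integral_cos_frequency:
  fixes m :: int
  shows "(LINT x|unit_lborel. cos (2 * pi * of_int m * x)) = (if m = 0 then 1 else 0)"
proof (cases "m = 0")
  case True
  then show ?thesis using unit.prob_space by simp
next
  case False
  let ?F = "\<lambda>x. sin (2 * pi * of_int m * x) / (2 * pi * of_int m)"
  have "(LINT x|lborel. cos (2 * pi * of_int m * x) * indicator {0..1} x) = ?F 1 - ?F 0"
    using False by (intro integral_FTC_Icc_real)
      (auto intro!: derivative_eq_intros continuous_intros)
  then show ?thesis
    using False by (simp add: integral_unit_lborel sin_int_2pin)
qed

lemma integral_sin_frequency: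
  fixes m :: int
  shows "(LINT x|unit_lborel. sin (2 * pi * of_int m * x)) = 0"
proof (cases "m = 0")
  case False
  let ?F = "\<lambda>x. - cos (2 * pi * of_int m * x) / (2 * pi * of_int m)"
  have "(LINT x|lborel. sin (2 * pi * of_int m * x) * indicator {0..1} x) = ?F 1 - ?F 0"
    using False by (intro integral_FTC_Icc_real)
      (auto intro!: derivative_eq_intros continuous_intros)
  then show ?thesis
    using False by (simp add: integral_unit_lborel cos_int_2pin)
qed simp

lemma fourier_basis_measurable [measurable]: "fourier_basis j \<in> borel_measurable borel"
  unfolding fourier_basis_def[abs_def] by (cases "j = 0"; cases "odd j"; simp)

lemma abs_fourier_basis_le: "\<bar>fourier_basis j x\<bar> \<le> sqrt 2"
  by (auto simp: fourier_basis_def abs_mult)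

lemma fourier_basis_orthonormal:
  assumes "i > 0" "j > 0"
  shows "(LINT x|unit_lborel. fourier_basis i x * fourier_basis j x) = (if i = j then 1 else 0)"
proof -
  \<comment> \<open>For either parity \<open>(i + 1) div 2\<close> is the frequency: for even
    \<open>i\<close> it equals \<open>i div 2\<close>. Integers are used because the product
    formulas produce the possibly negative frequency \<open>a - b\<close>.\<close>
  define a where "a = int ((i + 1) div 2)"
  define b where "b = int ((j + 1) div 2)"
  have pos: "a > 0" "b > 0" using assms by (auto simp: a_def b_def)
  have int: "integrable unit_lborel (\<lambda>x. cos (c * x))" "integrable unit_lborel (\<lambda>x. sin (c * x))" for c
    by (auto intro!: unit.integrable_const_bound[where B = 1])
  have i: "fourier_basis i = (\<lambda>x. if odd i then sqrt 2 * cos (2 * pi * a * x) else sqrt 2 * sin (2 * pi * a * x))"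
    using assms by (auto simp: fourier_basis_def a_def fun_eq_iff)
  have j: "fourier_basis j = (\<lambda>x. if odd j then sqrt 2 * cos (2 * pi * b * x) else sqrt 2 * sin (2 * pi * b * x))"
    using assms by (auto simp: fourier_basis_def b_def fun_eq_iff)
  have "odd i \<Longrightarrow> i = 2 * ((i + 1) div 2) - 1" "odd j \<Longrightarrow> j = 2 * ((j + 1) div 2) - 1"
    "even i \<Longrightarrow> i = 2 * ((i + 1) div 2)" "even j \<Longrightarrow> j = 2 * ((j + 1) div 2)"
    by (auto elim!: oddE evenE)
  then have ab: "odd i \<Longrightarrow> odd j \<Longrightarrow> a = b \<Longrightarrow> i = j"
      "even i \<Longrightarrow> even j \<Longrightarrow> a = b \<Longrightarrow> i = j" "i = j \<Longrightarrow> a = b"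
    unfolding a_def b_def of_nat_eq_iff by metis+
  have two: "sqrt 2 * u * (sqrt 2 * v) = 2 * (u * v)" for u v :: real
    by simp
  have cc: "sqrt 2 * cos (2 * pi * a * x) * (sqrt 2 * cos (2 * pi * b * x))
     = cos (2 * pi * of_int (a - b) * x) + cos (2 * pi * of_int (a + b) * x)" for x
    unfolding two cos_times_cos by (simp add: ring_distribs diff_divide_distrib add_divide_distrib)
  have ss: "sqrt 2 * sin (2 * pi * a * x) * (sqrt 2 * sin (2 * pi * b * x))
     = cos (2 * pi * of_int (a - b) * x) - cos (2 * pi * of_int (a + b) * x)" for x
    unfolding two sin_times_sin by (simp add: ring_distribs diff_divide_distrib add_divide_distrib)
  have sc: "sqrt 2 * sin (2 * pi * a * x) * (sqrt 2 * cos (2 * pi * b * x))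
     = sin (2 * pi * of_int (a + b) * x) + sin (2 * pi * of_int (a - b) * x)" for x
    unfolding two sin_times_cos by (simp add: ring_distribs diff_divide_distrib add_divide_distrib)
  have cs: "sqrt 2 * cos (2 * pi * a * x) * (sqrt 2 * sin (2 * pi * b * x))
     = sin (2 * pi * of_int (a + b) * x) - sin (2 * pi * of_int (a - b) * x)" for x
    unfolding two cos_times_sin by (simp add: ring_distribs diff_divide_distrib add_divide_distrib)
  show ?thesis
  proof (cases "odd i"; cases "odd j")
    assume p: "odd i" "odd j"
    have "(LINT x|unit_lborel. fourier_basis i x * fourier_basis j x) = (if a - b = 0 then 1 else 0) + (if a + b = 0 then 1 else 0)"
      unfolding i j if_P[OF p(1)] if_P[OF p(2)] cc
      by (simp add: int integral_cos_frequency integral_sin_frequency del: of_int_add of_int_diff)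
    then show ?thesis using pos ab p by (cases "i = j") auto
  next
    assume p: "odd i" "\<not> odd j"
    have "(LINT x|unit_lborel. fourier_basis i x * fourier_basis j x) = 0"
      unfolding i j if_P[OF p(1)] if_not_P[OF p(2)] cs
      by (simp add: int integral_cos_frequency integral_sin_frequency del: of_int_add of_int_diff)
    then show ?thesis using p by auto
  next
    assume p: "\<not> odd i" "odd j"
    have "(LINT x|unit_lborel. fourier_basis i x * fourier_basis j x) = 0"
      unfolding i j if_not_P[OF p(1)] if_P[OF p(2)] sc
      by (simp add: int integral_cos_frequency integral_sin_frequency del: of_int_add of_int_diff)
    then show ?thesis using p by auto
  next
    assume p: "\<not> odd i" "\<not> odd j"
    have "(LINT x|unit_lborel. fourier_basis i x * fourier_basis j x) = (if a - b = 0 then 1 else 0) - (if a + b = 0 then 1 else 0)"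
      unfolding i j if_not_P[OF p(1)] if_not_P[OF p(2)] ss
      by (simp add: int integral_cos_frequency integral_sin_frequency del: of_int_add of_int_diff)
    then show ?thesis using pos ab p by (cases "i = j") auto
  qed
qed

text \<open>The class in which the exponent series converges absolutely at every point and is
  bounded, by \<open>sqrt 2 * l1_norm \<theta>\<close>. It contains the sieve parameters, which have
  finitely many nonzero coordinates, and the Sobolev ball, because \<alpha> > 1/2.\<close>

definition abs_summable :: "(nat \<Rightarrow> real) \<Rightarrow> bool" where
  "abs_summable \<theta> \<longleftrightarrow> summable (\<lambda>j. \<bar>\<theta> (Suc j)\<bar>)"

definition l1_norm :: "(nat \<Rightarrow> real) \<Rightarrow> real" where
  "l1_norm \<theta> = (\<Sum>j. \<bar>\<theta> (Suc j)\<bar>)"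

section \<open>Convergence, sup norm and L2 norm of the exponent\<close>

lemma abs_exponent_term_le:
  "\<bar>\<theta> (Suc j) * fourier_basis (Suc j) x\<bar> \<le> sqrt 2 * \<bar>\<theta> (Suc j)\<bar>"
  using mult_left_mono[OF abs_fourier_basis_le[of "Suc j" x], of "\<bar>\<theta> (Suc j)\<bar>"]
  by (simp add: abs_mult mult.commute)

lemma exponent_terms_summable:
  assumes "abs_summable \<theta>"
  shows "summable (\<lambda>j. \<bar>\<theta> (Suc j) * fourier_basis (Suc j) x\<bar>)"
proof (rule summable_comparison_test')
  show "summable (\<lambda>j. sqrt 2 * \<bar>\<theta> (Suc j)\<bar>)"
    using assms by (intro summable_mult) (simp add: abs_summable_def)
  show "norm \<bar>\<theta> (Suc j) * fourier_basis (Suc j) x\<bar> \<le> sqrt 2 * \<bar>\<theta> (Suc j)\<bar>" for j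
    using abs_exponent_term_le by simp
qed

lemma exponent_sums:
  assumes "abs_summable \<theta>"
  shows "(\<lambda>j. \<theta> (Suc j) * fourier_basis (Suc j) x) sums exponent \<theta> x"
  unfolding exponent_def by (rule summable_sums[OF summable_rabs_cancel[OF exponent_terms_summable[OF assms]]])

lemma abs_exponent_le:
  assumes "abs_summable \<theta>"
  shows "\<bar>exponent \<theta> x\<bar> \<le> sqrt 2 * l1_norm \<theta>"
proof -
  have s: "summable (\<lambda>j. sqrt 2 * \<bar>\<theta> (Suc j)\<bar>)"
    using assms by (intro summable_mult) (simp add: abs_summable_def)
  have "\<bar>exponent \<theta> x\<bar> \<le> (\<Sum>j. \<bar>\<theta> (Suc j) * fourier_basis (Suc j) x\<bar>)"
    unfolding exponent_def by (rule summable_rabs[OF exponent_terms_summable[OF assms]])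
  also have "\<dots> \<le> (\<Sum>j. sqrt 2 * \<bar>\<theta> (Suc j)\<bar>)"
    by (intro suminf_le abs_exponent_term_le exponent_terms_summable assms s)
  also have "\<dots> = sqrt 2 * l1_norm \<theta>"
    unfolding l1_norm_def using assms by (intro suminf_mult) (simp add: abs_summable_def)
  finally show ?thesis .
qed

lemma abs_summable_diff:
  assumes "abs_summable \<theta>" "abs_summable \<eta>"
  shows "abs_summable (\<lambda>j. \<theta> j - \<eta> j)"
  unfolding abs_summable_def
proof (rule summable_comparison_test')
  show "summable (\<lambda>j. \<bar>\<theta> (Suc j)\<bar> + \<bar>\<eta> (Suc j)\<bar>)"
    using assms by (intro summable_add) (auto simp: abs_summable_def)
qed (auto intro: abs_triangle_ineq4)

lemma exponent_diff:
  assumes "abs_summable \<theta>" "abs_summable \<eta>"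
  shows "exponent (\<lambda>j. \<theta> j - \<eta> j) x = exponent \<theta> x - exponent \<eta> x"
  using sums_diff[OF exponent_sums[OF assms(1), of x] exponent_sums[OF assms(2), of x]]
    exponent_sums[OF abs_summable_diff[OF assms], of x]
  by (auto simp: left_diff_distrib dest: sums_unique2)

lemma exponent_measurable [measurable]: "exponent \<theta> \<in> borel_measurable borel"
  unfolding exponent_def[abs_def] by measurable

text \<open>Orthonormality gives the identity for partial sums. It passes to the limit by dominated
  convergence with a constant bound, since every partial sum is at most
  \<open>sqrt 2 * l1_norm \<theta>\<close> in absolute value.\<close>

lemma l2_norm_exponent_le:
  assumes abs: "abs_summable \<theta>" and sq: "(\<lambda>j. (\<theta> (Suc j))\<^sup>2) sums s"
  shows "(LINT x|unit_lborel. (exponent \<theta> x)\<^sup>2) \<le> s"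
proof -
  define P where "P N x = (\<Sum>j<N. \<theta> (Suc j) * fourier_basis (Suc j) x)" for N x
  have Pm [measurable]: "P N \<in> borel_measurable borel" for N
    unfolding P_def[abs_def] by measurable
  have lim: "(\<lambda>N. P N x) \<longlonglongrightarrow> exponent \<theta> x" for x
    using exponent_sums[OF abs] by (simp add: sums_def P_def)
  have bound: "\<bar>P N x\<bar> \<le> sqrt 2 * l1_norm \<theta>" for N x
  proof -
    have "\<bar>P N x\<bar> \<le> (\<Sum>j<N. \<bar>\<theta> (Suc j) * fourier_basis (Suc j) x\<bar>)"
      unfolding P_def by (rule sum_abs)
    also have "\<dots> \<le> (\<Sum>j<N. sqrt 2 * \<bar>\<theta> (Suc j)\<bar>)"
      by (intro sum_mono abs_exponent_term_le)
    also have "\<dots> \<le> sqrt 2 * l1_norm \<theta>"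
      unfolding sum_distrib_left[symmetric] l1_norm_def
      using abs by (intro mult_left_mono sum_le_suminf) (auto simp: abs_summable_def)
    finally show ?thesis .
  qed
  have "(\<lambda>N. LINT x|unit_lborel. (P N x)\<^sup>2) \<longlonglongrightarrow> (LINT x|unit_lborel. (exponent \<theta> x)\<^sup>2)"
  proof (rule integral_dominated_convergence[where w = "\<lambda>_. (sqrt 2 * l1_norm \<theta>)\<^sup>2"])
    show "AE x in unit_lborel. (\<lambda>N. (P N x)\<^sup>2) \<longlonglongrightarrow> (exponent \<theta> x)\<^sup>2"
      by (intro AE_I2 tendsto_power lim)
    show "AE x in unit_lborel. norm ((P N x)\<^sup>2) \<le> (sqrt 2 * l1_norm \<theta>)\<^sup>2" for N
      using power_mono[OF bound[of N] abs_ge_zero, of _ 2] by (intro AE_I2) (simp only: real_norm_def abs_power2 power2_abs)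
  qed auto
  moreover have "(LINT x|unit_lborel. (P N x)\<^sup>2) = (\<Sum>j<N. (\<theta> (Suc j))\<^sup>2)" for N
  proof -
    have int [simp]: "integrable unit_lborel (\<lambda>x. fourier_basis i x * fourier_basis j x)" for i j
    proof (rule unit.integrable_const_bound[where B = "sqrt 2 * sqrt 2"])
      show "AE x in unit_lborel. norm (fourier_basis i x * fourier_basis j x) \<le> sqrt 2 * sqrt 2"
        unfolding real_norm_def abs_mult by (intro AE_I2 mult_mono abs_fourier_basis_le) auto
    qed measurable
    have "(LINT x|unit_lborel. (P N x)\<^sup>2) =
      (LINT x|unit_lborel. (\<Sum>i<N. \<Sum>j<N. (\<theta> (Suc i) * \<theta> (Suc j)) * (fourier_basis (Suc i) x * fourier_basis (Suc j) x)))"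
      unfolding P_def power2_eq_square sum_product by (simp only: mult_ac)
    also have "\<dots> = (\<Sum>i<N. \<Sum>j<N. (\<theta> (Suc i) * \<theta> (Suc j)) * (if Suc i = Suc j then 1 else 0))"
      by (simp add: fourier_basis_orthonormal)
    also have "\<dots> = (\<Sum>j<N. (\<theta> (Suc j))\<^sup>2)"
      by (simp add: power2_eq_square if_distrib cong: if_cong)
    finally show ?thesis .
  qed
  ultimately have "(\<lambda>N. \<Sum>j<N. (\<theta> (Suc j))\<^sup>2) \<longlonglongrightarrow> (LINT x|unit_lborel. (exponent \<theta> x)\<^sup>2)"
    by simp
  with sq have "(LINT x|unit_lborel. (exponent \<theta> x)\<^sup>2) = s"
    unfolding sums_def by (rule LIMSEQ_unique[rotated])
  then show ?thesis by simp
qed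

section \<open>Densities, Hellinger affinity and chi-square divergence\<close>

lemma exp_exponent_integrable:
  assumes "abs_summable \<theta>"
  shows "integrable unit_lborel (\<lambda>x. exp (exponent \<theta> x))"
  using abs_exponent_le[OF assms]
  by (intro unit.integrable_const_bound[where B = "exp (sqrt 2 * l1_norm \<theta>)"]) (auto intro: abs_le_D1)

lemma integral_exp_exponent_ge:
  assumes "abs_summable \<theta>"
  shows "exp (- sqrt 2 * l1_norm \<theta>) \<le> (LINT x|unit_lborel. exp (exponent \<theta> x))"
  using abs_exponent_le[OF assms] exp_exponent_integrable[OF assms]
  by (intro unit.integral_ge_const AE_I2) (auto simp: abs_le_iff minus_le_iff)

lemma exp_log_normalizer:
  assumes "abs_summable \<theta>"
  shows "exp (log_normalizer \<theta>) = (LINT x|unit_lborel. exp (exponent \<theta> x))"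
  using less_le_trans[OF exp_gt_zero integral_exp_exponent_ge[OF assms]]
  by (simp add: log_normalizer_def)

lemma expfam_density_pos: "expfam_density \<theta> x > 0"
  by (simp add: expfam_density_def)

lemma expfam_density_measurable [measurable]: "expfam_density \<theta> \<in> borel_measurable borel"
  unfolding expfam_density_def[abs_def] by measurable

lemma log_normalizer_diff_le:
  assumes "abs_summable \<theta>" "abs_summable \<eta>"
    and "\<And>x. x \<in> {0..1} \<Longrightarrow> exponent \<theta> x \<le> exponent \<eta> x + d"
  shows "log_normalizer \<theta> \<le> log_normalizer \<eta> + d"
proof -
  have "exp (log_normalizer \<theta>) \<le> (LINT x|unit_lborel. exp (exponent \<eta> x) * exp d)"
    unfolding exp_log_normalizer[OF assms(1)]
    using assms by (intro integral_mono exp_exponent_integrable integrable_mult_left)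
      (auto simp flip: exp_add)
  also have "\<dots> = exp (log_normalizer \<eta> + d)"
    by (simp add: exp_add exp_log_normalizer[OF assms(2)])
  finally show ?thesis by simp
qed

text \<open>The bound \<open>d\<close> is paid twice, once for the exponent and once for the
  log-normalizer, hence the factor \<open>exp (2 * d)\<close>.\<close>

lemma expfam_density_le:
  assumes "abs_summable \<theta>" "abs_summable \<eta>"
    and d: "\<And>x. x \<in> {0..1} \<Longrightarrow> \<bar>exponent \<theta> x - exponent \<eta> x\<bar> \<le> d" and x: "x \<in> {0..1}"
  shows "expfam_density \<theta> x \<le> exp (2 * d) * expfam_density \<eta> x"
proof -
  have "exponent \<theta> y \<le> exponent \<eta> y + d" "exponent \<eta> y \<le> exponent \<theta> y + d" if "y \<in> {0..1}" for y
    using d[OF that] by (auto simp: abs_le_iff)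
  then have "exponent \<theta> x \<le> exponent \<eta> x + d" "log_normalizer \<eta> \<le> log_normalizer \<theta> + d"
    using x assms by (auto intro: log_normalizer_diff_le)
  then show ?thesis
    by (simp add: expfam_density_def flip: exp_add)
qed

lemma log_normalizer_ge:
  assumes "abs_summable \<theta>"
  shows "log_normalizer \<theta> \<ge> - sqrt 2 * l1_norm \<theta>"
  using integral_exp_exponent_ge[OF assms] unfolding exp_log_normalizer[OF assms, symmetric] by simp

lemma expfam_density_bound:
  assumes "abs_summable \<theta>"
  shows "expfam_density \<theta> x \<le> exp (2 * sqrt 2 * l1_norm \<theta>)"
  using abs_exponent_le[OF assms, of x] log_normalizer_ge[OF assms]
  by (simp add: expfam_density_def abs_le_iff)

lemma integrable_expfam_density_times:
  assumes "abs_summable \<theta>" and [measurable]: "g \<in> borel_measurable borel"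
    and "\<And>x. x \<in> {0..1} \<Longrightarrow> \<bar>g x\<bar> \<le> B"
  shows "integrable unit_lborel (\<lambda>x. expfam_density \<theta> x * g x)"
proof (rule unit.integrable_const_bound[where B = "exp (2 * sqrt 2 * l1_norm \<theta>) * B"])
  show "AE x in unit_lborel. norm (expfam_density \<theta> x * g x) \<le> exp (2 * sqrt 2 * l1_norm \<theta>) * B"
    unfolding real_norm_def abs_mult
    using assms expfam_density_bound[OF assms(1)] expfam_density_pos[of \<theta>]
    by (intro AE_I2 mult_mono) (auto simp: less_imp_le abs_of_pos)
qed measurable

lemma integrable_expfam_density:
  "abs_summable \<theta> \<Longrightarrow> integrable unit_lborel (expfam_density \<theta>)"
  using integrable_expfam_density_times[of \<theta> "\<lambda>_. 1" 1] by simp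

lemma integral_expfam_density:
  assumes "abs_summable \<theta>"
  shows "(LINT x|unit_lborel. expfam_density \<theta> x) = 1"
proof -
  have "(LINT x|unit_lborel. expfam_density \<theta> x)
      = (LINT x|unit_lborel. exp (exponent \<theta> x)) / exp (log_normalizer \<theta>)"
    by (simp add: expfam_density_def exp_diff)
  then show ?thesis using exp_log_normalizer[OF assms] by (metis exp_not_eq_zero divide_self)
qed

lemma sets_expfam [simp, measurable_cong]: "sets (expfam \<theta>) = sets unit_lborel"
  by (simp add: expfam_def)

lemma space_expfam [simp]: "space (expfam \<theta>) = {0..1}"
  by (simp add: expfam_def)

lemma nn_integral_expfam:
  assumes [measurable]: "f \<in> borel_measurable borel" and "\<And>x. f x \<ge> 0"
  shows "(\<integral>\<^sup>+x. ennreal (f x) \<partial>expfam \<theta>) = (\<integral>\<^sup>+x. ennreal (expfam_density \<theta> x * f x) \<partial>unit_lborel)"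
  unfolding expfam_def using assms(2)
  by (subst nn_integral_density) (auto simp: ennreal_mult less_imp_le[OF expfam_density_pos])

lemma prob_space_expfam:
  assumes "abs_summable \<theta>"
  shows "prob_space (expfam \<theta>)"
proof
  have "emeasure (expfam \<theta>) (space (expfam \<theta>)) = (\<integral>\<^sup>+x. ennreal (expfam_density \<theta> x) \<partial>unit_lborel)"
    unfolding expfam_def
    by (subst emeasure_density) (use sets.top[of unit_lborel] in \<open>auto intro!: nn_integral_cong split: split_indicator\<close>)
  also have "\<dots> = ennreal (LINT x|unit_lborel. expfam_density \<theta> x)"
    by (intro nn_integral_eq_integral integrable_expfam_density assms AE_I2 less_imp_le expfam_density_pos)
  finally show "emeasure (expfam \<theta>) (space (expfam \<theta>)) = 1"
    by (simp add: integral_expfam_density[OF assms])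
qed

text \<open>\<open>hellinger\<close> is defined through \<open>RN_deriv\<close>, which is determined
  only almost everywhere; uniqueness identifies it with \<open>expfam_density\<close>. Expanding the
  square then leaves the affinity, because both densities integrate to 1.\<close>

lemma hellinger_expfam:
  assumes "abs_summable \<theta>" "abs_summable \<eta>"
  shows "(hellinger unit_lborel (expfam \<theta>) (expfam \<eta>))\<^sup>2
    = 1 - (LINT x|unit_lborel. sqrt (expfam_density \<theta> x * expfam_density \<eta> x))"
    and "integrable unit_lborel (\<lambda>x. sqrt (expfam_density \<theta> x * expfam_density \<eta> x))"
proof -
  let ?p = "expfam_density \<theta>" and ?q = "expfam_density \<eta>"
  have "AE x in unit_lborel. ennreal (expfam_density \<zeta> x) = RN_deriv unit_lborel (expfam \<zeta>) x" for \<zeta>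
    by (rule unit.RN_deriv_unique) (auto simp: expfam_def)
  from this[of \<theta>] this[of \<eta>]
  have "AE x in unit_lborel. (sqrt (enn2real (RN_deriv unit_lborel (expfam \<theta>) x))
      - sqrt (enn2real (RN_deriv unit_lborel (expfam \<eta>) x)))\<^sup>2 = (sqrt (?p x) - sqrt (?q x))\<^sup>2"
  proof eventually_elim
    fix x
    assume "ennreal (?p x) = RN_deriv unit_lborel (expfam \<theta>) x"
      "ennreal (?q x) = RN_deriv unit_lborel (expfam \<eta>) x"
    from this[symmetric] show "(sqrt (enn2real (RN_deriv unit_lborel (expfam \<theta>) x))
      - sqrt (enn2real (RN_deriv unit_lborel (expfam \<eta>) x)))\<^sup>2 = (sqrt (?p x) - sqrt (?q x))\<^sup>2"
      by (simp add: less_imp_le[OF expfam_density_pos])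
  qed
  then have "(LINT x|unit_lborel. (sqrt (enn2real (RN_deriv unit_lborel (expfam \<theta>) x))
      - sqrt (enn2real (RN_deriv unit_lborel (expfam \<eta>) x)))\<^sup>2) = (LINT x|unit_lborel. (sqrt (?p x) - sqrt (?q x))\<^sup>2)"
    by (intro integral_cong_AE) measurable
  moreover have "(sqrt (?p x) - sqrt (?q x))\<^sup>2 = ?p x + ?q x - 2 * sqrt (?p x * ?q x)" for x
    using expfam_density_pos[of \<theta> x] expfam_density_pos[of \<eta> x]
    by (simp add: power2_diff real_sqrt_mult)
  moreover show int: "integrable unit_lborel (\<lambda>x. sqrt (?p x * ?q x))"
  proof (rule Bochner_Integration.integrable_bound)
    show "integrable unit_lborel (\<lambda>x. ?p x + ?q x)"
      using assms by (intro Bochner_Integration.integrable_add integrable_expfam_density)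
    show "AE x in unit_lborel. norm (sqrt (?p x * ?q x)) \<le> norm (?p x + ?q x)"
    proof (rule AE_I2)
      fix x
      have "sqrt (?p x * ?q x) \<le> (?p x + ?q x) / 2"
        by (rule arith_geo_mean_sqrt) (auto intro: less_imp_le expfam_density_pos)
      moreover have "sqrt (?p x * ?q x) \<ge> 0" "?p x > 0" "?q x > 0"
        using expfam_density_pos[of \<theta> x] expfam_density_pos[of \<eta> x] by auto
      ultimately show "norm (sqrt (?p x * ?q x)) \<le> norm (?p x + ?q x)" by simp
    qed
  qed measurable
  ultimately have eq: "(LINT x|unit_lborel. (sqrt (enn2real (RN_deriv unit_lborel (expfam \<theta>) x))
      - sqrt (enn2real (RN_deriv unit_lborel (expfam \<eta>) x)))\<^sup>2)
      = 2 - 2 * (LINT x|unit_lborel. sqrt (?p x * ?q x))"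
    using assms by (simp add: integrable_expfam_density integral_expfam_density)
  \<comment> \<open>Nonnegativity lets the square cancel the square root in
    \<open>hellinger\<close>.\<close>
  have "(LINT x|unit_lborel. (sqrt (enn2real (RN_deriv unit_lborel (expfam \<theta>) x))
      - sqrt (enn2real (RN_deriv unit_lborel (expfam \<eta>) x)))\<^sup>2) \<ge> 0"
    by (rule Bochner_Integration.integral_nonneg) simp
  then show "(hellinger unit_lborel (expfam \<theta>) (expfam \<eta>))\<^sup>2
    = 1 - (LINT x|unit_lborel. sqrt (?p x * ?q x))"
    unfolding hellinger_def eq by simp
qed

lemma hellinger_expfam_le_1:
  assumes "abs_summable \<theta>" "abs_summable \<eta>"
  shows "(hellinger unit_lborel (expfam \<theta>) (expfam \<eta>))\<^sup>2 \<le> 1"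
  unfolding hellinger_expfam[OF assms]
  by (simp add: Bochner_Integration.integral_nonneg less_imp_le expfam_density_pos)

lemma nn_integral_expfam_ratio:
  assumes "abs_summable \<theta>"
  shows "(\<integral>\<^sup>+x. ennreal (expfam_density \<theta> x / expfam_density \<eta> x) \<partial>expfam \<eta>) = 1"
proof -
  have "(\<integral>\<^sup>+x. ennreal (expfam_density \<theta> x / expfam_density \<eta> x) \<partial>expfam \<eta>)
    = (\<integral>\<^sup>+x. ennreal (expfam_density \<theta> x) \<partial>unit_lborel)"
    by (subst nn_integral_expfam)
      (auto simp: less_imp_le[OF expfam_density_pos] less_imp_neq[OF expfam_density_pos, symmetric])
  also have "\<dots> = ennreal (LINT x|unit_lborel. expfam_density \<theta> x)"
    by (intro nn_integral_eq_integral integrable_expfam_density assms AE_I2 less_imp_le expfam_density_pos)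
  finally show ?thesis by (simp add: integral_expfam_density[OF assms])
qed

lemma nn_integral_expfam_sqrt_ratio:
  assumes "abs_summable \<theta>" "abs_summable \<eta>"
  shows "(\<integral>\<^sup>+x. ennreal (sqrt (expfam_density \<theta> x / expfam_density \<eta> x)) \<partial>expfam \<eta>)
    = ennreal (1 - (hellinger unit_lborel (expfam \<theta>) (expfam \<eta>))\<^sup>2)"
proof -
  have "expfam_density \<eta> x * sqrt (expfam_density \<theta> x / expfam_density \<eta> x)
      = sqrt (expfam_density \<theta> x * expfam_density \<eta> x)" for x
    using expfam_density_pos[of \<eta> x]
    by (simp add: real_sqrt_divide real_sqrt_mult field_simps)
  then have "(\<integral>\<^sup>+x. ennreal (sqrt (expfam_density \<theta> x / expfam_density \<eta> x)) \<partial>expfam \<eta>)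
    = (\<integral>\<^sup>+x. ennreal (sqrt (expfam_density \<theta> x * expfam_density \<eta> x)) \<partial>unit_lborel)"
    by (subst nn_integral_expfam) (auto simp: less_imp_le[OF expfam_density_pos])
  also have "\<dots> = ennreal (LINT x|unit_lborel. sqrt (expfam_density \<theta> x * expfam_density \<eta> x))"
    by (intro nn_integral_eq_integral hellinger_expfam assms AE_I2)
      (auto simp: less_imp_le[OF expfam_density_pos])
  finally show ?thesis by (simp add: hellinger_expfam[OF assms])
qed

text \<open>By \<open>le\<close>, exp x - 1 - x is at most x * (exp x - 1), and the factor exp x - 1
  is in turn of size at most |x| * exp |x|. The exact linear term matters: it is what cancels
  between the expectations of exp g and exp (- g).\<close>

lemma exp_le_quadratic: "exp x \<le> 1 + x + x\<^sup>2 * exp \<bar>x\<bar>" for x :: real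
proof -
  have le: "exp y - 1 \<le> y * exp y" for y :: real
  proof -
    have "1 - y \<le> exp (- y)" using exp_ge_add_one_self[of "- y"] by simp
    then have "(1 - y) * exp y \<le> exp (- y) * exp y" by (rule mult_right_mono) simp
    then show ?thesis by (simp add: exp_minus_inverse algebra_simps flip: exp_add)
  qed
  have "x * (exp x - 1) \<le> x\<^sup>2 * exp \<bar>x\<bar>"
  proof (cases "x \<ge> 0")
    case True
    then show ?thesis using mult_left_mono[OF le[of x], of x] by (simp add: power2_eq_square mult.assoc)
  next
    case False
    have "1 - exp x \<le> - x * exp (-x)"
    proof -
      have "1 - exp x \<le> -x" using exp_ge_add_one_self[of x] by linarith
      also have "\<dots> \<le> - x * exp (-x)" using False by (simp add: mult_le_cancel_left1)
      finally show ?thesis .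
    qed
    from mult_left_mono[OF this, of "-x"] False show ?thesis
      by (simp add: power2_eq_square algebra_simps)
  qed
  then show ?thesis using le[of x] by (simp add: algebra_simps)
qed

text \<open>The logarithm of the density ratio is \<open>g\<close> up to a constant, and this constant cancels in
  \<open>E e\<^sup>g * E e\<^sup>-\<^sup>g\<close>, where \<open>E\<close> is the expectation under \<open>\<eta>\<close>. The linear terms cancel as well, so only
  \<open>E g\<^sup>2\<close> remains.\<close>

lemma nn_integral_expfam_inverse_ratio_le:
  assumes abs: "abs_summable \<theta>" "abs_summable \<eta>"
    and s: "(\<lambda>j. (\<theta> (Suc j) - \<eta> (Suc j))\<^sup>2) sums s"
    and G: "\<And>x. x \<in> {0..1} \<Longrightarrow> \<bar>exponent \<theta> x - exponent \<eta> x\<bar> \<le> G"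
  shows "(\<integral>\<^sup>+x. ennreal (expfam_density \<eta> x / expfam_density \<theta> x) \<partial>expfam \<eta>)
    \<le> ennreal (exp (2 * (exp G * (exp (2 * sqrt 2 * l1_norm \<eta>) * s))))"
proof -
  define g where "g x = exponent \<theta> x - exponent \<eta> x" for x
  define P where "P = exp (2 * sqrt 2 * l1_norm \<eta>)"
  let ?q = "expfam_density \<eta>"
  have gm [measurable]: "g \<in> borel_measurable borel" unfolding g_def[abs_def] by measurable
  have gb: "\<bar>g x\<bar> \<le> G" if "x \<in> {0..1}" for x using G[OF that] by (simp add: g_def)
  have int_g: "integrable unit_lborel (\<lambda>x. ?q x * g x)"
    using gb by (intro integrable_expfam_density_times abs) auto
  have g2b: "\<bar>(g x)\<^sup>2\<bar> \<le> G\<^sup>2" if "x \<in> {0..1}" for x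
    using power_mono[OF gb[OF that] abs_ge_zero, of 2] by simp
  have int_g2: "integrable unit_lborel (\<lambda>x. ?q x * (g x)\<^sup>2)"
    by (rule integrable_expfam_density_times[OF abs(2) _ g2b]) measurable
  have int_e: "integrable unit_lborel (\<lambda>x. ?q x * exp (c * g x))" if "\<bar>c\<bar> \<le> 1" for c
  proof (rule integrable_expfam_density_times[OF abs(2)])
    fix x :: real assume x: "x \<in> {0..1}"
    have "c * g x \<le> \<bar>c\<bar> * \<bar>g x\<bar>" by (metis abs_ge_self abs_mult)
    also have "\<dots> \<le> 1 * G" using that gb[OF x] by (intro mult_mono) auto
    finally show "\<bar>exp (c * g x)\<bar> \<le> exp G" by simp
  qed measurable
  define a where "a = (LINT x|unit_lborel. ?q x * g x)"
  define b where "b = (LINT x|unit_lborel. ?q x * (g x)\<^sup>2)"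
  define E where "E c = (LINT x|unit_lborel. ?q x * exp (c * g x))" for c
  have E_nonneg: "E c \<ge> 0" for c
    unfolding E_def by (rule Bochner_Integration.integral_nonneg) (simp add: less_imp_le expfam_density_pos)
  have E_le: "E c \<le> exp (c * a + exp G * b)" if c: "c = 1 \<or> c = -1" for c
  proof -
    have "E c \<le> (LINT x|unit_lborel. ?q x + c * (?q x * g x) + exp G * (?q x * (g x)\<^sup>2))"
      unfolding E_def
    proof (rule integral_mono)
      show "integrable unit_lborel (\<lambda>x. ?q x * exp (c * g x))" using c by (intro int_e) auto
      show "integrable unit_lborel (\<lambda>x. ?q x + c * (?q x * g x) + exp G * (?q x * (g x)\<^sup>2))"
        using int_g int_g2 integrable_expfam_density[OF abs(2)] by simp
      fix x assume "x \<in> space unit_lborel"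
      then have x: "x \<in> {0..1}" by simp
      have "exp (c * g x) \<le> 1 + c * g x + (c * g x)\<^sup>2 * exp \<bar>c * g x\<bar>" by (rule exp_le_quadratic)
      also have "\<dots> \<le> 1 + c * g x + (g x)\<^sup>2 * exp G"
        using c gb[OF x] by (auto intro!: mult_left_mono simp: abs_mult)
      finally have "?q x * exp (c * g x) \<le> ?q x * (1 + c * g x + (g x)\<^sup>2 * exp G)"
        by (rule mult_left_mono[OF _ less_imp_le[OF expfam_density_pos]])
      then show "?q x * exp (c * g x) \<le> ?q x + c * (?q x * g x) + exp G * (?q x * (g x)\<^sup>2)"
        by (simp add: algebra_simps)
    qed
    also have "\<dots> = 1 + (c * a + exp G * b)"
      using int_g int_g2 integrable_expfam_density[OF abs(2)] integral_expfam_density[OF abs(2)]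
      by (simp add: a_def b_def)
    also have "\<dots> \<le> exp (c * a + exp G * b)" by (rule exp_ge_add_one_self)
    finally show ?thesis .
  qed
  \<comment> \<open>The density of \<open>\<eta>\<close> is at most \<open>P\<close>, so the second
    moment of \<open>g\<close> under \<open>\<eta>\<close> is at most \<open>P\<close> times the
    Lebesgue one, which is a sum of squared coefficient differences by orthonormality.\<close>
  have b_le: "b \<le> P * s"
  proof -
    have "b \<le> (LINT x|unit_lborel. P * (g x)\<^sup>2)"
      unfolding b_def
    proof (rule integral_mono[OF int_g2])
      show "integrable unit_lborel (\<lambda>x. P * (g x)\<^sup>2)"
        using g2b by (intro integrable_mult_right unit.integrable_const_bound[where B = "G\<^sup>2"]) auto
      show "?q x * (g x)\<^sup>2 \<le> P * (g x)\<^sup>2" for x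
        unfolding P_def by (intro mult_right_mono expfam_density_bound abs) auto
    qed
    also have "\<dots> = P * (LINT x|unit_lborel. (exponent (\<lambda>j. \<theta> j - \<eta> j) x)\<^sup>2)"
      by (simp add: g_def exponent_diff[OF abs])
    also have "\<dots> \<le> P * s"
      using s by (intro mult_left_mono l2_norm_exponent_le abs_summable_diff abs) (auto simp: P_def)
    finally show ?thesis .
  qed
  \<comment> \<open>\<open>E 1\<close> is exp of the difference of the two log-normalizers, so the
    unknown constant in the density ratio becomes an expectation that \<open>E_le\<close>
    bounds.\<close>
  have ratio: "?q x * (?q x / expfam_density \<theta> x) = E 1 * (?q x * exp (-1 * g x))" for x
  proof -
    have "E 1 = (LINT x|unit_lborel. exp (exponent \<theta> x) / exp (log_normalizer \<eta>))"
      unfolding E_def by (simp add: expfam_density_def g_def flip: exp_add exp_diff)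
    also have "\<dots> = exp (log_normalizer \<theta> - log_normalizer \<eta>)"
      by (simp add: exp_log_normalizer[OF abs(1)] exp_diff)
    finally show ?thesis
      by (simp add: expfam_density_def g_def flip: exp_add exp_diff)
  qed
  have "(\<integral>\<^sup>+x. ennreal (?q x / expfam_density \<theta> x) \<partial>expfam \<eta>)
      = (\<integral>\<^sup>+x. ennreal (E 1 * (?q x * exp (-1 * g x))) \<partial>unit_lborel)"
    unfolding ratio[symmetric]
    by (subst nn_integral_expfam) (auto simp: less_imp_le[OF expfam_density_pos])
  also have "\<dots> = ennreal (LINT x|unit_lborel. E 1 * (?q x * exp (-1 * g x)))"
    using int_e[of "-1"] E_nonneg
    by (intro nn_integral_eq_integral AE_I2 mult_nonneg_nonneg less_imp_le[OF expfam_density_pos]) auto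
  also have "(LINT x|unit_lborel. E 1 * (?q x * exp (-1 * g x))) = E 1 * E (-1)"
    by (simp add: E_def)
  also have "E 1 * E (-1) \<le> exp (1 * a + exp G * b) * exp (-1 * a + exp G * b)"
    by (intro mult_mono E_le E_nonneg) auto
  also have "\<dots> = exp (2 * (exp G * b))" by (simp flip: exp_add)
  also have "\<dots> \<le> exp (2 * (exp G * (P * s)))" using b_le by simp
  finally show ?thesis by (simp add: P_def ennreal_leI)
qed

section \<open>The sieve priors\<close>

definition sieve :: "nat \<Rightarrow> (nat \<Rightarrow> real) set" where
  "sieve k = {\<theta>. \<forall>j. j \<notin> {1..k} \<longrightarrow> \<theta> j = 0}"

text \<open>\<open>exponent\<close> and \<open>l1_norm\<close> are indexed by \<open>Suc j\<close>,
  so the index range \<open>{1..k}\<close> shifts to \<open>{..<k}\<close>.\<close>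

lemma sieve_vanishes: "\<theta> \<in> sieve k \<Longrightarrow> j \<notin> {..<k} \<Longrightarrow> \<theta> (Suc j) = 0"
  by (auto simp: sieve_def)

lemma sieve_abs_summable: "\<theta> \<in> sieve k \<Longrightarrow> abs_summable \<theta>"
  unfolding abs_summable_def by (rule summable_finite[of "{..<k}"]) (auto simp: sieve_vanishes)

lemma sieve_exponent_diff_le:
  assumes "\<theta> \<in> sieve k" "\<eta> \<in> sieve k" "\<And>j. j \<in> {1..k} \<Longrightarrow> \<bar>\<theta> j - \<eta> j\<bar> \<le> h"
  shows "\<bar>exponent \<theta> x - exponent \<eta> x\<bar> \<le> sqrt 2 * (real k * h)"
proof -
  have abs: "abs_summable \<theta>" "abs_summable \<eta>" using assms by (auto intro: sieve_abs_summable)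
  have "l1_norm (\<lambda>j. \<theta> j - \<eta> j) = (\<Sum>j<k. \<bar>\<theta> (Suc j) - \<eta> (Suc j)\<bar>)"
    unfolding l1_norm_def using assms by (intro suminf_finite) (auto simp: sieve_vanishes)
  also have "\<dots> \<le> (\<Sum>j<k. h)" by (intro sum_mono assms) auto
  finally have "sqrt 2 * l1_norm (\<lambda>j. \<theta> j - \<eta> j) \<le> sqrt 2 * (real k * h)" by simp
  then show ?thesis
    using abs_exponent_le[OF abs_summable_diff[OF abs], of x]
    unfolding exponent_diff[OF abs] by linarith
qed

text \<open>A name for the factors of the prior, with which the locale
  \<open>product_prob_space\<close> is instantiated.\<close>

definition sieve_coordinate :: "real \<Rightarrow> nat \<Rightarrow> nat \<Rightarrow> real measure" where
  "sieve_coordinate \<sigma> k j =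
     (if j \<in> {1..k} then density lborel (\<lambda>t. ennreal (normal_density 0 \<sigma> t)) else return borel 0)"

lemma sieve_prior_eq: "sieve_prior \<sigma> k = Pi\<^sub>M UNIV (sieve_coordinate \<sigma> k)"
  by (simp add: sieve_prior_def sieve_coordinate_def[abs_def])

lemma sets_sieve_coordinate [simp, measurable_cong]: "sets (sieve_coordinate \<sigma> k j) = sets borel"
  by (simp add: sieve_coordinate_def)

lemma space_sieve_coordinate [simp]: "space (sieve_coordinate \<sigma> k j) = UNIV"
  by (simp add: sieve_coordinate_def)

lemma sets_sieve_prior [simp, measurable_cong]:
  "sets (sieve_prior \<sigma> k) = sets (\<Pi>\<^sub>M j\<in>UNIV. borel)"
  unfolding sieve_prior_eq by (rule sets_PiM_cong) auto

lemma space_sieve_prior [simp]: "space (sieve_prior \<sigma> k) = UNIV"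
  by (simp add: sieve_prior_eq space_PiM)

lemma prob_space_sieve_coordinate: "\<sigma> > 0 \<Longrightarrow> prob_space (sieve_coordinate \<sigma> k j)"
  by (simp add: sieve_coordinate_def prob_space_normal_density prob_space_return)

lemma prob_space_sieve_prior: "\<sigma> > 0 \<Longrightarrow> prob_space (sieve_prior \<sigma> k)"
  unfolding sieve_prior_eq by (intro prob_space_PiM prob_space_sieve_coordinate)

text \<open>Each coordinate outside \<open>{1..k}\<close> vanishes almost surely under its point
  mass, and there are countably many of them. Bounds valid on \<open>sieve k\<close> can thus be
  used under prior integrals.\<close>

lemma AE_sieve_prior:
  assumes "\<sigma> > 0"
  shows "AE \<theta> in sieve_prior \<sigma> k. \<theta> \<in> sieve k"
proof -
  have "AE \<theta> in sieve_prior \<sigma> k. \<theta> j = 0" if "j \<notin> {1..k}" for j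
  proof -
    have "AE t in sieve_coordinate \<sigma> k j. t = 0"
      unfolding sieve_coordinate_def if_not_P[OF that] by (subst AE_return) auto
    then show ?thesis
      unfolding sieve_prior_eq by (intro AE_PiM_component prob_space_sieve_coordinate assms) auto
  qed
  then show ?thesis
    by (simp add: sieve_def AE_all_countable)
qed

text \<open>Half of the Gaussian exponent is spent on the tail factor; the other half is the density
  with standard deviation \<open>sqrt 2 * \<sigma>\<close>, up to the factor \<open>sqrt 2\<close>
  between the normalizations, and integrates to 1.\<close>

lemma normal_tail_le:
  assumes "\<sigma> > 0" "r \<ge> 0"
  shows "emeasure (density lborel (\<lambda>t. ennreal (normal_density 0 \<sigma> t))) {t. \<bar>t\<bar> > r}
    \<le> ennreal (sqrt 2 * exp (- r\<^sup>2 / (4 * \<sigma>\<^sup>2)))"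
proof -
  have pos: "sqrt 2 * \<sigma> > 0" using assms by simp
  have le: "normal_density 0 \<sigma> t \<le> sqrt 2 * exp (- r\<^sup>2 / (4 * \<sigma>\<^sup>2)) * normal_density 0 (sqrt 2 * \<sigma>) t"
    if "\<bar>t\<bar> > r" for t
  proof -
    define u where "u = exp (- t\<^sup>2 / (4 * \<sigma>\<^sup>2))"
    have "r\<^sup>2 \<le> t\<^sup>2" using that assms by (simp add: abs_le_square_iff[symmetric])
    then have "u \<le> exp (- r\<^sup>2 / (4 * \<sigma>\<^sup>2))"
      unfolding u_def using assms by (simp add: divide_right_mono)
    then have "u * (u / sqrt (2 * pi * \<sigma>\<^sup>2)) \<le> exp (- r\<^sup>2 / (4 * \<sigma>\<^sup>2)) * (u / sqrt (2 * pi * \<sigma>\<^sup>2))"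
      by (rule mult_right_mono) (simp add: u_def)
    moreover have "normal_density 0 \<sigma> t = u * (u / sqrt (2 * pi * \<sigma>\<^sup>2))"
      using assms by (simp add: normal_density_def u_def flip: exp_add)
    moreover have "sqrt 2 * normal_density 0 (sqrt 2 * \<sigma>) t = u / sqrt (2 * pi * \<sigma>\<^sup>2)"
    proof -
      have "sqrt (2 * pi * (sqrt 2 * \<sigma>)\<^sup>2) = sqrt 2 * sqrt (2 * pi * \<sigma>\<^sup>2)"
        unfolding real_sqrt_mult[symmetric] by (simp add: power_mult_distrib)
      then show ?thesis
        by (simp add: normal_density_def u_def power_mult_distrib)
    qed
    ultimately have "normal_density 0 \<sigma> t \<le> exp (- r\<^sup>2 / (4 * \<sigma>\<^sup>2)) * (sqrt 2 * normal_density 0 (sqrt 2 * \<sigma>) t)"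
      by presburger
    then show ?thesis by (simp only: mult_ac)
  qed
  have "emeasure (density lborel (\<lambda>t. ennreal (normal_density 0 \<sigma> t))) {t. \<bar>t\<bar> > r}
      = (\<integral>\<^sup>+t. ennreal (normal_density 0 \<sigma> t) * indicator {t. \<bar>t\<bar> > r} t \<partial>lborel)"
    by (rule emeasure_density) auto
  also have "\<dots> \<le> (\<integral>\<^sup>+t. ennreal (sqrt 2 * exp (- r\<^sup>2 / (4 * \<sigma>\<^sup>2))) * ennreal (normal_density 0 (sqrt 2 * \<sigma>) t) \<partial>lborel)"
    using le by (intro nn_integral_mono) (auto split: split_indicator simp: ennreal_leI simp flip: ennreal_mult)
  also have "\<dots> = ennreal (sqrt 2 * exp (- r\<^sup>2 / (4 * \<sigma>\<^sup>2))) * (\<integral>\<^sup>+t. ennreal (normal_density 0 (sqrt 2 * \<sigma>) t) \<partial>lborel)"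
    by (rule nn_integral_cmult) auto
  also have "(\<integral>\<^sup>+t. ennreal (normal_density 0 (sqrt 2 * \<sigma>) t) \<partial>lborel) = 1"
    using integral_normal_density[OF pos, of 0] integrable_normal_density[OF pos, of 0]
    by (subst nn_integral_eq_integral) auto
  finally show ?thesis by simp
qed

lemma sieve_prior_tail_le:
  assumes "\<sigma> > 0" "r \<ge> 0"
  shows "emeasure (sieve_prior \<sigma> k) {\<theta>. \<exists>j\<in>{1..k}. \<bar>\<theta> j\<bar> > r}
    \<le> ennreal (real k * (sqrt 2 * exp (- r\<^sup>2 / (4 * \<sigma>\<^sup>2))))"
proof -
  interpret product_prob_space "sieve_coordinate \<sigma> k" UNIV
    by (rule product_prob_spaceI) (rule prob_space_sieve_coordinate[OF assms(1)])
  have sets: "{\<theta>. \<bar>\<theta> j\<bar> > r} \<in> sets (sieve_prior \<sigma> k)" for j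
  proof -
    have "{\<theta> \<in> space (sieve_prior \<sigma> k). \<bar>\<theta> j\<bar> > r} \<in> sets (sieve_prior \<sigma> k)" by measurable
    then show ?thesis by simp
  qed
  have "emeasure (sieve_prior \<sigma> k) {\<theta>. \<exists>j\<in>{1..k}. \<bar>\<theta> j\<bar> > r}
      = emeasure (sieve_prior \<sigma> k) (\<Union>j\<in>{1..k}. {\<theta>. \<bar>\<theta> j\<bar> > r})"
    by (rule arg_cong[where f = "emeasure _"]) auto
  also have "\<dots> \<le> (\<Sum>j\<in>{1..k}. emeasure (sieve_prior \<sigma> k) {\<theta>. \<bar>\<theta> j\<bar> > r})"
    using sets by (intro emeasure_subadditive_finite) auto
  also have "\<dots> \<le> (\<Sum>j\<in>{1..k}. ennreal (sqrt 2 * exp (- r\<^sup>2 / (4 * \<sigma>\<^sup>2))))"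
  proof (rule sum_mono)
    fix j assume j: "j \<in> {1..k}"
    have "emeasure (sieve_prior \<sigma> k) {\<theta>. \<bar>\<theta> j\<bar> > r} = emeasure (sieve_coordinate \<sigma> k j) {t. \<bar>t\<bar> > r}"
      unfolding sieve_prior_eq
      using emeasure_PiM_Collect_single[of j "{t. \<bar>t\<bar> > r}"] by (simp add: space_PiM)
    also have "\<dots> \<le> ennreal (sqrt 2 * exp (- r\<^sup>2 / (4 * \<sigma>\<^sup>2)))"
      using normal_tail_le[OF assms] j by (simp add: sieve_coordinate_def)
    finally show "emeasure (sieve_prior \<sigma> k) {\<theta>. \<bar>\<theta> j\<bar> > r} \<le> ennreal (sqrt 2 * exp (- r\<^sup>2 / (4 * \<sigma>\<^sup>2)))" .
  qed
  also have "\<dots> = ennreal (real k * (sqrt 2 * exp (- r\<^sup>2 / (4 * \<sigma>\<^sup>2))))"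
    by (simp add: ennreal_mult ennreal_of_nat_eq_real_of_nat)
  finally show ?thesis .
qed

text \<open>Only the coordinates in \<open>{1..k}\<close> are constrained, so the centre may lie
  outside \<open>sieve k\<close>; the true parameter is used as such a centre.\<close>

definition sup_box :: "nat \<Rightarrow> (nat \<Rightarrow> real) \<Rightarrow> real \<Rightarrow> (nat \<Rightarrow> real) set" where
  "sup_box k c h = {\<theta>. \<forall>j\<in>{1..k}. \<bar>\<theta> j - c j\<bar> \<le> h}"

lemma sup_box_sets [measurable]: "sup_box k c h \<in> sets (\<Pi>\<^sub>M j\<in>UNIV. borel)"
proof -
  have "{\<theta> \<in> space (\<Pi>\<^sub>M j\<in>UNIV. borel). \<forall>j\<in>{1..k}. \<bar>\<theta> j - c j\<bar> \<le> h} \<in> sets (\<Pi>\<^sub>M j\<in>UNIV. borel)"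
    by measurable
  then show ?thesis by (simp add: sup_box_def space_PiM)
qed

text \<open>The coordinates are independent. Each has to fall into an interval of length
  \<open>2 * h\<close> inside [-(B + 1), B + 1], where the normal density is at least its value at
  \<open>B + 1\<close>.\<close>

lemma sieve_prior_sup_box_ge:
  assumes \<sigma>: "\<sigma> > 0" and h: "0 \<le> h" "h \<le> 1" and c: "\<And>j. j \<in> {1..k} \<Longrightarrow> \<bar>c j\<bar> \<le> B"
  shows "emeasure (sieve_prior \<sigma> k) (sup_box k c h) \<ge> ennreal ((2 * h * normal_density 0 \<sigma> (B + 1)) ^ k)"
proof -
  interpret product_prob_space "sieve_coordinate \<sigma> k" UNIV
    by (rule product_prob_spaceI) (rule prob_space_sieve_coordinate[OF \<sigma>])
  have "ennreal ((2 * h * normal_density 0 \<sigma> (B + 1)) ^ k)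
      = (\<Prod>j\<in>{1..k}. ennreal (2 * h * normal_density 0 \<sigma> (B + 1)))"
    using h by (simp add: ennreal_power)
  also have "\<dots> \<le> (\<Prod>j\<in>{1..k}. emeasure (sieve_coordinate \<sigma> k j) {t. \<bar>t - c j\<bar> \<le> h})"
  proof (rule prod_mono_ennreal)
    fix j assume j: "j \<in> {1..k}"
    have le: "normal_density 0 \<sigma> (B + 1) \<le> normal_density 0 \<sigma> t" if "\<bar>t - c j\<bar> \<le> h" for t
    proof -
      have "\<bar>t\<bar> \<le> \<bar>B + 1\<bar>" using that h c[OF j] by linarith
      then have "t\<^sup>2 \<le> (B + 1)\<^sup>2" by (simp only: abs_le_square_iff)
      then have "exp (- (B + 1)\<^sup>2 / (2 * \<sigma>\<^sup>2)) \<le> exp (- t\<^sup>2 / (2 * \<sigma>\<^sup>2))"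
        using \<sigma> by (simp add: divide_right_mono)
      then show ?thesis
        unfolding normal_density_def by (intro mult_left_mono) auto
    qed
    have "ennreal (2 * h * normal_density 0 \<sigma> (B + 1))
        = ennreal (normal_density 0 \<sigma> (B + 1)) * emeasure lborel {c j - h..c j + h}"
      using h by (simp add: ennreal_mult[symmetric] mult.commute)
    also have "\<dots> = (\<integral>\<^sup>+t. ennreal (normal_density 0 \<sigma> (B + 1)) * indicator {c j - h..c j + h} t \<partial>lborel)"
      by (rule nn_integral_cmult_indicator[symmetric]) simp
    also have "\<dots> \<le> (\<integral>\<^sup>+t. ennreal (normal_density 0 \<sigma> t) * indicator {t. \<bar>t - c j\<bar> \<le> h} t \<partial>lborel)"
      using le by (intro nn_integral_mono) (auto split: split_indicator intro!: ennreal_leI simp: abs_le_iff)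
    also have "\<dots> = emeasure (sieve_coordinate \<sigma> k j) {t. \<bar>t - c j\<bar> \<le> h}"
      using j by (simp add: sieve_coordinate_def emeasure_density)
    finally show "ennreal (2 * h * normal_density 0 \<sigma> (B + 1)) \<le> emeasure (sieve_coordinate \<sigma> k j) {t. \<bar>t - c j\<bar> \<le> h}" .
  qed
  also have "\<dots> = emeasure (sieve_prior \<sigma> k) (sup_box k c h)"
    unfolding sieve_prior_eq sup_box_def
    using emeasure_PiM_Collect[of "{1..k}" "\<lambda>j. {t. \<bar>t - c j\<bar> \<le> h}"] by (simp add: space_PiM)
  finally show ?thesis .
qed

text \<open>Points with the same rounded coordinates are within 1 / N of each other. One
  representative per rounding pattern is kept (\<open>g\<close> is injective on \<open>T\<close>),
  which places the centres in \<open>F\<close> itself.\<close>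

lemma finite_sup_box_cover:
  assumes "finite I" and F: "\<forall>\<theta>\<in>F. (\<lambda>j\<in>I. \<lfloor>real N * \<theta> j\<rfloor>) \<in> I \<rightarrow>\<^sub>E A" and "finite A" and "N > 0"
  obtains T where "finite T" "T \<subseteq> F" "card T \<le> card A ^ card I"
    "\<forall>\<theta>\<in>F. \<exists>\<eta>\<in>T. \<forall>j\<in>I. \<bar>\<theta> j - \<eta> j\<bar> \<le> 1 / real N"
proof -
  define g where "g \<theta> = (\<lambda>j\<in>I. \<lfloor>real N * \<theta> j\<rfloor>)" for \<theta> :: "'a \<Rightarrow> real"
  obtain T where T: "T \<subseteq> F" "inj_on g T" "g ` F = g ` T"
    by (metis subset_image_inj order_refl)
  have sub: "g ` T \<subseteq> I \<rightarrow>\<^sub>E A" using T(1) F unfolding g_def by blast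
  have fin: "finite (I \<rightarrow>\<^sub>E A)" using assms by (intro finite_PiE) auto
  show ?thesis
  proof
    show "finite T" using finite_imageD[OF finite_subset[OF sub fin] T(2)] .
    show "T \<subseteq> F" by fact
    have "card T = card (g ` T)" using T by (simp add: card_image)
    also have "\<dots> \<le> card (I \<rightarrow>\<^sub>E A)" by (rule card_mono[OF fin sub])
    also have "\<dots> = card A ^ card I" using assms by (simp add: card_PiE)
    finally show "card T \<le> card A ^ card I" .
    show "\<forall>\<theta>\<in>F. \<exists>\<eta>\<in>T. \<forall>j\<in>I. \<bar>\<theta> j - \<eta> j\<bar> \<le> 1 / real N"
    proof
      fix \<theta> assume "\<theta> \<in> F"
      then obtain \<eta> where \<eta>: "\<eta> \<in> T" "g \<theta> = g \<eta>" using T(3) by blast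
      have "\<bar>\<theta> j - \<eta> j\<bar> \<le> 1 / real N" if "j \<in> I" for j
      proof -
        have "\<lfloor>real N * \<theta> j\<rfloor> = \<lfloor>real N * \<eta> j\<rfloor>"
          using fun_cong[OF \<eta>(2), of j] that by (simp add: g_def)
        then have "\<bar>real N * \<theta> j - real N * \<eta> j\<bar> \<le> 1" by linarith
        then have "real N * \<bar>\<theta> j - \<eta> j\<bar> \<le> 1"
          by (simp only: abs_mult abs_of_nat right_diff_distrib[symmetric])
        then show ?thesis
          using \<open>N > 0\<close> by (simp add: pos_le_divide_eq mult.commute)
      qed
      then show "\<exists>\<eta>\<in>T. \<forall>j\<in>I. \<bar>\<theta> j - \<eta> j\<bar> \<le> 1 / real N" using \<eta> by blast
    qed
  qed
qed

section \<open>Likelihood ratios under the sampling law\<close>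

abbreviation (input) sample_law :: "nat \<Rightarrow> (nat \<Rightarrow> real) \<Rightarrow> (nat \<Rightarrow> real) measure" where
  "sample_law n \<eta> \<equiv> (\<Pi>\<^sub>M i\<in>{1..n}. expfam \<eta>)"

text \<open>Dividing by the likelihood at \<open>\<eta>\<close>, a positive factor that is the same
  for all \<open>\<theta>\<close>, changes neither the posterior nor the ordering of the dimensions,
  and gives expectation one under the sampling law of \<open>\<eta>\<close>.\<close>

definition likelihood_ratio :: "nat \<Rightarrow> (nat \<Rightarrow> real) \<Rightarrow> (nat \<Rightarrow> real) \<Rightarrow> (nat \<Rightarrow> real) \<Rightarrow> real" where
  "likelihood_ratio n \<eta> X \<theta> = likelihood n X \<theta> / likelihood n X \<eta>"

lemma likelihood_pos: "likelihood n X \<theta> > 0"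
  unfolding likelihood_def by (intro prod_pos expfam_density_pos)

lemma likelihood_ratio_pos: "likelihood_ratio n \<eta> X \<theta> > 0"
  unfolding likelihood_ratio_def by (intro divide_pos_pos likelihood_pos)

lemma likelihood_ratio_eq_prod:
  "likelihood_ratio n \<eta> X \<theta> = (\<Prod>i=1..n. expfam_density \<theta> (X i) / expfam_density \<eta> (X i))"
  by (simp add: likelihood_ratio_def likelihood_def prod_dividef)

section \<open>Joint measurability of the likelihood in sample and parameter, as Fubini's theorem
  requires\<close>

lemma exponent_measurable_pair [measurable (raw)]:
  assumes [measurable]: "f \<in> measurable M (\<Pi>\<^sub>M j\<in>UNIV. borel)" "g \<in> borel_measurable M"
  shows "(\<lambda>z. exponent (f z) (g z)) \<in> borel_measurable M"
  unfolding exponent_def by measurable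

lemma measurable_id_unit_lborel: "(\<lambda>x. x) \<in> measurable unit_lborel borel"
  by measurable

lemma expfam_density_measurable_pair [measurable (raw)]:
  assumes [measurable]: "f \<in> measurable M (\<Pi>\<^sub>M j\<in>UNIV. borel)" "g \<in> borel_measurable M"
  shows "(\<lambda>z. expfam_density (f z) (g z)) \<in> borel_measurable M"
proof -
  have [measurable]: "snd \<in> borel_measurable ((\<Pi>\<^sub>M j\<in>UNIV. borel) \<Otimes>\<^sub>M unit_lborel)"
    by (rule measurable_compose[OF measurable_snd measurable_id_unit_lborel])
  have "log_normalizer \<in> borel_measurable (\<Pi>\<^sub>M j\<in>UNIV. borel)"
    unfolding log_normalizer_def[abs_def]
    by (intro borel_measurable_ln unit.borel_measurable_lebesgue_integral)
      (simp add: case_prod_beta', measurable)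
  note [measurable] = this
  show ?thesis unfolding expfam_density_def by measurable
qed

lemma sets_sample_law [measurable_cong]: "sets (sample_law n \<eta>) = sets (\<Pi>\<^sub>M i\<in>{1..n}. unit_lborel)"
  by (rule sets_PiM_cong) auto

lemma sample_component_measurable [measurable]:
  "i \<in> {1..n} \<Longrightarrow> (\<lambda>X. X i) \<in> borel_measurable (\<Pi>\<^sub>M i\<in>{1..n}. unit_lborel)"
  using measurable_compose[OF measurable_component_singleton[of i "{1..n}" "\<lambda>_. unit_lborel"] measurable_id_unit_lborel]
  by simp

lemma likelihood_measurable [measurable (raw)]:
  assumes f [measurable]: "f \<in> measurable M (\<Pi>\<^sub>M j\<in>UNIV. borel)"
    and g: "g \<in> measurable M (\<Pi>\<^sub>M i\<in>{1..n}. unit_lborel)"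
  shows "(\<lambda>z. likelihood n (g z) (f z)) \<in> borel_measurable M"
  unfolding likelihood_def
proof (rule borel_measurable_prod)
  fix i assume "i \<in> {1..n}"
  then have [measurable]: "(\<lambda>z. g z i) \<in> borel_measurable M"
    using measurable_compose[OF g sample_component_measurable] by blast
  show "(\<lambda>z. expfam_density (f z) (g z i)) \<in> borel_measurable M" by measurable
qed

lemma likelihood_ratio_measurable [measurable (raw)]:
  assumes [measurable]: "f \<in> measurable M (\<Pi>\<^sub>M j\<in>UNIV. borel)"
    "g \<in> measurable M (\<Pi>\<^sub>M i\<in>{1..n}. unit_lborel)"
  shows "(\<lambda>z. likelihood_ratio n \<eta> (g z) (f z)) \<in> borel_measurable M"
  unfolding likelihood_ratio_def
  by (intro borel_measurable_divide likelihood_measurable assms measurable_const) (auto simp: space_PiM)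

lemma prob_space_sample_law: "abs_summable \<eta> \<Longrightarrow> prob_space (sample_law n \<eta>)"
  by (intro prob_space_PiM prob_space_expfam)

section \<open>Moments of the likelihood ratio over an independent sample\<close>

lemma nn_integral_sample_law_prod:
  assumes "abs_summable \<eta>" "f \<in> borel_measurable borel"
  shows "(\<integral>\<^sup>+X. (\<Prod>i\<in>{1..n}. f (X i)) \<partial>sample_law n \<eta>) = (\<integral>\<^sup>+x. f x \<partial>expfam \<eta>) ^ n"
proof -
  interpret e: prob_space "expfam \<eta>" by (rule prob_space_expfam[OF assms(1)])
  interpret product_sigma_finite "\<lambda>_::nat. expfam \<eta>" by unfold_locales
  have "f \<in> borel_measurable unit_lborel" using assms(2) by measurable
  then have "f \<in> borel_measurable (expfam \<eta>)" by (simp cong: measurable_cong_sets)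
  then show ?thesis by (subst product_nn_integral_prod) auto
qed

lemma expectation_likelihood_ratio:
  assumes "abs_summable \<theta>" "abs_summable \<eta>"
  shows "(\<integral>\<^sup>+X. ennreal (likelihood_ratio n \<eta> X \<theta>) \<partial>sample_law n \<eta>) = 1"
proof -
  have "ennreal (likelihood_ratio n \<eta> X \<theta>)
      = (\<Prod>i\<in>{1..n}. ennreal (expfam_density \<theta> (X i) / expfam_density \<eta> (X i)))" for X
    unfolding likelihood_ratio_eq_prod
    by (intro prod_ennreal[symmetric] divide_nonneg_nonneg less_imp_le expfam_density_pos)
  then show ?thesis
    using nn_integral_sample_law_prod[OF assms(2), of "\<lambda>x. ennreal (expfam_density \<theta> x / expfam_density \<eta> x)"]
    by (simp add: nn_integral_expfam_ratio[OF assms(1)])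
qed

text \<open>By independence the expectation is the n-th power of the affinity 1 - H^2, and 1 - u is
  at most exp (- u).\<close>

lemma expectation_sqrt_likelihood_ratio_le:
  assumes "abs_summable \<theta>" "abs_summable \<eta>"
  shows "(\<integral>\<^sup>+X. ennreal (sqrt (likelihood_ratio n \<eta> X \<theta>)) \<partial>sample_law n \<eta>)
    \<le> ennreal (exp (- real n * (hellinger unit_lborel (expfam \<theta>) (expfam \<eta>))\<^sup>2))"
proof -
  let ?H = "(hellinger unit_lborel (expfam \<theta>) (expfam \<eta>))\<^sup>2"
  have "sqrt (\<Prod>i=1..n. f i) = (\<Prod>i=1..n. sqrt (f i))" for f :: "nat \<Rightarrow> real"
    by (induction n) (auto simp: real_sqrt_mult)
  then have "sqrt (likelihood_ratio n \<eta> X \<theta>)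
      = (\<Prod>i\<in>{1..n}. sqrt (expfam_density \<theta> (X i) / expfam_density \<eta> (X i)))" for X
    unfolding likelihood_ratio_eq_prod by blast
  then have "ennreal (sqrt (likelihood_ratio n \<eta> X \<theta>))
      = (\<Prod>i\<in>{1..n}. ennreal (sqrt (expfam_density \<theta> (X i) / expfam_density \<eta> (X i))))" for X
    by (simp add: prod_ennreal less_imp_le expfam_density_pos)
  then have "(\<integral>\<^sup>+X. ennreal (sqrt (likelihood_ratio n \<eta> X \<theta>)) \<partial>sample_law n \<eta>) = ennreal (1 - ?H) ^ n"
    using nn_integral_sample_law_prod[OF assms(2), of "\<lambda>x. ennreal (sqrt (expfam_density \<theta> x / expfam_density \<eta> x))"]
    by (simp add: nn_integral_expfam_sqrt_ratio[OF assms])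
  also have "\<dots> = ennreal ((1 - ?H) ^ n)"
    using hellinger_expfam_le_1[OF assms] by (simp add: ennreal_power)
  also have "(1 - ?H) ^ n \<le> exp (- ?H) ^ n"
    using hellinger_expfam_le_1[OF assms] exp_ge_add_one_self[of "- ?H"] by (intro power_mono) auto
  also have "\<dots> = exp (- real n * ?H)" by (simp flip: exp_of_nat_mult)
  finally show ?thesis by (simp add: ennreal_leI)
qed

lemma expectation_inverse_likelihood_ratio_le:
  assumes abs: "abs_summable \<theta>" "abs_summable \<eta>"
    and s: "(\<lambda>j. (\<theta> (Suc j) - \<eta> (Suc j))\<^sup>2) sums s"
    and G: "\<And>x. x \<in> {0..1} \<Longrightarrow> \<bar>exponent \<theta> x - exponent \<eta> x\<bar> \<le> G"
  shows "(\<integral>\<^sup>+X. ennreal (1 / likelihood_ratio n \<eta> X \<theta>) \<partial>sample_law n \<eta>)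
    \<le> ennreal (exp (real n * (2 * (exp G * (exp (2 * sqrt 2 * l1_norm \<eta>) * s)))))"
proof -
  have "ennreal (1 / likelihood_ratio n \<eta> X \<theta>)
      = (\<Prod>i\<in>{1..n}. ennreal (expfam_density \<eta> (X i) / expfam_density \<theta> (X i)))" for X
    unfolding likelihood_ratio_eq_prod
    by (subst prod_ennreal) (auto simp: less_imp_le expfam_density_pos prod_dividef)
  then have "(\<integral>\<^sup>+X. ennreal (1 / likelihood_ratio n \<eta> X \<theta>) \<partial>sample_law n \<eta>)
      = (\<integral>\<^sup>+x. ennreal (expfam_density \<eta> x / expfam_density \<theta> x) \<partial>expfam \<eta>) ^ n"
    using nn_integral_sample_law_prod[OF abs(2), of "\<lambda>x. ennreal (expfam_density \<eta> x / expfam_density \<theta> x)"]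
    by simp
  also have "\<dots> \<le> ennreal (exp (2 * (exp G * (exp (2 * sqrt 2 * l1_norm \<eta>) * s)))) ^ n"
    by (intro power_mono nn_integral_expfam_inverse_ratio_le assms) auto
  also have "\<dots> = ennreal (exp (real n * (2 * (exp G * (exp (2 * sqrt 2 * l1_norm \<eta>) * s)))))"
    by (simp add: ennreal_power flip: exp_of_nat_mult)
  finally show ?thesis .
qed

lemma likelihood_ratio_le:
  assumes X: "X \<in> space (sample_law n \<eta>)" and abs: "abs_summable \<theta>" "abs_summable \<zeta>"
    and d: "\<And>x. x \<in> {0..1} \<Longrightarrow> \<bar>exponent \<theta> x - exponent \<zeta> x\<bar> \<le> d"
  shows "likelihood_ratio n \<eta> X \<theta> \<le> exp (2 * real n * d) * likelihood_ratio n \<eta> X \<zeta>"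
proof -
  have "likelihood n X \<theta> \<le> (\<Prod>i=1..n. exp (2 * d) * expfam_density \<zeta> (X i))"
    unfolding likelihood_def
  proof (rule prod_mono, intro conjI)
    fix i assume "i \<in> {1..n}"
    then have "X i \<in> {0..1}" using X by (auto simp: space_PiM dest: PiE_mem)
    then show "expfam_density \<theta> (X i) \<le> exp (2 * d) * expfam_density \<zeta> (X i)"
      by (intro expfam_density_le abs d)
  qed (simp add: less_imp_le expfam_density_pos)
  also have "\<dots> = exp (2 * real n * d) * likelihood n X \<zeta>"
    by (simp add: prod.distrib likelihood_def mult.assoc mult.left_commute flip: exp_of_nat_mult)
  finally show ?thesis
    unfolding likelihood_ratio_def using likelihood_pos[of n X \<eta>]
    by (simp add: divide_right_mono less_imp_le)
qed

lemma Fubini_sample_prior: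
  assumes "\<sigma> > 0" "abs_summable \<eta>"
    and [measurable]: "case_prod f \<in> borel_measurable ((\<Pi>\<^sub>M i\<in>{1..n}. unit_lborel) \<Otimes>\<^sub>M (\<Pi>\<^sub>M j\<in>UNIV. borel))"
  shows "(\<integral>\<^sup>+X. (\<integral>\<^sup>+\<theta>. f X \<theta> \<partial>sieve_prior \<sigma> k) \<partial>sample_law n \<eta>)
    = (\<integral>\<^sup>+\<theta>. (\<integral>\<^sup>+X. f X \<theta> \<partial>sample_law n \<eta>) \<partial>sieve_prior \<sigma> k)"
proof -
  interpret p: prob_space "sample_law n \<eta>" by (rule prob_space_sample_law[OF assms(2)])
  interpret q: prob_space "sieve_prior \<sigma> k" by (rule prob_space_sieve_prior[OF assms(1)])
  interpret pair_sigma_finite "sample_law n \<eta>" "sieve_prior \<sigma> k" ..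
  show ?thesis by (rule Fubini'[symmetric]) measurable
qed

text \<open>After exchanging the integrals, the inner expectation is one for almost every
  \<open>\<theta>\<close>. Sets of small prior mass therefore contribute little to the numerator on
  average, wherever they lie.\<close>

lemma expectation_prior_likelihood_ratio:
  assumes "\<sigma> > 0" "abs_summable \<eta>" and S [measurable]: "S \<in> sets (\<Pi>\<^sub>M j\<in>UNIV. borel)"
  shows "(\<integral>\<^sup>+X. (\<integral>\<^sup>+\<theta>. ennreal (likelihood_ratio n \<eta> X \<theta>) * indicator S \<theta> \<partial>sieve_prior \<sigma> k) \<partial>sample_law n \<eta>)
    = emeasure (sieve_prior \<sigma> k) S"
proof -
  have "(\<integral>\<^sup>+X. (\<integral>\<^sup>+\<theta>. ennreal (likelihood_ratio n \<eta> X \<theta>) * indicator S \<theta> \<partial>sieve_prior \<sigma> k) \<partial>sample_law n \<eta>)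
    = (\<integral>\<^sup>+\<theta>. (\<integral>\<^sup>+X. ennreal (likelihood_ratio n \<eta> X \<theta>) * indicator S \<theta> \<partial>sample_law n \<eta>) \<partial>sieve_prior \<sigma> k)"
    by (rule Fubini_sample_prior[OF assms(1,2)]) measurable
  also have "\<dots> = (\<integral>\<^sup>+\<theta>. (\<integral>\<^sup>+X. ennreal (likelihood_ratio n \<eta> X \<theta>) \<partial>sample_law n \<eta>) * indicator S \<theta> \<partial>sieve_prior \<sigma> k)"
    by (intro nn_integral_cong nn_integral_multc) (measurable; simp add: space_PiM)
  also have "\<dots> = (\<integral>\<^sup>+\<theta>. indicator S \<theta> \<partial>sieve_prior \<sigma> k)"
  proof (rule nn_integral_cong_AE)
    show "AE \<theta> in sieve_prior \<sigma> k.
      (\<integral>\<^sup>+X. ennreal (likelihood_ratio n \<eta> X \<theta>) \<partial>sample_law n \<eta>) * indicator S \<theta> = indicator S \<theta>"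
      using AE_sieve_prior[OF assms(1)]
      by eventually_elim (simp only: expectation_likelihood_ratio sieve_abs_summable assms(2) mult_1)
  qed
  also have "\<dots> = emeasure (sieve_prior \<sigma> k) S"
    by (rule nn_integral_indicator) simp
  finally show ?thesis .
qed

section \<open>Evidence and the empirical Bayes posterior\<close>

text \<open>The value in \<open>ennreal\<close> keeps an infinite integral visible, whereas
  \<open>evidence\<close>, a Bochner integral, would then have its default value 0.\<close>

definition ratio_integral ::
  "real \<Rightarrow> nat \<Rightarrow> (nat \<Rightarrow> real) \<Rightarrow> nat \<Rightarrow> (nat \<Rightarrow> real) set \<Rightarrow> (nat \<Rightarrow> real) \<Rightarrow> ennreal" where
  "ratio_integral \<sigma> n \<eta> k S X =
     (\<integral>\<^sup>+\<theta>. ennreal (likelihood_ratio n \<eta> X \<theta>) * indicator S \<theta> \<partial>sieve_prior \<sigma> k)"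

lemma ratio_integral_measurable:
  assumes "\<sigma> > 0" and [measurable]: "S \<in> sets (\<Pi>\<^sub>M j\<in>UNIV. borel)"
  shows "ratio_integral \<sigma> n \<eta> k S \<in> borel_measurable (\<Pi>\<^sub>M i\<in>{1..n}. unit_lborel)"
proof -
  interpret q: prob_space "sieve_prior \<sigma> k" by (rule prob_space_sieve_prior[OF assms(1)])
  show ?thesis unfolding ratio_integral_def by measurable
qed

lemma UNIV_sets_sequences [simp, measurable]: "UNIV \<in> sets (\<Pi>\<^sub>M j\<in>UNIV. borel)"
  using sets.top[of "\<Pi>\<^sub>M j\<in>UNIV. borel"] by (simp add: space_PiM)

lemma likelihood_ratio_prior_measurable:
  assumes "X \<in> space (sample_law n \<eta>)"
  shows "likelihood_ratio n \<eta> X \<in> borel_measurable (sieve_prior \<sigma> k)"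
  using assms by (intro likelihood_ratio_measurable[of "\<lambda>\<theta>. \<theta>" _ "\<lambda>_. X"]) (auto simp: space_PiM)

lemma ratio_integral_pos:
  assumes "\<sigma> > 0" "X \<in> space (sample_law n \<eta>)"
  shows "ratio_integral \<sigma> n \<eta> k UNIV X \<noteq> 0"
proof
  interpret q: prob_space "sieve_prior \<sigma> k" by (rule prob_space_sieve_prior[OF assms(1)])
  note [measurable] = likelihood_ratio_prior_measurable[OF assms(2)]
  assume "ratio_integral \<sigma> n \<eta> k UNIV X = 0"
  then have "AE \<theta> in sieve_prior \<sigma> k. ennreal (likelihood_ratio n \<eta> X \<theta>) = 0"
    unfolding ratio_integral_def by (subst (asm) nn_integral_0_iff_AE) auto
  then have "AE \<theta> in sieve_prior \<sigma> k. False"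
    by eventually_elim (metis ennreal_eq_0_iff likelihood_ratio_pos not_le)
  then show False by simp
qed

text \<open>The identity survives an infinite integral: the Bochner integral and
  \<open>enn2real\<close> both default to 0 there.\<close>

lemma evidence_eq:
  assumes "X \<in> space (sample_law n \<eta>)"
  shows "evidence \<sigma> n X k = likelihood n X \<eta> * enn2real (ratio_integral \<sigma> n \<eta> k UNIV X)"
proof -
  note [measurable] = likelihood_ratio_prior_measurable[OF assms]
  have "evidence \<sigma> n X k = (LINT \<theta>|sieve_prior \<sigma> k. likelihood n X \<eta> * likelihood_ratio n \<eta> X \<theta>)"
    using likelihood_pos[of n X \<eta>] by (simp add: evidence_def likelihood_ratio_def)
  also have "\<dots> = likelihood n X \<eta> * (LINT \<theta>|sieve_prior \<sigma> k. likelihood_ratio n \<eta> X \<theta>)"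
    by simp
  also have "(LINT \<theta>|sieve_prior \<sigma> k. likelihood_ratio n \<eta> X \<theta>) = enn2real (ratio_integral \<sigma> n \<eta> k UNIV X)"
    unfolding ratio_integral_def
    by (subst integral_eq_nn_integral) (auto simp: less_imp_le likelihood_ratio_pos)
  finally show ?thesis .
qed

text \<open>\<open>arg_max_on\<close> is a choice that says something only if a maximizer exists,
  hence the passage through \<open>Max\<close> over a finite nonempty set. Positive evidence then
  allows the logarithm to be removed.\<close>

lemma k_hat_maximizes:
  assumes "n \<ge> 1" "\<tau> > 0" and pos: "\<And>k. k \<in> {1..n} \<Longrightarrow> evidence \<sigma> n X k > 0"
  shows "k_hat \<sigma> \<tau> n X \<in> {1..n}"
    and "\<And>k. k \<in> {1..n} \<Longrightarrow> model_weight \<tau> k * evidence \<sigma> n X k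
      \<le> model_weight \<tau> (k_hat \<sigma> \<tau> n X) * evidence \<sigma> n X (k_hat \<sigma> \<tau> n X)"
proof -
  let ?f = "\<lambda>k. ln (model_weight \<tau> k * evidence \<sigma> n X k)"
  have "finite {1..n}" "{1..n} \<noteq> {}" using assms by auto
  then have "Max (?f ` {1..n}) \<in> ?f ` {1..n}" by (intro Max_in) auto
  then obtain m where "m \<in> {1..n}" and m: "Max (?f ` {1..n}) = ?f m" by blast
  moreover have "?f k \<le> ?f m" if "k \<in> {1..n}" for k
    unfolding m[symmetric] using that by (intro Max_ge) auto
  ultimately have "\<exists>m. is_arg_max ?f (\<lambda>k. k \<in> {1..n}) m" unfolding is_arg_max_linorder by blast
  then have *: "is_arg_max ?f (\<lambda>k. k \<in> {1..n}) (k_hat \<sigma> \<tau> n X)"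
    unfolding k_hat_def arg_max_on_def arg_max_def by (rule someI_ex)
  then show mem: "k_hat \<sigma> \<tau> n X \<in> {1..n}" by (simp add: is_arg_max_linorder)
  have wpos: "model_weight \<tau> k > 0" for k using \<open>\<tau> > 0\<close> by (simp add: model_weight_def)
  show "model_weight \<tau> k * evidence \<sigma> n X k
      \<le> model_weight \<tau> (k_hat \<sigma> \<tau> n X) * evidence \<sigma> n X (k_hat \<sigma> \<tau> n X)" if k: "k \<in> {1..n}" for k
  proof -
    have "?f k \<le> ?f (k_hat \<sigma> \<tau> n X)" using * k by (simp add: is_arg_max_linorder)
    then show ?thesis using wpos pos[OF k] pos[OF mem] by (subst (asm) ln_le_cancel_iff) auto
  qed
qed

text \<open>The sets \<open>S k\<close> are measurable supersets of the regions where
  \<open>f\<close> exceeds \<open>c\<close>, so the posterior is only ever evaluated on measurable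
  sets. The minimum with 1 retains the trivial bound for a probability, which
  \<open>le_1_split\<close> exploits.\<close>

lemma posterior_integral_le:
  assumes \<sigma>: "\<sigma> > 0" and \<tau>: "\<tau> > 0" and n: "n \<ge> 1" and X: "X \<in> space (sample_law n \<eta>)"
    and fin: "\<And>k. k \<in> {1..n} \<Longrightarrow> ratio_integral \<sigma> n \<eta> k UNIV X < \<infinity>"
    and k0: "k0 \<in> {1..n}"
    and S [measurable]: "\<And>k. S k \<in> sets (\<Pi>\<^sub>M j\<in>UNIV. borel)"
    and f: "\<And>k \<theta>. k \<in> {1..n} \<Longrightarrow> \<theta> \<in> sieve k \<Longrightarrow> f \<theta> \<le> c + indicator (S k) \<theta>"
  shows "(\<integral>\<^sup>+\<theta>. f \<theta> \<partial>posterior \<sigma> n X (k_hat \<sigma> \<tau> n X)) \<le>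
    c + min 1 ((\<Sum>k=1..n. ennreal (model_weight \<tau> k) * ratio_integral \<sigma> n \<eta> k (S k) X)
      * inverse (ennreal (model_weight \<tau> k0) * ratio_integral \<sigma> n \<eta> k0 UNIV X))"
proof -
  define e where "e k = enn2real (ratio_integral \<sigma> n \<eta> k UNIV X)" for k
  define w where "w = model_weight \<tau>"
  define K where "K = k_hat \<sigma> \<tau> n X"
  have w: "w k > 0" for k using \<tau> by (simp add: w_def model_weight_def)
  have e: "e k > 0" "ratio_integral \<sigma> n \<eta> k UNIV X = ennreal (e k)" if "k \<in> {1..n}" for k
    using fin[OF that] ratio_integral_pos[OF \<sigma> X, of k]
    by (auto simp: e_def enn2real_positive_iff zero_less_iff_neq_zero)
  have ev: "evidence \<sigma> n X k = likelihood n X \<eta> * e k" for k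
    by (simp add: evidence_eq[OF X] e_def)
  have max: "K \<in> {1..n}" "\<And>k. k \<in> {1..n} \<Longrightarrow> w k * evidence \<sigma> n X k \<le> w K * evidence \<sigma> n X K"
    unfolding w_def K_def using k_hat_maximizes[OF n \<tau>, of \<sigma> X] e likelihood_pos[of n X \<eta>]
    by (auto simp: ev)
  have le: "w k0 * e k0 \<le> w K * e K"
    using max(2)[OF k0] likelihood_pos[of n X \<eta>]
    by (simp add: ev mult.left_commute mult_le_cancel_left_pos)
  interpret q: prob_space "sieve_prior \<sigma> K" by (rule prob_space_sieve_prior[OF \<sigma>])
  note [measurable] = likelihood_ratio_prior_measurable[OF X]
  have post: "posterior \<sigma> n X K = density (sieve_prior \<sigma> K) (\<lambda>\<theta>. ennreal (likelihood_ratio n \<eta> X \<theta> / e K))"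
    unfolding posterior_def ev likelihood_ratio_def by (simp add: mult.commute)
  have emeasure_post: "emeasure (posterior \<sigma> n X K) A = ratio_integral \<sigma> n \<eta> K A X * inverse (ennreal (e K))"
    if [measurable]: "A \<in> sets (\<Pi>\<^sub>M j\<in>UNIV. borel)" for A
  proof -
    have "emeasure (posterior \<sigma> n X K) A
        = (\<integral>\<^sup>+\<theta>. (ennreal (likelihood_ratio n \<eta> X \<theta>) * indicator A \<theta>) * inverse (ennreal (e K)) \<partial>sieve_prior \<sigma> K)"
      unfolding post using e(1)[OF max(1)] likelihood_ratio_pos[of n \<eta> X]
      by (subst emeasure_density)
        (auto intro!: nn_integral_cong simp: divide_inverse ennreal_mult inverse_ennreal less_imp_le mult_ac)
    then show ?thesis unfolding ratio_integral_def by (subst (asm) nn_integral_multc) auto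
  qed
  have one: "emeasure (posterior \<sigma> n X K) UNIV = 1"
    using e[OF max(1)] by (subst emeasure_post) (auto simp: inverse_ennreal simp flip: ennreal_mult)
  have SK: "S K \<in> sets (posterior \<sigma> n X K)" by (simp add: post)
  have space: "space (posterior \<sigma> n X K) = UNIV" by (simp add: post)
  have "(\<integral>\<^sup>+\<theta>. f \<theta> \<partial>posterior \<sigma> n X K) \<le> (\<integral>\<^sup>+\<theta>. c + indicator (S K) \<theta> \<partial>posterior \<sigma> n X K)"
  proof (rule nn_integral_mono_AE)
    have "AE \<theta> in posterior \<sigma> n X K. \<theta> \<in> sieve K"
      unfolding post using AE_sieve_prior[OF \<sigma>, of K] by (subst AE_density) auto
    then show "AE \<theta> in posterior \<sigma> n X K. f \<theta> \<le> c + indicator (S K) \<theta>"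
      by eventually_elim (rule f[OF max(1)])
  qed
  also have "\<dots> = c + emeasure (posterior \<sigma> n X K) (S K)"
    using SK by (subst nn_integral_add) (auto simp: one space)
  also have "emeasure (posterior \<sigma> n X K) (S K) \<le> min 1 ((\<Sum>k=1..n. ennreal (w k) * ratio_integral \<sigma> n \<eta> k (S k) X)
      * inverse (ennreal (w k0) * ratio_integral \<sigma> n \<eta> k0 UNIV X))"
  proof (rule min.boundedI)
    show "emeasure (posterior \<sigma> n X K) (S K) \<le> 1"
      using emeasure_space[of "posterior \<sigma> n X K" "S K"] by (simp add: one space)
    have "emeasure (posterior \<sigma> n X K) (S K)
        = ratio_integral \<sigma> n \<eta> K (S K) X * inverse (ennreal (e K))"
      by (rule emeasure_post) simp
    \<comment> \<open>The weight is inserted so that the denominator becomes the quantity maximized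
      by \<open>K\<close>, and the numerator a summand of the sum over all dimensions.\<close>
    also have "inverse (ennreal (e K)) = ennreal (w K) * inverse (ennreal (w K * e K))"
      using w[of K] e(1)[OF max(1)] by (simp add: inverse_ennreal flip: ennreal_mult)
    also have "ratio_integral \<sigma> n \<eta> K (S K) X * \<dots>
        = (ennreal (w K) * ratio_integral \<sigma> n \<eta> K (S K) X) * inverse (ennreal (w K * e K))"
      by (simp only: mult_ac)
    also have "\<dots> \<le> (\<Sum>k=1..n. ennreal (w k) * ratio_integral \<sigma> n \<eta> k (S k) X) * inverse (ennreal (w k0 * e k0))"
    proof (rule mult_mono)
      show "ennreal (w K) * ratio_integral \<sigma> n \<eta> K (S K) X \<le> (\<Sum>k=1..n. ennreal (w k) * ratio_integral \<sigma> n \<eta> k (S k) X)"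
        using max(1) by (intro member_le_sum[of K]) auto
      show "inverse (ennreal (w K * e K)) \<le> inverse (ennreal (w k0 * e k0))"
        using le_imp_inverse_le[OF le] w[of k0] w[of K] e(1)[OF k0] e(1)[OF max(1)]
        by (simp add: inverse_ennreal ennreal_leI)
    qed auto
    also have "ennreal (w k0 * e k0) = ennreal (w k0) * ratio_integral \<sigma> n \<eta> k0 UNIV X"
      using w[of k0] e[OF k0] by (simp add: ennreal_mult)
    finally show "emeasure (posterior \<sigma> n X K) (S K) \<le> (\<Sum>k=1..n. ennreal (w k) * ratio_integral \<sigma> n \<eta> k (S k) X)
      * inverse (ennreal (w k0) * ratio_integral \<sigma> n \<eta> k0 UNIV X)" .
  qed
  finally show ?thesis unfolding K_def w_def by (simp add: add_left_mono)
qed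

text \<open>Cauchy-Schwarz is applied to sqrt l and 1 / sqrt l on \<open>B\<close>, whose product
  integrates to the prior mass \<open>b\<close>. Enlarging the first factor to the whole space gives
  b^2 \<le> E * J.\<close>

lemma inverse_ratio_integral_le:
  assumes \<sigma>: "\<sigma> > 0" and X: "X \<in> space (sample_law n \<eta>)"
    and B [measurable]: "B \<in> sets (\<Pi>\<^sub>M j\<in>UNIV. borel)"
    and pos: "emeasure (sieve_prior \<sigma> k) B \<noteq> 0"
  shows "inverse (ratio_integral \<sigma> n \<eta> k UNIV X) \<le>
    (inverse (emeasure (sieve_prior \<sigma> k) B))\<^sup>2
      * (\<integral>\<^sup>+\<theta>. ennreal (1 / likelihood_ratio n \<eta> X \<theta>) * indicator B \<theta> \<partial>sieve_prior \<sigma> k)"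
proof -
  interpret q: prob_space "sieve_prior \<sigma> k" by (rule prob_space_sieve_prior[OF \<sigma>])
  note [measurable] = likelihood_ratio_prior_measurable[OF X]
  define l where "l = likelihood_ratio n \<eta> X"
  have l: "l \<theta> > 0" for \<theta> by (simp add: l_def likelihood_ratio_pos)
  have [measurable]: "l \<in> borel_measurable (sieve_prior \<sigma> k)" unfolding l_def by measurable
  define b where "b = emeasure (sieve_prior \<sigma> k) B"
  define E where "E = ratio_integral \<sigma> n \<eta> k UNIV X"
  define J where "J = (\<integral>\<^sup>+\<theta>. ennreal (1 / l \<theta>) * indicator B \<theta> \<partial>sieve_prior \<sigma> k)"
  have eq: "(\<integral>\<^sup>+\<theta>. (ennreal (sqrt (l \<theta>)) * indicator B \<theta>) * (ennreal (1 / sqrt (l \<theta>)) * indicator B \<theta>) \<partial>sieve_prior \<sigma> k) = b"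
  proof -
    have "(ennreal (sqrt (l \<theta>)) * indicator B \<theta>) * (ennreal (1 / sqrt (l \<theta>)) * indicator B \<theta>) = indicator B \<theta>" for \<theta>
      using l[of \<theta>] by (auto split: split_indicator simp flip: ennreal_mult)
    then show ?thesis by (simp add: b_def)
  qed
  have "b\<^sup>2 \<le> (\<integral>\<^sup>+\<theta>. (ennreal (sqrt (l \<theta>)) * indicator B \<theta>)\<^sup>2 \<partial>sieve_prior \<sigma> k)
      * (\<integral>\<^sup>+\<theta>. (ennreal (1 / sqrt (l \<theta>)) * indicator B \<theta>)\<^sup>2 \<partial>sieve_prior \<sigma> k)"
    unfolding eq[symmetric] by (rule Cauchy_Schwarz_nn_integral) measurable
  also have "\<dots> \<le> E * J"
    unfolding E_def ratio_integral_def J_def l_def[symmetric] using l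
    by (intro mult_mono nn_integral_mono)
      (auto split: split_indicator simp: ennreal_power less_imp_le power_divide)
  finally have bEJ: "b\<^sup>2 \<le> E * J" .
  have b: "b \<noteq> 0" "b \<noteq> \<infinity>" using pos by (auto simp: b_def)
  have inv: "(inverse b)\<^sup>2 * b\<^sup>2 = 1"
    using b unfolding power_mult_distrib[symmetric] by (cases b) (auto simp: inverse_ennreal simp flip: ennreal_mult)
  have "inverse E \<le> (inverse b)\<^sup>2 * J"
  proof (cases "E = \<infinity>")
    case False
    have "E \<noteq> 0" using ratio_integral_pos[OF \<sigma> X] by (simp add: E_def)
    with False have EE: "E * inverse E = 1"
      by (cases E) (auto simp: inverse_ennreal simp flip: ennreal_mult)
    have "inverse E = (inverse b)\<^sup>2 * b\<^sup>2 * inverse E" by (simp add: inv)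
    also have "\<dots> \<le> (inverse b)\<^sup>2 * (E * J) * inverse E" using bEJ by (intro mult_mono) auto
    also have "\<dots> = (inverse b)\<^sup>2 * J * (E * inverse E)" by (simp only: mult_ac)
    finally show ?thesis by (simp add: EE)
  qed simp
  then show ?thesis by (simp add: E_def b_def J_def l_def)
qed

text \<open>By Fubini the expected integral over \<open>B\<close> is at most \<open>C\<close> times
  the mass of \<open>B\<close>, which cancels one of the two inverse masses of
  \<open>inverse_ratio_integral_le\<close>.\<close>

lemma expectation_inverse_ratio_integral_le:
  assumes \<sigma>: "\<sigma> > 0" and abs: "abs_summable \<eta>"
    and B [measurable]: "B \<in> sets (\<Pi>\<^sub>M j\<in>UNIV. borel)"
    and \<beta>: "ennreal \<beta> \<le> emeasure (sieve_prior \<sigma> k) B" "\<beta> > 0"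
    and C: "\<And>\<theta>. \<theta> \<in> sieve k \<Longrightarrow> \<theta> \<in> B \<Longrightarrow>
      (\<integral>\<^sup>+X. ennreal (1 / likelihood_ratio n \<eta> X \<theta>) \<partial>sample_law n \<eta>) \<le> ennreal C"
  shows "(\<integral>\<^sup>+X. inverse (ratio_integral \<sigma> n \<eta> k UNIV X) \<partial>sample_law n \<eta>) \<le> ennreal (C / \<beta>)"
proof -
  interpret q: prob_space "sieve_prior \<sigma> k" by (rule prob_space_sieve_prior[OF \<sigma>])
  define b where "b = emeasure (sieve_prior \<sigma> k) B"
  have b0: "b \<noteq> 0" "b \<noteq> \<infinity>" using \<beta> by (auto simp: b_def ennreal_eq_0_iff)
  have "(\<integral>\<^sup>+X. inverse (ratio_integral \<sigma> n \<eta> k UNIV X) \<partial>sample_law n \<eta>)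
      \<le> (\<integral>\<^sup>+X. (inverse b)\<^sup>2 * (\<integral>\<^sup>+\<theta>. ennreal (1 / likelihood_ratio n \<eta> X \<theta>) * indicator B \<theta> \<partial>sieve_prior \<sigma> k) \<partial>sample_law n \<eta>)"
    using b0 unfolding b_def by (intro nn_integral_mono inverse_ratio_integral_le \<sigma> B) auto
  also have "\<dots> = (inverse b)\<^sup>2 * (\<integral>\<^sup>+X. (\<integral>\<^sup>+\<theta>. ennreal (1 / likelihood_ratio n \<eta> X \<theta>) * indicator B \<theta> \<partial>sieve_prior \<sigma> k) \<partial>sample_law n \<eta>)"
    by (rule nn_integral_cmult) measurable
  also have "(\<integral>\<^sup>+X. (\<integral>\<^sup>+\<theta>. ennreal (1 / likelihood_ratio n \<eta> X \<theta>) * indicator B \<theta> \<partial>sieve_prior \<sigma> k) \<partial>sample_law n \<eta>)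
      = (\<integral>\<^sup>+\<theta>. (\<integral>\<^sup>+X. ennreal (1 / likelihood_ratio n \<eta> X \<theta>) * indicator B \<theta> \<partial>sample_law n \<eta>) \<partial>sieve_prior \<sigma> k)"
    by (rule Fubini_sample_prior[OF \<sigma> abs]) measurable
  also have "\<dots> \<le> (\<integral>\<^sup>+\<theta>. ennreal C * indicator B \<theta> \<partial>sieve_prior \<sigma> k)"
  proof (rule nn_integral_mono_AE)
    show "AE \<theta> in sieve_prior \<sigma> k.
      (\<integral>\<^sup>+X. ennreal (1 / likelihood_ratio n \<eta> X \<theta>) * indicator B \<theta> \<partial>sample_law n \<eta>) \<le> ennreal C * indicator B \<theta>"
      using AE_sieve_prior[OF \<sigma>, of k]
      by eventually_elim (use C in \<open>auto split: split_indicator\<close>)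
  qed
  also have "\<dots> = ennreal C * b"
    unfolding b_def by (rule nn_integral_cmult_indicator) simp
  also have "(inverse b)\<^sup>2 * (ennreal C * b) = ennreal C * inverse b * (inverse b * b)"
    by (simp only: power2_eq_square mult_ac)
  also have "inverse b * b = 1"
    using b0 by (cases b) (auto simp: inverse_ennreal simp flip: ennreal_mult)
  also have "inverse b \<le> inverse (ennreal \<beta>)"
    using \<beta> b0 unfolding b_def[symmetric]
    by (cases b) (auto simp: inverse_ennreal intro!: ennreal_leI le_imp_inverse_le)
  then have "ennreal C * inverse b * 1 \<le> ennreal C * inverse (ennreal \<beta>)"
    by (simp add: mult_left_mono)
  also have "\<dots> = ennreal (C / \<beta>)"
    using \<beta>(2) by (simp add: inverse_ennreal divide_inverse flip: ennreal_mult'')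
  finally show ?thesis by (simp add: mult_left_mono)
qed

text \<open>On the event \<open>Z \<le> t\<close> the bound \<open>min 1 u \<le> sqrt u\<close> is used, on its complement \<open>1 \<le> Z / t\<close>.\<close>

lemma le_1_split:
  fixes q Z N :: ennreal
  assumes "q \<le> 1" "q \<le> ((\<Sum>i\<in>I. ennreal (y i)) + N) * Z" "t > 0" "finite I" "\<And>i. i \<in> I \<Longrightarrow> y i \<ge> 0"
  shows "q \<le> ennreal (1 / t) * Z + (\<Sum>i\<in>I. ennreal (sqrt (t * y i))) + ennreal t * N"
\<comment> \<open>The lemma is used with the reciprocal of the weighted evidence as
  \<open>Z\<close>, so a large \<open>Z\<close> is the bad event.\<close>
proof (cases "Z \<le> ennreal t")
  case False
  then have "1 \<le> ennreal (1 / t) * Z"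
    using mult_left_mono[of "ennreal t" Z "ennreal (1 / t)"] \<open>t > 0\<close> by (simp flip: ennreal_mult)
  with \<open>q \<le> 1\<close> have "q \<le> ennreal (1 / t) * Z" by (rule order.trans)
  then show ?thesis by (intro add_increasing2 zero_le)
next
  case True
  define s where "s = t * (\<Sum>i\<in>I. y i)"
  \<comment> \<open>Subadditivity of the root lets each box contribute separately, through the half
    moment of its own likelihood ratio.\<close>
  have sqrt_sum: "sqrt (\<Sum>i\<in>I. t * y i) \<le> (\<Sum>i\<in>I. sqrt (t * y i))"
    using \<open>finite I\<close> assms(5)
  proof (induction I)
    case (insert i I)
    have "sqrt (t * y i + (\<Sum>i\<in>I. t * y i)) \<le> sqrt (t * y i) + sqrt (\<Sum>i\<in>I. t * y i)"
      using insert.prems \<open>t > 0\<close> by (intro sqrt_add_le_add_sqrt sum_nonneg) auto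
    also have "\<dots> \<le> sqrt (t * y i) + (\<Sum>i\<in>I. sqrt (t * y i))"
      using insert by (intro add_left_mono insert.IH) auto
    finally show ?case using insert.hyps by simp
  qed simp
  have "q \<le> ((\<Sum>i\<in>I. ennreal (y i)) + N) * ennreal t"
    using assms(2) mult_left_mono[OF True] by (rule order.trans) simp
  also have "\<dots> = ennreal s + ennreal t * N"
    using assms by (simp add: s_def sum_ennreal sum_nonneg ennreal_mult ring_distribs mult.commute[of _ "ennreal t"])
  finally have q: "q \<le> ennreal s + ennreal t * N" .
  \<comment> \<open>Only the box part goes under the root. \<open>N\<close> stays linear, because
    its first moment is what Fubini computes.\<close>
  have "q \<le> ennreal (sqrt s) + ennreal t * N"
  proof (cases "s \<le> 1")
    case True
    have "s \<ge> 0" using assms by (simp add: s_def sum_nonneg)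
    then have "s * s \<le> s * 1" using True by (intro mult_left_mono) auto
    then have "s \<le> sqrt s" using \<open>s \<ge> 0\<close> by (intro real_le_rsqrt) (simp add: power2_eq_square)
    then have "ennreal s + ennreal t * N \<le> ennreal (sqrt s) + ennreal t * N"
      by (intro add_right_mono ennreal_leI)
    with q show ?thesis by (rule order.trans)
  next
    case False
    then have "1 \<le> ennreal (sqrt s)" by simp
    with \<open>q \<le> 1\<close> have "q \<le> ennreal (sqrt s)" by (rule order.trans)
    then show ?thesis by (intro add_increasing2 zero_le)
  qed
  also have "ennreal (sqrt s) \<le> (\<Sum>i\<in>I. ennreal (sqrt (t * y i)))"
    using sqrt_sum assms by (simp add: s_def sum_distrib_left sum_ennreal ennreal_leI)
  finally have "q \<le> (\<Sum>i\<in>I. ennreal (sqrt (t * y i))) + ennreal t * N" by (simp add: add_right_mono)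
  then show ?thesis by (simp add: add.assoc add_increasing)
qed

section \<open>Covering the far region\<close>

lemma ratio_integral_Un_UN_le:
  assumes X: "X \<in> space (sample_law n \<eta>)" and "finite T"
    and [measurable]: "A \<in> sets (\<Pi>\<^sub>M j\<in>UNIV. borel)" "\<And>\<zeta>. B \<zeta> \<in> sets (\<Pi>\<^sub>M j\<in>UNIV. borel)"
  shows "ratio_integral \<sigma> n \<eta> k (A \<union> (\<Union>\<zeta>\<in>T. B \<zeta>)) X
    \<le> ratio_integral \<sigma> n \<eta> k A X + (\<Sum>\<zeta>\<in>T. ratio_integral \<sigma> n \<eta> k (B \<zeta>) X)"
proof -
  note [measurable] = likelihood_ratio_prior_measurable[OF X]
  have "indicator (A \<union> (\<Union>\<zeta>\<in>T. B \<zeta>)) \<theta> \<le> indicator A \<theta> + (\<Sum>\<zeta>\<in>T. indicator (B \<zeta>) \<theta> :: ennreal)" for \<theta>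
  proof (cases "\<exists>\<zeta>\<in>T. \<theta> \<in> B \<zeta>")
    case True
    then obtain \<zeta> where "\<zeta> \<in> T" "\<theta> \<in> B \<zeta>" by blast
    then have "1 \<le> (\<Sum>\<zeta>\<in>T. indicator (B \<zeta>) \<theta> :: ennreal)"
      using member_le_sum[of \<zeta> T "\<lambda>\<zeta>. indicator (B \<zeta>) \<theta> :: ennreal"] \<open>finite T\<close> by auto
    then have "1 \<le> indicator A \<theta> + (\<Sum>\<zeta>\<in>T. indicator (B \<zeta>) \<theta> :: ennreal)"
      by (rule add_increasing[OF zero_le])
    moreover have "indicator (A \<union> (\<Union>\<zeta>\<in>T. B \<zeta>)) \<theta> \<le> (1 :: ennreal)" by (simp split: split_indicator)
    ultimately show ?thesis by (rule order.trans[rotated])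
  qed (auto split: split_indicator)
  then have "ratio_integral \<sigma> n \<eta> k (A \<union> (\<Union>\<zeta>\<in>T. B \<zeta>)) X
      \<le> (\<integral>\<^sup>+\<theta>. ennreal (likelihood_ratio n \<eta> X \<theta>) * (indicator A \<theta> + (\<Sum>\<zeta>\<in>T. indicator (B \<zeta>) \<theta>)) \<partial>sieve_prior \<sigma> k)"
    unfolding ratio_integral_def by (intro nn_integral_mono mult_left_mono) auto
  also have "\<dots> = ratio_integral \<sigma> n \<eta> k A X + (\<Sum>\<zeta>\<in>T. ratio_integral \<sigma> n \<eta> k (B \<zeta>) X)"
    unfolding ratio_integral_def distrib_left sum_distrib_left
    by (simp add: nn_integral_add nn_integral_sum)
  finally show ?thesis .
qed

text \<open>On the box the exponent moves by at most sqrt 2 * k * h, so over n observations the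
  ratio changes by at most exp of the left-hand side of the hypothesis on \<open>h\<close>. The
  prior mass of the box is bounded by 1.\<close>

lemma ratio_integral_sup_box_le:
  assumes \<sigma>: "\<sigma> > 0" and X: "X \<in> space (sample_law n \<eta>)" and \<zeta>: "\<zeta> \<in> sieve k"
    and h: "2 * real n * (sqrt 2 * (real k * h)) \<le> 1"
  shows "ratio_integral \<sigma> n \<eta> k (sup_box k \<zeta> h) X \<le> ennreal (exp 1 * likelihood_ratio n \<eta> X \<zeta>)"
proof -
  interpret q: prob_space "sieve_prior \<sigma> k" by (rule prob_space_sieve_prior[OF \<sigma>])
  have "ratio_integral \<sigma> n \<eta> k (sup_box k \<zeta> h) X \<le> (\<integral>\<^sup>+\<theta>. ennreal (exp 1 * likelihood_ratio n \<eta> X \<zeta>) \<partial>sieve_prior \<sigma> k)"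
    unfolding ratio_integral_def
  proof (rule nn_integral_mono_AE)
    show "AE \<theta> in sieve_prior \<sigma> k. ennreal (likelihood_ratio n \<eta> X \<theta>) * indicator (sup_box k \<zeta> h) \<theta>
      \<le> ennreal (exp 1 * likelihood_ratio n \<eta> X \<zeta>)"
      using AE_sieve_prior[OF \<sigma>, of k]
    proof eventually_elim
      case (elim \<theta>)
      show ?case
      proof (cases "\<theta> \<in> sup_box k \<zeta> h")
        case True
        then have "likelihood_ratio n \<eta> X \<theta> \<le> exp (2 * real n * (sqrt 2 * (real k * h))) * likelihood_ratio n \<eta> X \<zeta>"
          using elim \<zeta> by (intro likelihood_ratio_le[OF X] sieve_exponent_diff_le sieve_abs_summable)
            (auto simp: sup_box_def)
        also have "\<dots> \<le> exp 1 * likelihood_ratio n \<eta> X \<zeta>"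
          using h by (intro mult_right_mono) (auto simp: less_imp_le likelihood_ratio_pos)
        finally show ?thesis using True by (simp add: ennreal_leI)
      qed simp
    qed
  qed
  then show ?thesis by (simp add: q.emeasure_space_1[simplified])
qed

text \<open>Coordinates bounded by n, rounded at scale 4 n^2, yield integers between -4 n^3 and 4
  n^3, of which there are 8 n^3 + 1. The mesh 1 / (4 n^2) is the one that
  \<open>ratio_integral_sup_box_le\<close> asks for when k \<le> n and sqrt 2 is estimated by
  2.\<close>

lemma far_set_cover:
  assumes "n \<ge> 1"
  obtains T where "finite T" "T \<subseteq> F" "card T \<le> (8 * n ^ 3 + 1) ^ k"
    "\<And>\<theta>. \<theta> \<in> F \<Longrightarrow> (\<forall>j\<in>{1..k}. \<bar>\<theta> j\<bar> \<le> real n) \<Longrightarrow> \<exists>\<zeta>\<in>T. \<theta> \<in> sup_box k \<zeta> (1 / (4 * real n ^ 2))"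
proof -
  let ?A = "{- int (4 * n ^ 3)..int (4 * n ^ 3)}"
  let ?F = "{\<theta> \<in> F. \<forall>j\<in>{1..k}. \<bar>\<theta> j\<bar> \<le> real n}"
  have "(\<lambda>j\<in>{1..k}. \<lfloor>real (4 * n ^ 2) * \<theta> j\<rfloor>) \<in> {1..k} \<rightarrow>\<^sub>E ?A" if "\<theta> \<in> ?F" for \<theta>
  proof (intro restrict_PiE_iff[THEN iffD2] ballI)
    fix j assume "j \<in> {1..k}"
    then have "\<bar>real (4 * n ^ 2) * \<theta> j\<bar> \<le> real (4 * n ^ 2) * real n"
      using that unfolding abs_mult by (intro mult_mono) auto
    also have "\<dots> = real (4 * n ^ 3)" by (simp add: power2_eq_square power3_eq_cube)
    finally have "- real (4 * n ^ 3) \<le> real (4 * n ^ 2) * \<theta> j" "real (4 * n ^ 2) * \<theta> j \<le> real (4 * n ^ 3)"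
      by (auto simp only: abs_le_iff)
    then show "\<lfloor>real (4 * n ^ 2) * \<theta> j\<rfloor> \<in> ?A"
      unfolding atLeastAtMost_iff le_floor_iff floor_le_iff of_int_minus of_int_of_nat_eq by linarith
  qed
  then have cover: "\<forall>\<theta>\<in>?F. (\<lambda>j\<in>{1..k}. \<lfloor>real (4 * n ^ 2) * \<theta> j\<rfloor>) \<in> {1..k} \<rightarrow>\<^sub>E ?A" by blast
  have "0 < 4 * n ^ 2" using \<open>n \<ge> 1\<close> by simp
  then obtain T where T: "finite T" "T \<subseteq> ?F" "card T \<le> card ?A ^ card {1..k}"
    and box: "\<forall>\<theta>\<in>?F. \<exists>\<zeta>\<in>T. \<forall>j\<in>{1..k}. \<bar>\<theta> j - \<zeta> j\<bar> \<le> 1 / real (4 * n ^ 2)"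
    by (rule finite_sup_box_cover[OF finite_atLeastAtMost cover finite_atLeastAtMost_int])
  show ?thesis
  proof
    show "finite T" "T \<subseteq> F" using T by auto
    have "card ?A = 8 * n ^ 3 + 1" unfolding card_atLeastAtMost_int by (simp add: nat_eq_iff)
    then show "card T \<le> (8 * n ^ 3 + 1) ^ k" using T(3) by simp
    show "\<exists>\<zeta>\<in>T. \<theta> \<in> sup_box k \<zeta> (1 / (4 * real n ^ 2))"
      if "\<theta> \<in> F" "\<forall>j\<in>{1..k}. \<bar>\<theta> j\<bar> \<le> real n" for \<theta>
      using box that by (simp add: sup_box_def)
  qed
qed

text \<open>The expectation of this integral is the prior mass of the whole space. Finiteness makes
  the evidence positive, which \<open>k_hat_maximizes\<close> requires.\<close>

lemma AE_ratio_integral_finite: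
  assumes "\<sigma> > 0" "abs_summable \<eta>"
  shows "AE X in sample_law n \<eta>. \<forall>k. ratio_integral \<sigma> n \<eta> k UNIV X < \<infinity>"
proof -
  have "AE X in sample_law n \<eta>. ratio_integral \<sigma> n \<eta> k UNIV X \<noteq> \<infinity>" for k
  proof (rule nn_integral_PInf_AE)
    interpret q: prob_space "sieve_prior \<sigma> k" by (rule prob_space_sieve_prior[OF assms(1)])
    show "ratio_integral \<sigma> n \<eta> k UNIV \<in> borel_measurable (sample_law n \<eta>)"
      using ratio_integral_measurable[OF assms(1) UNIV_sets_sequences]
      unfolding measurable_cong_sets[OF sets_sample_law refl] .
    show "(\<integral>\<^sup>+X. ratio_integral \<sigma> n \<eta> k UNIV X \<partial>sample_law n \<eta>) \<noteq> \<infinity>"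
      unfolding ratio_integral_def expectation_prior_likelihood_ratio[OF assms UNIV_sets_sequences]
      using q.emeasure_space_1 by simp
  qed
  then show ?thesis by (simp add: AE_all_countable less_top)
qed

text \<open>The squared radius \<open>c\<close>, the threshold \<open>t\<close> and the set
  \<open>Ks\<close> of moderate dimensions remain free. \<open>D / t\<close> is Markov's bound for
  passing the threshold, the first sum is the cost of the box centres, and the bracket after
  \<open>t\<close> collects the prior mass of coordinates beyond n and the weights of the dimensions
  outside \<open>Ks\<close>.\<close>

lemma expected_posterior_hellinger_le:
  assumes \<sigma>: "\<sigma> > 0" and \<tau>: "\<tau> > 0" and n: "n \<ge> 1" and abs: "abs_summable \<eta>"
    and k0: "k0 \<in> {1..n}" and Ks: "Ks \<subseteq> {1..n}" and c: "c \<ge> 0" and t: "t > 0" and D: "D \<ge> 0"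
    and inv: "(\<integral>\<^sup>+X. inverse (ennreal (model_weight \<tau> k0) * ratio_integral \<sigma> n \<eta> k0 UNIV X) \<partial>sample_law n \<eta>) \<le> ennreal D"
  shows "(\<integral>\<^sup>+X. (\<integral>\<^sup>+\<theta>. ennreal ((hellinger unit_lborel (expfam \<theta>) (expfam \<eta>))\<^sup>2)
      \<partial>posterior \<sigma> n X (k_hat \<sigma> \<tau> n X)) \<partial>sample_law n \<eta>)
    \<le> ennreal (c + D / t
      + (\<Sum>k\<in>Ks. real ((8 * n ^ 3 + 1) ^ k) * (sqrt (t * (model_weight \<tau> k * exp 1)) * exp (- (real n * c))))
      + t * ((\<Sum>k\<in>Ks. model_weight \<tau> k * (real k * (sqrt 2 * exp (- (real n)\<^sup>2 / (4 * \<sigma>\<^sup>2)))))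
        + (\<Sum>k\<in>{1..n} - Ks. model_weight \<tau> k)))"
proof -
  define H where "H \<theta> = (hellinger unit_lborel (expfam \<theta>) (expfam \<eta>))\<^sup>2" for \<theta>
  define w where "w = model_weight \<tau>"
  have w: "w k > 0" for k using \<tau> by (simp add: w_def model_weight_def)
  define h where "h = 1 / (4 * real n ^ 2)"
  define far where "far k = {\<theta> \<in> sieve k. H \<theta> > c}" for k
  have "\<exists>T. finite T \<and> T \<subseteq> far k \<and> card T \<le> (8 * n ^ 3 + 1) ^ k \<and>
      (\<forall>\<theta>\<in>far k. (\<forall>j\<in>{1..k}. \<bar>\<theta> j\<bar> \<le> real n) \<longrightarrow> (\<exists>\<zeta>\<in>T. \<theta> \<in> sup_box k \<zeta> h))" for k
    using far_set_cover[OF n, of "far k" k] unfolding h_def by metis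
  then obtain T where T: "\<And>k. finite (T k)" "\<And>k. T k \<subseteq> far k" "\<And>k. card (T k) \<le> (8 * n ^ 3 + 1) ^ k"
    "\<And>k \<theta>. \<theta> \<in> far k \<Longrightarrow> (\<forall>j\<in>{1..k}. \<bar>\<theta> j\<bar> \<le> real n) \<Longrightarrow> \<exists>\<zeta>\<in>T k. \<theta> \<in> sup_box k \<zeta> h"
    by metis
  define tail where "tail k = {\<theta>. \<exists>j\<in>{1..k}. \<bar>\<theta> j :: real\<bar> > real n}" for k :: nat
  have tail_sets [measurable]: "tail k \<in> sets (\<Pi>\<^sub>M j\<in>UNIV. borel)" for k
  proof -
    have "{\<theta> \<in> space (\<Pi>\<^sub>M j\<in>UNIV. borel). \<exists>j\<in>{1..k}. \<bar>\<theta> j :: real\<bar> > real n} \<in> sets (\<Pi>\<^sub>M j\<in>UNIV. borel)"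
      by measurable
    then show ?thesis by (simp add: tail_def space_PiM)
  qed
  \<comment> \<open>Outside \<open>Ks\<close> nothing is covered: the whole space is exceptional,
    and only the weight \<open>w k\<close> is small.\<close>
  define R where "R k = (if k \<in> Ks then tail k else UNIV)" for k
  define S where "S k = R k \<union> (\<Union>\<zeta>\<in>(if k \<in> Ks then T k else {}). sup_box k \<zeta> h)" for k
  have R_sets [measurable]: "R k \<in> sets (\<Pi>\<^sub>M j\<in>UNIV. borel)" for k by (simp add: R_def)
  have S_sets: "S k \<in> sets (\<Pi>\<^sub>M j\<in>UNIV. borel)" for k
    using T(1) unfolding S_def by (intro sets.Un R_sets sets.finite_UN) auto
  \<comment> \<open>On \<open>S k\<close> the trivial bound H \<le> 1 is used. Outside it, a far
    parameter would have a coordinate beyond n or lie in one of the boxes.\<close>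
  have H_le: "ennreal (H \<theta>) \<le> ennreal c + indicator (S k) \<theta>" if "\<theta> \<in> sieve k" for k \<theta>
  proof (cases "\<theta> \<in> S k")
    case True
    have "H \<theta> \<le> 1" unfolding H_def using that by (intro hellinger_expfam_le_1 abs sieve_abs_summable)
    then have "ennreal (H \<theta>) \<le> 1" by simp
    then show ?thesis using True by (simp add: add_increasing)
  next
    case False
    then have "k \<in> Ks" "\<forall>j\<in>{1..k}. \<bar>\<theta> j\<bar> \<le> real n" "\<not> (\<exists>\<zeta>\<in>T k. \<theta> \<in> sup_box k \<zeta> h)"
      by (auto simp: S_def R_def tail_def not_less split: if_splits)
    then have "\<theta> \<notin> far k" using T(4) by blast
    then have "H \<theta> \<le> c" using that by (auto simp: far_def)
    then show ?thesis using False by (simp add: ennreal_leI)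
  qed
  define I where "I = Sigma Ks T"
  define y where "y X = (\<lambda>(k, \<zeta>). w k * (exp 1 * likelihood_ratio n \<eta> X \<zeta>))" for X
  define N where "N X = (\<Sum>k=1..n. ennreal (w k) * ratio_integral \<sigma> n \<eta> k (R k) X)" for X
  define Z where "Z X = inverse (ennreal (w k0) * ratio_integral \<sigma> n \<eta> k0 UNIV X)" for X
  have finKs: "finite Ks" using Ks finite_subset by blast
  have finI: "finite I" unfolding I_def using finKs T(1) by auto
  have box: "2 * real n * (sqrt 2 * (real k * h)) \<le> 1" if "k \<in> Ks" for k
  proof -
    have "sqrt 2 \<le> 2" by (rule real_le_lsqrt) auto
    then have "2 * real n * (sqrt 2 * (real k * h)) \<le> 2 * real n * (2 * (real n * h))"
      using that Ks by (intro mult_mono mult_nonneg_nonneg) (auto simp: h_def)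
    also have "\<dots> = 1" using n by (simp add: h_def power2_eq_square)
    finally show ?thesis .
  qed
  have numerator: "(\<Sum>k=1..n. ennreal (w k) * ratio_integral \<sigma> n \<eta> k (S k) X) \<le> (\<Sum>i\<in>I. ennreal (y X i)) + N X"
    if X: "X \<in> space (sample_law n \<eta>)" for X
  proof -
    have "(\<Sum>k=1..n. ennreal (w k) * ratio_integral \<sigma> n \<eta> k (S k) X)
      \<le> (\<Sum>k=1..n. (if k \<in> Ks then (\<Sum>\<zeta>\<in>T k. ennreal (y X (k, \<zeta>))) else 0) + ennreal (w k) * ratio_integral \<sigma> n \<eta> k (R k) X)"
    proof (rule sum_mono)
      fix k
      have "ratio_integral \<sigma> n \<eta> k (S k) X \<le> ratio_integral \<sigma> n \<eta> k (R k) X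
          + (\<Sum>\<zeta>\<in>(if k \<in> Ks then T k else {}). ratio_integral \<sigma> n \<eta> k (sup_box k \<zeta> h) X)"
        unfolding S_def using T(1) by (intro ratio_integral_Un_UN_le X) auto
      also have "\<dots> \<le> ratio_integral \<sigma> n \<eta> k (R k) X
          + (\<Sum>\<zeta>\<in>(if k \<in> Ks then T k else {}). ennreal (exp 1 * likelihood_ratio n \<eta> X \<zeta>))"
        using T(2)[of k] box[of k]
        by (intro add_left_mono sum_mono ratio_integral_sup_box_le \<sigma> X) (auto simp: far_def split: if_splits)
      finally have "ennreal (w k) * ratio_integral \<sigma> n \<eta> k (S k) X \<le> ennreal (w k) * (ratio_integral \<sigma> n \<eta> k (R k) X
          + (\<Sum>\<zeta>\<in>(if k \<in> Ks then T k else {}). ennreal (exp 1 * likelihood_ratio n \<eta> X \<zeta>)))"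
        by (rule mult_left_mono) simp
      also have "\<dots> = (if k \<in> Ks then (\<Sum>\<zeta>\<in>T k. ennreal (y X (k, \<zeta>))) else 0) + ennreal (w k) * ratio_integral \<sigma> n \<eta> k (R k) X"
        using w[of k] by (simp add: y_def distrib_left sum_distrib_left ennreal_mult' add.commute)
      finally show "ennreal (w k) * ratio_integral \<sigma> n \<eta> k (S k) X \<le> \<dots>" .
    qed
    also have "\<dots> = (\<Sum>k\<in>Ks. \<Sum>\<zeta>\<in>T k. ennreal (y X (k, \<zeta>))) + N X"
      using Ks by (simp add: sum.distrib N_def sum.inter_restrict[symmetric] Int_absorb1)
    also have "(\<Sum>k\<in>Ks. \<Sum>\<zeta>\<in>T k. ennreal (y X (k, \<zeta>))) = (\<Sum>i\<in>I. ennreal (y X i))"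
      unfolding I_def using finKs T(1) by (subst sum.Sigma) (auto simp: case_prod_beta')
    finally show ?thesis .
  qed
  have pointwise: "AE X in sample_law n \<eta>.
      (\<integral>\<^sup>+\<theta>. ennreal (H \<theta>) \<partial>posterior \<sigma> n X (k_hat \<sigma> \<tau> n X))
      \<le> ennreal c + (ennreal (1 / t) * Z X + (\<Sum>i\<in>I. ennreal (sqrt (t * y X i))) + ennreal t * N X)"
    using AE_ratio_integral_finite[OF \<sigma> abs] AE_space
  proof eventually_elim
    case (elim X)
    define q where "q = min 1 ((\<Sum>k=1..n. ennreal (w k) * ratio_integral \<sigma> n \<eta> k (S k) X) * Z X)"
    have "(\<integral>\<^sup>+\<theta>. ennreal (H \<theta>) \<partial>posterior \<sigma> n X (k_hat \<sigma> \<tau> n X)) \<le> ennreal c + q"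
      unfolding q_def Z_def w_def
      using elim by (intro posterior_integral_le[OF \<sigma> \<tau> n _ _ k0 S_sets] H_le) auto
    also have "q \<le> ennreal (1 / t) * Z X + (\<Sum>i\<in>I. ennreal (sqrt (t * y X i))) + ennreal t * N X"
    proof (rule le_1_split[OF _ _ t finI])
      show "q \<le> 1" by (simp add: q_def)
      have "q \<le> (\<Sum>k=1..n. ennreal (w k) * ratio_integral \<sigma> n \<eta> k (S k) X) * Z X" by (simp add: q_def)
      also have "\<dots> \<le> ((\<Sum>i\<in>I. ennreal (y X i)) + N X) * Z X"
        using numerator[OF elim(2)] by (rule mult_right_mono) simp
      finally show "q \<le> ((\<Sum>i\<in>I. ennreal (y X i)) + N X) * Z X" .
      show "y X i \<ge> 0" for i
        using w likelihood_ratio_pos[of n \<eta> X] by (auto simp: y_def less_imp_le split: prod.split)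
    qed
    finally show ?case by (simp add: add_left_mono)
  qed
  interpret p: prob_space "sample_law n \<eta>" by (rule prob_space_sample_law[OF abs])
  have lr_m [measurable]: "(\<lambda>X. likelihood_ratio n \<eta> X \<zeta>) \<in> borel_measurable (\<Pi>\<^sub>M i\<in>{1..n}. unit_lborel)" for \<zeta>
    by (rule likelihood_ratio_measurable) (auto simp: space_PiM)
  have ri_m [measurable]: "ratio_integral \<sigma> n \<eta> k A \<in> borel_measurable (\<Pi>\<^sub>M i\<in>{1..n}. unit_lborel)"
    if "A \<in> sets (\<Pi>\<^sub>M j\<in>UNIV. borel)" for A k
    by (rule ratio_integral_measurable[OF \<sigma> that])
  have Zm [measurable]: "Z \<in> borel_measurable (\<Pi>\<^sub>M i\<in>{1..n}. unit_lborel)"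
    unfolding Z_def[abs_def] by measurable
  have Nm [measurable]: "N \<in> borel_measurable (\<Pi>\<^sub>M i\<in>{1..n}. unit_lborel)"
    unfolding N_def[abs_def] by measurable
  have ym [measurable]: "(\<lambda>X. y X i) \<in> borel_measurable (\<Pi>\<^sub>M i\<in>{1..n}. unit_lborel)" for i
    unfolding y_def case_prod_beta' by measurable
  have EN: "(\<integral>\<^sup>+X. N X \<partial>sample_law n \<eta>)
    \<le> ennreal ((\<Sum>k\<in>Ks. w k * (real k * (sqrt 2 * exp (- (real n)\<^sup>2 / (4 * \<sigma>\<^sup>2))))) + (\<Sum>k\<in>{1..n} - Ks. w k))"
  proof -
    define b where "b k = (if k \<in> Ks then real k * (sqrt 2 * exp (- (real n)\<^sup>2 / (4 * \<sigma>\<^sup>2))) else 1)" for k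
    have "emeasure (sieve_prior \<sigma> k) (R k) \<le> ennreal (b k)" for k
      using sieve_prior_tail_le[OF \<sigma>, of "real n" k] prob_space.emeasure_space_1[OF prob_space_sieve_prior[OF \<sigma>, of k]]
      by (auto simp: R_def b_def tail_def)
    moreover have "(\<integral>\<^sup>+X. N X \<partial>sample_law n \<eta>) = (\<Sum>k=1..n. ennreal (w k) * emeasure (sieve_prior \<sigma> k) (R k))"
    proof -
      have "(\<integral>\<^sup>+X. ennreal (w k) * ratio_integral \<sigma> n \<eta> k (R k) X \<partial>sample_law n \<eta>)
          = ennreal (w k) * emeasure (sieve_prior \<sigma> k) (R k)" for k
      proof -
        have "(\<integral>\<^sup>+X. ennreal (w k) * ratio_integral \<sigma> n \<eta> k (R k) X \<partial>sample_law n \<eta>)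
            = ennreal (w k) * (\<integral>\<^sup>+X. ratio_integral \<sigma> n \<eta> k (R k) X \<partial>sample_law n \<eta>)"
          by (rule nn_integral_cmult) measurable
        then show ?thesis
          unfolding ratio_integral_def expectation_prior_likelihood_ratio[OF \<sigma> abs R_sets] .
      qed
      moreover have "(\<integral>\<^sup>+X. N X \<partial>sample_law n \<eta>)
          = (\<Sum>k=1..n. \<integral>\<^sup>+X. ennreal (w k) * ratio_integral \<sigma> n \<eta> k (R k) X \<partial>sample_law n \<eta>)"
        unfolding N_def by (rule nn_integral_sum) measurable
      ultimately show ?thesis by simp
    qed
    ultimately have "(\<integral>\<^sup>+X. N X \<partial>sample_law n \<eta>) \<le> (\<Sum>k=1..n. ennreal (w k) * ennreal (b k))"
      by (auto intro!: sum_mono mult_left_mono)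
    also have "\<dots> = ennreal (\<Sum>k=1..n. w k * b k)"
      using w by (subst sum_ennreal[symmetric]) (auto simp: b_def less_imp_le ennreal_mult)
    also have "(\<Sum>k=1..n. w k * b k) = (\<Sum>k\<in>Ks. w k * b k) + (\<Sum>k\<in>{1..n} - Ks. w k * b k)"
      using sum.subset_diff[OF Ks, of "\<lambda>k. w k * b k"] by simp
    also have "\<dots> = (\<Sum>k\<in>Ks. w k * (real k * (sqrt 2 * exp (- (real n)\<^sup>2 / (4 * \<sigma>\<^sup>2))))) + (\<Sum>k\<in>{1..n} - Ks. w k)"
      by (intro arg_cong2[where f = "(+)"] sum.cong) (auto simp: b_def)
    finally show ?thesis .
  qed
  have Ey: "(\<integral>\<^sup>+X. (\<Sum>i\<in>I. ennreal (sqrt (t * y X i))) \<partial>sample_law n \<eta>)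
    \<le> ennreal (\<Sum>k\<in>Ks. real ((8 * n ^ 3 + 1) ^ k) * (sqrt (t * (w k * exp 1)) * exp (- (real n * c))))"
  proof -
    define a where "a k = sqrt (t * (w k * exp 1)) * exp (- (real n * c))" for k
    have a: "a k \<ge> 0" for k using t w[of k] by (simp add: a_def)
    have "(\<integral>\<^sup>+X. ennreal (sqrt (t * y X (k, \<zeta>))) \<partial>sample_law n \<eta>) \<le> ennreal (a k)" if "\<zeta> \<in> T k" for k \<zeta>
    proof -
      have \<zeta>: "\<zeta> \<in> sieve k" "c \<le> H \<zeta>" using that T(2)[of k] by (auto simp: far_def)
      have "(\<integral>\<^sup>+X. ennreal (sqrt (t * y X (k, \<zeta>))) \<partial>sample_law n \<eta>)
        = (\<integral>\<^sup>+X. ennreal (sqrt (t * (w k * exp 1))) * ennreal (sqrt (likelihood_ratio n \<eta> X \<zeta>)) \<partial>sample_law n \<eta>)"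
        using t w[of k] likelihood_ratio_pos[of n \<eta>]
        by (intro nn_integral_cong) (simp add: y_def real_sqrt_mult mult.assoc less_imp_le flip: ennreal_mult)
      also have "\<dots> = ennreal (sqrt (t * (w k * exp 1))) * (\<integral>\<^sup>+X. ennreal (sqrt (likelihood_ratio n \<eta> X \<zeta>)) \<partial>sample_law n \<eta>)"
        by (rule nn_integral_cmult) measurable
      also have "\<dots> \<le> ennreal (sqrt (t * (w k * exp 1))) * ennreal (exp (- real n * H \<zeta>))"
        unfolding H_def by (intro mult_left_mono expectation_sqrt_likelihood_ratio_le abs sieve_abs_summable[OF \<zeta>(1)]) auto
      also have "\<dots> \<le> ennreal (sqrt (t * (w k * exp 1))) * ennreal (exp (- (real n * c)))"
        using \<zeta>(2) by (intro mult_left_mono ennreal_leI) (auto intro: mult_left_mono)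
      also have "\<dots> = ennreal (a k)" using t w[of k] by (simp add: a_def ennreal_mult)
      finally show ?thesis .
    qed
    note * = this
    have "(\<integral>\<^sup>+X. (\<Sum>i\<in>I. ennreal (sqrt (t * y X i))) \<partial>sample_law n \<eta>)
      = (\<Sum>i\<in>I. \<integral>\<^sup>+X. ennreal (sqrt (t * y X i)) \<partial>sample_law n \<eta>)"
      by (rule nn_integral_sum) measurable
    also have "\<dots> \<le> (\<Sum>i\<in>I. ennreal (a (fst i)))"
      using * by (intro sum_mono) (auto simp: I_def)
    also have "\<dots> = ennreal (\<Sum>i\<in>I. a (fst i))" using a by (simp add: sum_ennreal)
    also have "(\<Sum>i\<in>I. a (fst i)) = (\<Sum>k\<in>Ks. \<Sum>\<zeta>\<in>T k. a k)"
      unfolding I_def using finKs T(1) by (subst sum.Sigma) (auto simp: case_prod_beta')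
    also have "\<dots> \<le> (\<Sum>k\<in>Ks. real ((8 * n ^ 3 + 1) ^ k) * a k)"
    proof (rule sum_mono)
      fix k
      have "real (card (T k)) \<le> real ((8 * n ^ 3 + 1) ^ k)" using T(3)[of k] by (simp only: of_nat_le_iff)
      then show "(\<Sum>\<zeta>\<in>T k. a k) \<le> real ((8 * n ^ 3 + 1) ^ k) * a k"
        using a[of k] by (simp only: sum_constant mult_right_mono)
    qed
    finally show ?thesis unfolding a_def by (simp add: ennreal_leI)
  qed
  have "(\<integral>\<^sup>+X. (\<integral>\<^sup>+\<theta>. ennreal (H \<theta>) \<partial>posterior \<sigma> n X (k_hat \<sigma> \<tau> n X)) \<partial>sample_law n \<eta>)
    \<le> (\<integral>\<^sup>+X. ennreal c + (ennreal (1 / t) * Z X + (\<Sum>i\<in>I. ennreal (sqrt (t * y X i))) + ennreal t * N X) \<partial>sample_law n \<eta>)"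
    by (rule nn_integral_mono_AE[OF pointwise])
  also have "\<dots> = ennreal c + (ennreal (1 / t) * (\<integral>\<^sup>+X. Z X \<partial>sample_law n \<eta>)
      + (\<integral>\<^sup>+X. (\<Sum>i\<in>I. ennreal (sqrt (t * y X i))) \<partial>sample_law n \<eta>) + ennreal t * (\<integral>\<^sup>+X. N X \<partial>sample_law n \<eta>))"
    by (simp add: nn_integral_add nn_integral_cmult p.emeasure_space_1 del: One_nat_def)
  also have "\<dots> \<le> ennreal c + (ennreal (1 / t) * ennreal D
      + ennreal (\<Sum>k\<in>Ks. real ((8 * n ^ 3 + 1) ^ k) * (sqrt (t * (w k * exp 1)) * exp (- (real n * c))))
      + ennreal t * ennreal ((\<Sum>k\<in>Ks. w k * (real k * (sqrt 2 * exp (- (real n)\<^sup>2 / (4 * \<sigma>\<^sup>2))))) + (\<Sum>k\<in>{1..n} - Ks. w k)))"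
    using inv by (intro add_left_mono add_mono mult_left_mono EN Ey) (auto simp: Z_def w_def)
  also have "\<dots> = ennreal (c + (1 / t * D
      + (\<Sum>k\<in>Ks. real ((8 * n ^ 3 + 1) ^ k) * (sqrt (t * (w k * exp 1)) * exp (- (real n * c))))
      + t * ((\<Sum>k\<in>Ks. w k * (real k * (sqrt 2 * exp (- (real n)\<^sup>2 / (4 * \<sigma>\<^sup>2))))) + (\<Sum>k\<in>{1..n} - Ks. w k))))"
    using c t D w
    by (simp only: ennreal_mult[symmetric] ennreal_plus[symmetric] add_nonneg_nonneg mult_nonneg_nonneg
      sum_nonneg less_imp_le real_sqrt_ge_zero exp_ge_zero of_nat_0_le_iff divide_nonneg_nonneg zero_le_one
      order_refl zero_le_numeral)
  finally show ?thesis unfolding H_def w_def by (simp add: add.assoc)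
qed

section \<open>Sobolev smoothness and the evidence lower bound\<close>

text \<open>Bounds the l1 norm over the Sobolev ball by the termwise estimate |u| \<le> (j^(-2
  \<alpha>) + j^(2 \<alpha>) u^2) / 2. The series is the zeta function at 2 \<alpha>, finite because
  \<alpha> > 1/2.\<close>

definition zeta_bound :: "real \<Rightarrow> real \<Rightarrow> real" where
  "zeta_bound \<alpha> R = ((\<Sum>j. real (Suc j) powr (- (2 * \<alpha>))) + R\<^sup>2) / 2"

lemma summable_Suc_powr:
  assumes "\<alpha> > 1 / 2"
  shows "summable (\<lambda>j. real (Suc j) powr (- (2 * \<alpha>)))"
  using assms by (subst summable_Suc_iff) (simp add: summable_real_powr_iff)

lemma sobolev_ball_l1:
  assumes \<alpha>: "\<alpha> > 1 / 2" and \<eta>: "\<eta> \<in> sobolev_ball \<alpha> R"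
  shows "abs_summable \<eta>" and "l1_norm \<eta> \<le> zeta_bound \<alpha> R"
proof -
  let ?u = "\<lambda>j. (real (Suc j) powr (- (2 * \<alpha>)) + real (Suc j) powr (2 * \<alpha>) * (\<eta> (Suc j))\<^sup>2) / 2"
  have s: "summable ?u"
    using \<eta> summable_Suc_powr[OF \<alpha>] by (intro summable_divide summable_add) (auto simp: sobolev_ball_def)
  have le: "\<bar>\<eta> (Suc j)\<bar> \<le> ?u j" for j
  proof -
    let ?m = "real (Suc j) powr \<alpha>"
    have m: "?m > 0" by simp
    have "0 \<le> (inverse ?m - ?m * \<bar>\<eta> (Suc j)\<bar>)\<^sup>2" by simp
    also have "\<dots> = (inverse ?m)\<^sup>2 + ?m\<^sup>2 * (\<eta> (Suc j))\<^sup>2 - 2 * \<bar>\<eta> (Suc j)\<bar>"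
      using m by (simp add: power2_diff power_mult_distrib)
    also have "?m\<^sup>2 = real (Suc j) powr (2 * \<alpha>)"
      unfolding power2_eq_square powr_add[symmetric] by simp
    also have "(inverse ?m)\<^sup>2 = real (Suc j) powr (- (2 * \<alpha>))"
      unfolding powr_minus[symmetric] power2_eq_square powr_add[symmetric] by simp
    finally show ?thesis by simp
  qed
  show abs: "abs_summable \<eta>"
    unfolding abs_summable_def by (rule summable_comparison_test'[OF s]) (use le in auto)
  have "l1_norm \<eta> \<le> suminf ?u"
    unfolding l1_norm_def using abs by (intro suminf_le le s) (simp add: abs_summable_def)
  also have "\<dots> = ((\<Sum>j. real (Suc j) powr (- (2 * \<alpha>))) + (\<Sum>j. real (Suc j) powr (2 * \<alpha>) * (\<eta> (Suc j))\<^sup>2)) / 2"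
    using \<eta> summable_Suc_powr[OF \<alpha>]
    by (subst suminf_divide, intro summable_add) (auto simp: sobolev_ball_def suminf_add[symmetric])
  also have "\<dots> \<le> zeta_bound \<alpha> R"
    using \<eta> by (simp add: zeta_bound_def sobolev_ball_def)
  finally show "l1_norm \<eta> \<le> zeta_bound \<alpha> R" .
qed

lemma sobolev_ball_coordinate_le:
  assumes \<alpha>: "\<alpha> > 1 / 2" and R: "R > 0" and \<eta>: "\<eta> \<in> sobolev_ball \<alpha> R" and j: "j \<ge> 1"
  shows "\<bar>\<eta> j\<bar> \<le> R"
proof -
  obtain i where i: "j = Suc i" using j by (cases j) auto
  let ?u = "\<lambda>j. real (Suc j) powr (2 * \<alpha>) * (\<eta> (Suc j))\<^sup>2"
  have "1 \<le> real (Suc i) powr (2 * \<alpha>)" using \<alpha> by (intro ge_one_powr_ge_zero) auto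
  then have "(\<eta> j)\<^sup>2 \<le> ?u i"
    unfolding i by (simp add: mult_le_cancel_right1)
  also have "\<dots> = (\<Sum>j\<in>{i}. ?u j)" by simp
  also have "\<dots> \<le> suminf ?u" using \<eta> by (intro sum_le_suminf) (auto simp: sobolev_ball_def)
  also have "\<dots> \<le> R\<^sup>2" using \<eta> by (simp add: sobolev_ball_def)
  finally show ?thesis using R by (simp add: abs_le_square_iff[symmetric])
qed

text \<open>The first k coordinates contribute at most k h^2, the others the squared bias of the
  Sobolev ball. In sup norm the difference is merely bounded, not small; this suffices, because it
  enters the chi-square bound only through the constant factor exp G.\<close>

lemma sobolev_truncation:
  assumes \<alpha>: "\<alpha> > 1 / 2" and \<eta>: "\<eta> \<in> sobolev_ball \<alpha> R"
    and k: "k \<ge> 1" and h: "h \<ge> 0" and \<theta>: "\<theta> \<in> sieve k" "\<theta> \<in> sup_box k \<eta> h"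
  obtains s where "(\<lambda>j. (\<theta> (Suc j) - \<eta> (Suc j))\<^sup>2) sums s" "s \<le> real k * h\<^sup>2 + real k powr (- (2 * \<alpha>)) * R\<^sup>2"
    "\<And>x. \<bar>exponent \<theta> x - exponent \<eta> x\<bar> \<le> sqrt 2 * (real k * h + zeta_bound \<alpha> R)"
proof -
  note abs = sieve_abs_summable[OF \<theta>(1)] sobolev_ball_l1(1)[OF \<alpha> \<eta>]
  have close: "\<bar>\<theta> (Suc j) - \<eta> (Suc j)\<bar> \<le> h" if "j < k" for j
    using \<theta>(2) that by (simp add: sup_box_def)
  let ?v = "\<lambda>j. real (Suc j) powr (2 * \<alpha>) * (\<eta> (Suc j))\<^sup>2"
  let ?u = "\<lambda>j. (if j \<in> {..<k} then h\<^sup>2 else 0) + real k powr (- (2 * \<alpha>)) * ?v j"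
  have "(\<lambda>j. if j \<in> {..<k} then h\<^sup>2 else 0) sums (\<Sum>j<k. h\<^sup>2)"
    by (rule sums_If_finite_set) simp
  moreover have "?v sums suminf ?v" using \<eta> by (intro summable_sums) (simp add: sobolev_ball_def)
  ultimately have u: "?u sums (real k * h\<^sup>2 + real k powr (- (2 * \<alpha>)) * suminf ?v)"
    by (auto intro: sums_add sums_mult)
  have le: "(\<theta> (Suc j) - \<eta> (Suc j))\<^sup>2 \<le> ?u j" for j
  proof (cases "j < k")
    case True
    then have "(\<theta> (Suc j) - \<eta> (Suc j))\<^sup>2 \<le> h\<^sup>2"
      using power_mono[OF close[OF True] abs_ge_zero, of 2] by simp
    then have "(\<theta> (Suc j) - \<eta> (Suc j))\<^sup>2 \<le> h\<^sup>2 + real k powr (- (2 * \<alpha>)) * ?v j"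
      by (rule add_increasing2[rotated]) simp
    then show ?thesis using True by simp
  next
    case False
    \<comment> \<open>Beyond k the Sobolev weight is at least k^(2 \<alpha>), which turns the
      weighted sum into a bound on the tail.\<close>
    have "1 = real k powr (- (2 * \<alpha>)) * real k powr (2 * \<alpha>)"
      using k by (simp flip: powr_add)
    also have "\<dots> \<le> real k powr (- (2 * \<alpha>)) * real (Suc j) powr (2 * \<alpha>)"
      using False \<alpha> by (intro mult_left_mono powr_mono2) auto
    finally have "1 * (\<eta> (Suc j))\<^sup>2 \<le> real k powr (- (2 * \<alpha>)) * real (Suc j) powr (2 * \<alpha>) * (\<eta> (Suc j))\<^sup>2"
      by (rule mult_right_mono) simp
    moreover have "\<theta> (Suc j) = 0" using \<theta>(1) False by (simp add: sieve_def)
    ultimately show ?thesis using False by (simp add: mult.assoc)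
  qed
  have summ: "summable (\<lambda>j. (\<theta> (Suc j) - \<eta> (Suc j))\<^sup>2)"
    by (rule summable_comparison_test'[OF sums_summable[OF u]]) (use le in auto)
  show ?thesis
  proof
    show "(\<lambda>j. (\<theta> (Suc j) - \<eta> (Suc j))\<^sup>2) sums (\<Sum>j. (\<theta> (Suc j) - \<eta> (Suc j))\<^sup>2)"
      using summ by (rule summable_sums)
    have "(\<Sum>j. (\<theta> (Suc j) - \<eta> (Suc j))\<^sup>2) \<le> real k * h\<^sup>2 + real k powr (- (2 * \<alpha>)) * suminf ?v"
      using suminf_le[OF le summ sums_summable[OF u]] sums_unique[OF u] by simp
    also have "\<dots> \<le> real k * h\<^sup>2 + real k powr (- (2 * \<alpha>)) * R\<^sup>2"
      using \<eta> by (intro add_left_mono mult_left_mono) (auto simp: sobolev_ball_def)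
    finally show "(\<Sum>j. (\<theta> (Suc j) - \<eta> (Suc j))\<^sup>2) \<le> real k * h\<^sup>2 + real k powr (- (2 * \<alpha>)) * R\<^sup>2" .
    let ?w = "\<lambda>j. (if j \<in> {..<k} then h else 0) + \<bar>\<eta> (Suc j)\<bar>"
    have "(\<lambda>j. if j \<in> {..<k} then h else 0) sums (\<Sum>j<k. h)"
      by (rule sums_If_finite_set) simp
    moreover have "(\<lambda>j. \<bar>\<eta> (Suc j)\<bar>) sums l1_norm \<eta>"
      unfolding l1_norm_def using abs(2) by (intro summable_sums) (simp add: abs_summable_def)
    ultimately have w: "?w sums (real k * h + l1_norm \<eta>)" by (auto intro: sums_add)
    have "\<bar>\<theta> (Suc j) - \<eta> (Suc j)\<bar> \<le> ?w j" for j
      using close[of j] \<theta>(1) by (cases "j < k") (auto simp: sieve_def)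
    then have "l1_norm (\<lambda>j. \<theta> j - \<eta> j) \<le> suminf ?w"
      unfolding l1_norm_def
      using abs_summable_diff[OF abs] by (intro suminf_le sums_summable[OF w]) (auto simp: abs_summable_def)
    also have "\<dots> \<le> real k * h + zeta_bound \<alpha> R"
      using sums_unique[OF w] sobolev_ball_l1(2)[OF \<alpha> \<eta>] by simp
    finally have "sqrt 2 * l1_norm (\<lambda>j. \<theta> j - \<eta> j) \<le> sqrt 2 * (real k * h + zeta_bound \<alpha> R)" by simp
    then show "\<bar>exponent \<theta> x - exponent \<eta> x\<bar> \<le> sqrt 2 * (real k * h + zeta_bound \<alpha> R)" for x
      using abs_exponent_le[OF abs_summable_diff[OF abs], of x] unfolding exponent_diff[OF abs] by linarith
  qed
qed

text \<open>The box has half-width 1 / n: then k * h \<le> 1 and n * k * h^2 \<le> 1, so apart from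
  the bias term the likelihood costs only a constant in the exponent. One power of n per coordinate
  pays for the prior mass of the box, the other for the factorial in the weight.\<close>

lemma expectation_inverse_evidence_le:
  assumes \<sigma>: "\<sigma> > 0" and \<tau>: "\<tau> > 0" and R: "R > 0" and \<alpha>: "\<alpha> > 1 / 2"
  shows "\<exists>C\<ge>0. \<exists>\<kappa>>0. \<forall>n. \<forall>\<eta>\<in>sobolev_ball \<alpha> R. \<forall>k\<in>{1..n}.
    (\<integral>\<^sup>+X. inverse (ennreal (model_weight \<tau> k) * ratio_integral \<sigma> n \<eta> k UNIV X) \<partial>sample_law n \<eta>)
    \<le> ennreal (exp (C * (1 + R\<^sup>2 * (real n * real k powr (- (2 * \<alpha>))))) * ((real n)\<^sup>2 / \<kappa>) ^ k)"
proof (intro exI conjI allI ballI)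
  define S where "S = zeta_bound \<alpha> R"
  define C where "C = 2 * (exp (sqrt 2 * (1 + S)) * exp (2 * sqrt 2 * S))"
  \<comment> \<open>With half-width 1 / n each coordinate of the box has prior mass at least \<nu> /
    n, since the true coordinates are bounded by R.\<close>
  define \<nu> where "\<nu> = 2 * normal_density 0 \<sigma> (R + 1)"
  show "C \<ge> 0" by (simp add: C_def)
  have \<nu>: "\<nu> > 0" using \<sigma> by (simp add: \<nu>_def normal_density_pos)
  then show "\<nu> * \<tau> > 0" using \<tau> by simp
  fix n :: nat and \<eta> k assume \<eta>: "\<eta> \<in> sobolev_ball \<alpha> R" and k: "k \<in> {1..n}"
  have n: "real n > 0" using k by auto
  note abs = sobolev_ball_l1(1)[OF \<alpha> \<eta>]
  let ?h = "1 / real n"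
  let ?B = "exp (C * (1 + R\<^sup>2 * (real n * real k powr (- (2 * \<alpha>)))))"
  have kh: "real k * ?h \<le> 1" using k by (simp add: field_simps)
  have inv: "(\<integral>\<^sup>+X. inverse (ratio_integral \<sigma> n \<eta> k UNIV X) \<partial>sample_law n \<eta>)
      \<le> ennreal (?B / (2 * ?h * normal_density 0 \<sigma> (R + 1)) ^ k)"
  proof (rule expectation_inverse_ratio_integral_le[OF \<sigma> abs sup_box_sets[of k \<eta> ?h]])
    show "ennreal ((2 * ?h * normal_density 0 \<sigma> (R + 1)) ^ k) \<le> emeasure (sieve_prior \<sigma> k) (sup_box k \<eta> ?h)"
      using k sobolev_ball_coordinate_le[OF \<alpha> R \<eta>] by (intro sieve_prior_sup_box_ge \<sigma>) auto
    show "(2 * ?h * normal_density 0 \<sigma> (R + 1)) ^ k > 0" using n \<sigma> by (simp add: normal_density_pos)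
    fix \<theta> assume \<theta>: "\<theta> \<in> sieve k" "\<theta> \<in> sup_box k \<eta> ?h"
    have "k \<ge> 1" using k by simp
    from sobolev_truncation[OF \<alpha> \<eta> this _ \<theta>] n obtain s where
      s: "(\<lambda>j. (\<theta> (Suc j) - \<eta> (Suc j))\<^sup>2) sums s" "s \<le> real k * ?h\<^sup>2 + real k powr (- (2 * \<alpha>)) * R\<^sup>2"
      and d: "\<And>x. \<bar>exponent \<theta> x - exponent \<eta> x\<bar> \<le> sqrt 2 * (real k * ?h + S)"
      unfolding S_def by auto
    have "s \<ge> 0" using suminf_nonneg[OF sums_summable[OF s(1)]] sums_unique[OF s(1)] by simp
    have "(\<integral>\<^sup>+X. ennreal (1 / likelihood_ratio n \<eta> X \<theta>) \<partial>sample_law n \<eta>)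
        \<le> ennreal (exp (real n * (2 * (exp (sqrt 2 * (1 + S)) * (exp (2 * sqrt 2 * l1_norm \<eta>) * s)))))"
    proof (rule expectation_inverse_likelihood_ratio_le[OF sieve_abs_summable[OF \<theta>(1)] abs s(1)])
      fix x
      have "sqrt 2 * (real k * ?h + S) \<le> sqrt 2 * (1 + S)" using kh by simp
      then show "\<bar>exponent \<theta> x - exponent \<eta> x\<bar> \<le> sqrt 2 * (1 + S)" using d[of x] by linarith
    qed
    also have "\<dots> \<le> ennreal ?B"
    proof (rule ennreal_leI, subst exp_le_cancel_iff)
      have "real n * (2 * (exp (sqrt 2 * (1 + S)) * (exp (2 * sqrt 2 * l1_norm \<eta>) * s)))
        \<le> real n * (2 * (exp (sqrt 2 * (1 + S)) * (exp (2 * sqrt 2 * S) * s)))"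
        using sobolev_ball_l1(2)[OF \<alpha> \<eta>] \<open>s \<ge> 0\<close> by (intro mult_left_mono mult_right_mono) (auto simp: S_def)
      also have "\<dots> = C * (real n * s)" by (simp add: C_def)
      also have "\<dots> \<le> C * (1 + R\<^sup>2 * (real n * real k powr (- (2 * \<alpha>))))"
      proof (rule mult_left_mono[OF _ \<open>C \<ge> 0\<close>])
        have "real n * s \<le> real n * (real k * ?h\<^sup>2 + real k powr (- (2 * \<alpha>)) * R\<^sup>2)"
          using s(2) by (rule mult_left_mono) simp
        also have "\<dots> = real k * ?h + R\<^sup>2 * (real n * real k powr (- (2 * \<alpha>)))"
          using n by (simp add: algebra_simps power2_eq_square)
        finally show "real n * s \<le> 1 + R\<^sup>2 * (real n * real k powr (- (2 * \<alpha>)))" using kh by linarith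
      qed
      finally show "real n * (2 * (exp (sqrt 2 * (1 + S)) * (exp (2 * sqrt 2 * l1_norm \<eta>) * s)))
        \<le> C * (1 + R\<^sup>2 * (real n * real k powr (- (2 * \<alpha>))))" .
    qed
    finally show "(\<integral>\<^sup>+X. ennreal (1 / likelihood_ratio n \<eta> X \<theta>) \<partial>sample_law n \<eta>) \<le> ennreal ?B" .
  qed
  have w: "model_weight \<tau> k > 0" using \<tau> by (simp add: model_weight_def)
  have m: "(\<lambda>X. inverse (ratio_integral \<sigma> n \<eta> k UNIV X)) \<in> borel_measurable (sample_law n \<eta>)"
    using ratio_integral_measurable[OF \<sigma> UNIV_sets_sequences, of n \<eta> k]
    unfolding measurable_cong_sets[OF sets_sample_law refl] by measurable
  have "(\<integral>\<^sup>+X. inverse (ennreal (model_weight \<tau> k) * ratio_integral \<sigma> n \<eta> k UNIV X) \<partial>sample_law n \<eta>)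
      = (\<integral>\<^sup>+X. ennreal (1 / model_weight \<tau> k) * inverse (ratio_integral \<sigma> n \<eta> k UNIV X) \<partial>sample_law n \<eta>)"
    using w by (intro nn_integral_cong) (subst ennreal_inverse_mult', auto simp: inverse_ennreal inverse_eq_divide)
  also have "\<dots> = ennreal (1 / model_weight \<tau> k) * (\<integral>\<^sup>+X. inverse (ratio_integral \<sigma> n \<eta> k UNIV X) \<partial>sample_law n \<eta>)"
    by (rule nn_integral_cmult[OF m])
  also have "\<dots> \<le> ennreal (1 / model_weight \<tau> k) * ennreal (?B / (2 * ?h * normal_density 0 \<sigma> (R + 1)) ^ k)"
    by (rule mult_left_mono[OF inv]) simp
  also have "\<dots> = ennreal (1 / model_weight \<tau> k * (?B / (2 * ?h * normal_density 0 \<sigma> (R + 1)) ^ k))"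
    using w by (intro ennreal_mult[symmetric]) (auto simp: less_imp_le)
  also have "1 / model_weight \<tau> k * (?B / (2 * ?h * normal_density 0 \<sigma> (R + 1)) ^ k)
      = ?B * fact k * (real n ^ k / (\<nu> * \<tau>) ^ k)"
    by (simp add: model_weight_def \<nu>_def power_mult_distrib power_divide field_simps)
  also have "\<dots> \<le> ?B * real n ^ k * (real n ^ k / (\<nu> * \<tau>) ^ k)"
  proof (intro mult_right_mono mult_left_mono)
    have "(fact k :: real) \<le> real k ^ k" using fact_le_power[of k] by simp
    also have "\<dots> \<le> real n ^ k" using k by (intro power_mono) auto
    finally show "(fact k :: real) \<le> real n ^ k" .
  qed (use \<nu> \<tau> in auto)
  also have "\<dots> = ?B * ((real n)\<^sup>2 / (\<nu> * \<tau>)) ^ k"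
    by (simp add: power_divide power2_eq_square power_mult_distrib)
  finally show "(\<integral>\<^sup>+X. inverse (ennreal (model_weight \<tau> k) * ratio_integral \<sigma> n \<eta> k UNIV X) \<partial>sample_law n \<eta>)
    \<le> ennreal (?B * ((real n)\<^sup>2 / (\<nu> * \<tau>)) ^ k)"
    by (simp add: ennreal_leI)
qed

section \<open>The convergence rate\<close>

lemma sum_exp_series_le:
  assumes "y \<ge> (0::real)" "finite I"
  shows "(\<Sum>k\<in>I. y ^ k / fact k) \<le> exp y"
proof -
  have "summable (\<lambda>k. y ^ k / fact k)"
    using summable_exp_generic[of y] by (simp add: scaleR_conv_of_real divide_inverse mult.commute)
  then have "(\<Sum>k\<in>I. y ^ k / fact k) \<le> (\<Sum>k. y ^ k / fact k)"
    using assms by (intro sum_le_suminf) auto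
  then show ?thesis by (simp add: exp_def scaleR_conv_of_real divide_inverse mult.commute)
qed

lemma model_weight_le_exp: "\<tau> > 0 \<Longrightarrow> model_weight \<tau> k \<le> exp \<tau>"
  using sum_exp_series_le[of \<tau> "{k}"] by (simp add: model_weight_def)

text \<open>Chernoff's argument: x^k * exp (- K * ln x) is at least 1 for k \<ge> K, and the weights
  multiplied by x^k sum to at most exp (x * \<tau>).\<close>

lemma model_weight_tail_le:
  assumes \<tau>: "\<tau> > 0" and x: "x \<ge> 1" and fin: "finite I" and K: "\<And>k. k \<in> I \<Longrightarrow> real k \<ge> K"
  shows "(\<Sum>k\<in>I. model_weight \<tau> k) \<le> exp (x * \<tau> - K * ln x)"
proof -
  have "model_weight \<tau> k \<le> exp (- K * ln x) * ((x * \<tau>) ^ k / fact k)" if "k \<in> I" for k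
  proof -
    have "K * ln x \<le> real k * ln x" using K[OF that] x by (intro mult_right_mono) auto
    then have "1 \<le> exp (- K * ln x + real k * ln x)" by simp
    also have "\<dots> = exp (- K * ln x) * x ^ k"
      unfolding exp_add exp_of_nat_mult using x by simp
    finally have "1 * model_weight \<tau> k \<le> exp (- K * ln x) * x ^ k * model_weight \<tau> k"
      using \<tau> by (intro mult_right_mono) (auto simp: model_weight_def)
    then show ?thesis by (simp add: model_weight_def power_mult_distrib)
  qed
  then have "(\<Sum>k\<in>I. model_weight \<tau> k) \<le> exp (- K * ln x) * (\<Sum>k\<in>I. (x * \<tau>) ^ k / fact k)"
    unfolding sum_distrib_left by (rule sum_mono)
  also have "\<dots> \<le> exp (- K * ln x) * exp (x * \<tau>)"
    using \<tau> x fin by (intro mult_left_mono sum_exp_series_le) auto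
  also have "\<dots> = exp (x * \<tau> - K * ln x)" by (simp flip: exp_add)
  finally show ?thesis .
qed

lemma ln_le_half: "y > 0 \<Longrightarrow> ln y \<le> y / 2" for y :: real
proof -
  assume y: "y > 0"
  have "ln (y / 2) \<le> y / 2 - 1" using y by (intro ln_le_minus_one) auto
  then have "ln y \<le> y / 2 - 1 + ln 2" using y by (simp add: ln_div)
  moreover have "ln 2 \<le> (1 :: real)" using ln_le_minus_one[of "2 :: real"] by simp
  ultimately show "ln y \<le> y / 2" by linarith
qed

text \<open>The sieve dimension \<open>x = (n / ln n) powr (1 / (2 * \<alpha> + 1))\<close> balances the squared bias
  \<open>n * x powr (- 2 * \<alpha>)\<close> against the complexity \<open>x * ln n\<close>; their common value is \<open>n\<close> times the rate.\<close>

lemma balanced_dimension: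
  fixes n :: nat
  assumes n: "n \<ge> 2" and \<alpha>: "\<alpha> > 1 / 2"
  defines "x \<equiv> (real n / ln (real n)) powr (1 / (2 * \<alpha> + 1))"
  shows "x \<ge> 1" "x \<le> real n" "x * ln (real n) \<le> real n" "ln (real n) \<ge> 1 / 2"
    "1 / (2 * (2 * \<alpha> + 1)) * (x * ln (real n)) \<le> x * ln x"
    "real n * x powr (- (2 * \<alpha>)) = x * ln (real n)"
    "x * ln (real n) = real n * (real n powr (- (2 * \<alpha> / (2 * \<alpha> + 1))) * ln (real n) powr (2 * \<alpha> / (2 * \<alpha> + 1)))"
proof -
  define L where "L = ln (real n)"
  define p where "p = 1 / (2 * \<alpha> + 1)"
  \<comment> \<open>Here \<alpha> > 1/2 enters: p \<le> 1/2 yields x \<le> sqrt (n / L), hence x * L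
    \<le> sqrt (n * L) \<le> n.\<close>
  have p: "0 < p" "p \<le> 1 / 2" using \<alpha> by (auto simp: p_def field_simps)
  have pa: "2 * \<alpha> / (2 * \<alpha> + 1) = 1 - p" using \<alpha> by (simp add: p_def field_simps)
  have n0: "real n > 0" using n by simp
  have "ln 2 \<le> L" using n by (simp add: L_def)
  then show L: "ln (real n) \<ge> 1 / 2" using ln2_ge_two_thirds unfolding L_def by linarith
  then have L0: "L > 0" by (simp add: L_def)
  have Ln: "L \<le> real n / 2" unfolding L_def using n0 by (rule ln_le_half)
  then have y: "real n / L \<ge> 1" using L0 n0 by (simp add: field_simps)
  show x1: "x \<ge> 1" unfolding x_def L_def[symmetric] using y p by (intro ge_one_powr_ge_zero) (auto simp: p_def)
  have "x \<le> (real n / L) powr (1 / 2)"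
    unfolding x_def L_def[symmetric] using y p by (intro powr_mono) (auto simp: p_def)
  also have "\<dots> = sqrt (real n / L)" using y by (simp add: powr_half_sqrt)
  finally have xs: "x \<le> sqrt (real n / L)" .
  have "real n / L \<le> (real n)\<^sup>2"
  proof -
    have "1 \<le> real n * L" using n L mult_mono[of 2 "real n" "1/2" L] by (simp add: L_def)
    then have "real n * 1 \<le> real n * (real n * L)" by (intro mult_left_mono) auto
    then show ?thesis using L0 by (simp add: field_simps power2_eq_square)
  qed
  then have "sqrt (real n / L) \<le> real n" using n0 by (intro real_le_lsqrt) auto
  with xs show "x \<le> real n" by linarith
  have "x * L \<le> sqrt (real n / L) * L" using xs L0 by (intro mult_right_mono) auto
  also have "\<dots> = sqrt (real n * L)"
    using L0 n0 by (simp add: real_sqrt_mult real_sqrt_divide field_simps)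
  also have "\<dots> \<le> sqrt (real n * real n)" using Ln n0 by (intro real_sqrt_le_mono mult_left_mono) auto
  also have "\<dots> = real n" by simp
  finally show "x * ln (real n) \<le> real n" by (simp add: L_def)
  have "ln x = p * (L - ln L)"
    unfolding x_def L_def[symmetric] p_def[symmetric] using n0 L0 by (simp add: ln_powr ln_div) (simp add: L_def)
  \<comment> \<open>This makes ln x at least a fixed multiple of ln n, so that the factorial decay x
    * ln x matches the complexity x * ln n.\<close>
  moreover have "L / 2 \<le> L - ln L" using ln_le_half[OF L0] by simp
  ultimately have "p * (L / 2) \<le> ln x" using p by simp
  then have "x * (p * (L / 2)) \<le> x * ln x" using x1 by (intro mult_left_mono) auto
  then show "1 / (2 * (2 * \<alpha> + 1)) * (x * ln (real n)) \<le> x * ln x"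
    unfolding L_def[symmetric] p_def by (simp add: field_simps)
  have x_eq: "x = real n powr p * L powr (- p)"
    unfolding x_def L_def[symmetric] p_def[symmetric] using n0 L0
    by (simp add: powr_divide powr_minus_divide)
  have "x powr (2 * \<alpha> + 1) = real n / L"
    unfolding x_def L_def[symmetric] powr_powr using \<alpha> L0 by simp
  then have "x * x powr (2 * \<alpha>) = real n / L" using x1 by (simp add: powr_add mult.commute)
  then have "real n = x * L * x powr (2 * \<alpha>)" using L0 by (simp add: field_simps)
  then have "real n * x powr (- (2 * \<alpha>)) = x * L * (x powr (2 * \<alpha>) * x powr (- (2 * \<alpha>)))" by (metis mult.assoc)
  also have "x powr (2 * \<alpha>) * x powr (- (2 * \<alpha>)) = 1" using x1 by (simp flip: powr_add)
  finally show "real n * x powr (- (2 * \<alpha>)) = x * ln (real n)" by (simp add: L_def)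
  have "real n powr p = real n powr 1 * real n powr (- (1 - p))" "L powr (1 - p) = L powr 1 * L powr (- p)"
    unfolding powr_add[symmetric] by simp_all
  then have "real n * (real n powr (- (1 - p)) * L powr (1 - p)) = x * L"
    unfolding x_eq using n0 L0 by simp
  then show "x * ln (real n) = real n * (real n powr (- (2 * \<alpha> / (2 * \<alpha> + 1))) * ln (real n) powr (2 * \<alpha> / (2 * \<alpha> + 1)))"
    unfolding pa L_def by simp
qed

text \<open>The constants are tuned so that every term keeps exp (- A). The threshold
  \<open>t\<close> beats exp (C * A) by one A. In n * c, the part 7 * q * A pays for the covering,
  (C + 1) * A for \<open>t\<close>, one A for the number of dimensions, and one A is left. Beyond q
  * x the weights sum to at most exp (- (C + 2) * A), which again beats \<open>t\<close> by one
  A.\<close>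

lemma posterior_remainder_le:
  fixes n :: nat and \<sigma> \<tau> x A C q :: real
  assumes \<sigma>: "\<sigma> > 0" and \<tau>: "\<tau> > 0" and n: "n \<ge> 2" and x: "x \<ge> 1" and A: "A = x * ln (real n)"
    "A \<le> real n" and L: "ln (real n) \<ge> 1 / 2" and C: "C \<ge> 0" and q: "q \<ge> 0"
    and qx: "(2 * \<tau> + C + 2) * A \<le> q * (x * ln x)"
    and Ks: "Ks = {k\<in>{1..n}. real k \<le> q * x}" and t: "t = exp ((C + 1) * A)" and c: "real n * c = (7 * q + C + 3) * A"
  shows "exp (C * A) / t
      + (\<Sum>k\<in>Ks. real ((8 * n ^ 3 + 1) ^ k) * (sqrt (t * (model_weight \<tau> k * exp 1)) * exp (- (real n * c))))
      + t * ((\<Sum>k\<in>Ks. model_weight \<tau> k * (real k * (sqrt 2 * exp (- (real n)\<^sup>2 / (4 * \<sigma>\<^sup>2)))))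
        + (\<Sum>k\<in>{1..n} - Ks. model_weight \<tau> k))
    \<le> (2 + exp (\<tau> + 1) + sqrt 2 * exp \<tau> * exp (\<sigma>\<^sup>2 * (C + 4)\<^sup>2)) * exp (- A)"
proof -
  define L where "L = ln (real n)"
  have L: "L \<ge> 1 / 2" using L by (simp add: L_def)
  have AL: "A = x * L" by (simp add: A L_def)
  have LA: "L \<le> A" using mult_right_mono[OF x, of L] L by (simp add: AL)
  have A0: "A \<ge> 0" using LA L by linarith
  have nL: "real n = exp L" using n by (simp add: L_def)
  have nA: "real n \<le> exp A" unfolding nL using LA by simp
  have finKs: "finite Ks" "card Ks \<le> n"
  proof -
    show "finite Ks" by (simp add: Ks)
    have "card Ks \<le> card {1..n}" unfolding Ks by (intro card_mono) auto
    then show "card Ks \<le> n" by simp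
  qed
  have t1: "t \<ge> 1" unfolding t using C A0 by simp
  have first: "exp (C * A) / t = exp (- A)"
    unfolding t by (simp add: algebra_simps flip: exp_diff)
  have second: "(\<Sum>k\<in>Ks. real ((8 * n ^ 3 + 1) ^ k) * (sqrt (t * (model_weight \<tau> k * exp 1)) * exp (- (real n * c))))
    \<le> exp (\<tau> + 1) * exp (- A)"
  proof -
    have "real ((8 * n ^ 3 + 1) ^ k) * (sqrt (t * (model_weight \<tau> k * exp 1)) * exp (- (real n * c)))
      \<le> exp (7 * q * A) * (t * (exp \<tau> * exp 1) * exp (- (real n * c)))" if k: "k \<in> Ks" for k
    proof (intro mult_mono)
      \<comment> \<open>The exponent 7 comes from 8 n^3 + 1 \<le> 2^4 n^3 \<le> n^7, valid for n
        \<ge> 2.\<close>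
      have "(8::real) * real n ^ 3 + 1 \<le> real n ^ 7"
      proof -
        have "(2::real) ^ 4 * real n ^ 3 \<le> real n ^ 4 * real n ^ 3"
          using n by (intro mult_right_mono power_mono) auto
        moreover have "(1::real) \<le> real n ^ 3" using n by simp
        ultimately show ?thesis by (simp flip: power_add)
      qed
      also have "real n ^ 7 = exp (7 * L)" unfolding nL by (simp flip: exp_of_nat_mult)
      finally have "(8 * real n ^ 3 + 1) ^ k \<le> exp (7 * L) ^ k" by (intro power_mono) auto
      also have "\<dots> = exp (real k * (7 * L))" by (simp flip: exp_of_nat_mult)
      also have "\<dots> \<le> exp (7 * q * A)"
      proof (subst exp_le_cancel_iff)
        have "real k * (7 * L) \<le> (q * x) * (7 * L)" using k L by (intro mult_right_mono) (auto simp: Ks)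
        then show "real k * (7 * L) \<le> 7 * q * A" by (simp add: AL mult_ac)
      qed
      finally show "real ((8 * n ^ 3 + 1) ^ k) \<le> exp (7 * q * A)" by (simp add: add.commute)
      have "sqrt (t * (model_weight \<tau> k * exp 1)) \<le> sqrt (t * (exp \<tau> * exp 1))"
        using t1 model_weight_le_exp[OF \<tau>, of k] by (intro real_sqrt_le_mono mult_left_mono mult_right_mono) auto
      also have "\<dots> \<le> t * (exp \<tau> * exp 1)"
      proof (rule real_le_lsqrt)
        have "1 \<le> t * (exp \<tau> * exp 1)"
          using t1 \<tau> mult_mono[of 1 t 1 "exp \<tau> * exp 1"] by (simp flip: exp_add)
        then show "t * (exp \<tau> * exp 1) \<le> (t * (exp \<tau> * exp 1))\<^sup>2" "0 \<le> t * (exp \<tau> * exp 1)"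
          by (auto intro: self_le_power)
      qed
      finally show "sqrt (t * (model_weight \<tau> k * exp 1)) \<le> t * (exp \<tau> * exp 1)" .
    qed (use t1 \<tau> in \<open>auto simp: model_weight_def\<close>)
    then have "(\<Sum>k\<in>Ks. real ((8 * n ^ 3 + 1) ^ k) * (sqrt (t * (model_weight \<tau> k * exp 1)) * exp (- (real n * c))))
      \<le> (\<Sum>k\<in>Ks. exp (7 * q * A) * (t * (exp \<tau> * exp 1) * exp (- (real n * c))))"
      by (rule sum_mono)
    also have "\<dots> = real (card Ks) * (exp (7 * q * A) * (t * (exp \<tau> * exp 1) * exp (- (real n * c))))"
      by simp
    also have "\<dots> \<le> exp A * (exp (7 * q * A) * (t * (exp \<tau> * exp 1) * exp (- (real n * c))))"
      using finKs(2) nA t1 by (intro mult_right_mono) auto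
    also have "\<dots> = exp (\<tau> + 1) * exp (- A)"
      unfolding t c by (simp add: algebra_simps flip: exp_add)
    finally show ?thesis .
  qed
  have third: "t * (\<Sum>k\<in>Ks. model_weight \<tau> k * (real k * (sqrt 2 * exp (- (real n)\<^sup>2 / (4 * \<sigma>\<^sup>2)))))
    \<le> sqrt 2 * exp \<tau> * exp (\<sigma>\<^sup>2 * (C + 4)\<^sup>2) * exp (- A)"
  proof -
    let ?e = "exp (- (real n)\<^sup>2 / (4 * \<sigma>\<^sup>2))"
    have "(\<Sum>k\<in>Ks. model_weight \<tau> k * (real k * (sqrt 2 * ?e))) \<le> (\<Sum>k\<in>Ks. exp \<tau> * (real n * (sqrt 2 * ?e)))"
      using model_weight_le_exp[OF \<tau>] by (intro sum_mono mult_mono) (auto simp: Ks)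
    also have "\<dots> = real (card Ks) * (exp \<tau> * (real n * (sqrt 2 * ?e)))" by simp
    also have "\<dots> \<le> exp A * (exp \<tau> * (exp A * (sqrt 2 * ?e)))"
      using finKs(2) nA by (intro mult_mono) auto
    finally have "t * (\<Sum>k\<in>Ks. model_weight \<tau> k * (real k * (sqrt 2 * ?e))) \<le> t * (exp A * (exp \<tau> * (exp A * (sqrt 2 * ?e))))"
      using t1 by (intro mult_left_mono) auto
    also have "\<dots> = sqrt 2 * exp \<tau> * exp ((C + 4) * A - (real n)\<^sup>2 / (4 * \<sigma>\<^sup>2)) * exp (- A)"
      unfolding t by (simp add: algebra_simps flip: exp_add)
    also have "\<dots> \<le> sqrt 2 * exp \<tau> * exp (\<sigma>\<^sup>2 * (C + 4)\<^sup>2) * exp (- A)"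
    proof (intro mult_right_mono mult_left_mono, subst exp_le_cancel_iff)
      have "(C + 4) * A \<le> (C + 4) * real n" using A(2) C by (intro mult_left_mono) auto
      \<comment> \<open>Completing the square: the Gaussian tail at n absorbs every exp (const * n),
        and A \<le> n, at the price of the constant exp (\<sigma>^2 (C + 4)^2).\<close>
      moreover have "0 \<le> (\<sigma> * (C + 4) - real n / (2 * \<sigma>))\<^sup>2" by simp
      then have "(C + 4) * real n \<le> \<sigma>\<^sup>2 * (C + 4)\<^sup>2 + (real n)\<^sup>2 / (4 * \<sigma>\<^sup>2)"
        using \<sigma> by (simp add: power2_diff power_mult_distrib power_divide)
      ultimately show "(C + 4) * A - (real n)\<^sup>2 / (4 * \<sigma>\<^sup>2) \<le> \<sigma>\<^sup>2 * (C + 4)\<^sup>2" by linarith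
    qed auto
    finally show ?thesis .
  qed
  have fourth: "t * (\<Sum>k\<in>{1..n} - Ks. model_weight \<tau> k) \<le> exp (- A)"
  proof -
    have "(\<Sum>k\<in>{1..n} - Ks. model_weight \<tau> k) \<le> exp (x * \<tau> - (q * x) * ln x)"
      by (rule model_weight_tail_le[OF \<tau> x]) (auto simp: Ks)
    also have "\<dots> \<le> exp (- (C + 2) * A)"
    proof (subst exp_le_cancel_iff)
      \<comment> \<open>The factor exp (x * \<tau>) of the Chernoff bound is absorbed into A by ln n
        \<ge> 1/2, which explains 2 * \<tau> in the condition on \<open>q\<close>.\<close>
      have "x * 1 \<le> x * (2 * L)" using L x by (intro mult_left_mono) auto
      then have "x * 1 * \<tau> \<le> x * (2 * L) * \<tau>" using \<tau> by (intro mult_right_mono) auto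
      then have "x * \<tau> \<le> 2 * \<tau> * A" by (simp add: AL mult_ac)
      moreover have "2 * \<tau> * A + (C + 2) * A \<le> q * x * ln x" using qx by (simp add: algebra_simps)
      moreover have "- (C + 2) * A = - ((C + 2) * A)" by (rule mult_minus_left)
      ultimately show "x * \<tau> - q * x * ln x \<le> - (C + 2) * A" by linarith
    qed
    finally have "t * (\<Sum>k\<in>{1..n} - Ks. model_weight \<tau> k) \<le> t * exp (- (C + 2) * A)"
      using t1 by (intro mult_left_mono) auto
    also have "\<dots> = exp (- A)" unfolding t by (simp add: algebra_simps flip: exp_add)
    finally show ?thesis .
  qed
  show ?thesis
    using first second third fourth unfolding distrib_left[of t] distrib_right[of _ _ "exp (- A)"] by linarith
qed

theorem theorem3p2:
  fixes \<sigma> \<tau> R \<alpha> :: real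
  assumes "\<sigma> > 0" and "\<tau> > 0" and "R > 0" and "\<alpha> > 1 / 2"
  shows "\<exists>M>0. \<forall>n\<ge>(2::nat). \<forall>\<theta>s\<in>sobolev_ball \<alpha> R.
    (\<integral>\<^sup>+ X. (\<integral>\<^sup>+ \<theta>. ennreal ((hellinger unit_lborel (expfam \<theta>) (expfam \<theta>s))\<^sup>2)
              \<partial>posterior \<sigma> n X (k_hat \<sigma> \<tau> n X))
       \<partial>(\<Pi>\<^sub>M i\<in>{1..n}. expfam \<theta>s))
    \<le> ennreal (M * real n powr (- (2 * \<alpha> / (2 * \<alpha> + 1)))
                 * ln (real n) powr (2 * \<alpha> / (2 * \<alpha> + 1)))"
proof -
  obtain C0 \<kappa> where C0: "C0 \<ge> 0" "\<kappa> > 0" and inv: "\<And>n \<eta> k. \<eta> \<in> sobolev_ball \<alpha> R \<Longrightarrow> k \<in> {1..n} \<Longrightarrow>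
    (\<integral>\<^sup>+X. inverse (ennreal (model_weight \<tau> k) * ratio_integral \<sigma> n \<eta> k UNIV X) \<partial>sample_law n \<eta>)
    \<le> ennreal (exp (C0 * (1 + R\<^sup>2 * (real n * real k powr (- (2 * \<alpha>))))) * ((real n)\<^sup>2 / \<kappa>) ^ k)"
    using expectation_inverse_evidence_le[OF assms] by metis
  \<comment> \<open>Collects the exponent of the inverse evidence at k0 \<le> 2 x in units of A: 1
    \<le> 2 A gives the 2 beside R^2, the power n^(2 k0) gives 4, and \<kappa>^(- k0) gives the last
    summand.\<close>
  define C where "C = C0 * (2 + R\<^sup>2) + 4 + 4 * \<bar>ln \<kappa>\<bar>"
  \<comment> \<open>The factor 2 * (2 * \<alpha> + 1) undoes the constant that relates x * ln x to x
    * ln n in \<open>balanced_dimension\<close>.\<close>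
  define q where "q = (2 * \<tau> + C + 2) * (2 * (2 * \<alpha> + 1))"
  define E where "E = 2 + exp (\<tau> + 1) + sqrt 2 * exp \<tau> * exp (\<sigma>\<^sup>2 * (C + 4)\<^sup>2)"
  define M where "M = 7 * q + C + 3 + 2 * E"
  have C: "C \<ge> 0" using C0 by (simp add: C_def)
  have q: "q \<ge> 0" using C assms by (simp add: q_def)
  have E: "E > 0" unfolding E_def by (intro add_pos_pos) auto
  have "M > 0" unfolding M_def using C q E by linarith
  moreover have "(\<integral>\<^sup>+ X. (\<integral>\<^sup>+ \<theta>. ennreal ((hellinger unit_lborel (expfam \<theta>) (expfam \<eta>))\<^sup>2)
              \<partial>posterior \<sigma> n X (k_hat \<sigma> \<tau> n X)) \<partial>sample_law n \<eta>)
    \<le> ennreal (M * real n powr (- (2 * \<alpha> / (2 * \<alpha> + 1))) * ln (real n) powr (2 * \<alpha> / (2 * \<alpha> + 1)))"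
    if n: "n \<ge> 2" and \<eta>: "\<eta> \<in> sobolev_ball \<alpha> R" for n :: nat and \<eta>
  proof -
    define x where "x = (real n / ln (real n)) powr (1 / (2 * \<alpha> + 1))"
    define A where "A = x * ln (real n)"
    define r where "r = real n powr (- (2 * \<alpha> / (2 * \<alpha> + 1))) * ln (real n) powr (2 * \<alpha> / (2 * \<alpha> + 1))"
    note dim = balanced_dimension[OF n assms(4), folded x_def, folded A_def r_def]
    have n0: "real n > 0" using n by simp
    have LA: "ln (real n) \<le> A" using mult_right_mono[OF dim(1), of "ln (real n)"] dim(4) by (simp add: A_def)
    \<comment> \<open>Rounding up keeps the bias no larger than at x. It at most doubles the
      dimension, as x \<ge> 1, and stays within \<open>{1..n}\<close>, as x \<le> n.\<close>
    define k0 where "k0 = nat \<lceil>x\<rceil>"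
    have k0: "x \<le> real k0" "real k0 \<le> 2 * x" "k0 \<in> {1..n}"
      using dim(1,2) by (auto simp: k0_def) linarith+
    define c where "c = (7 * q + C + 3) * r"
    define t where "t = exp ((C + 1) * A)"
    define Ks where "Ks = {k\<in>{1..n}. real k \<le> q * x}"
    have r: "r \<ge> 0" by (simp add: r_def)
    have "(\<integral>\<^sup>+X. inverse (ennreal (model_weight \<tau> k0) * ratio_integral \<sigma> n \<eta> k0 UNIV X) \<partial>sample_law n \<eta>)
        \<le> ennreal (exp (C0 * (1 + R\<^sup>2 * (real n * real k0 powr (- (2 * \<alpha>))))) * ((real n)\<^sup>2 / \<kappa>) ^ k0)"
      by (rule inv[OF \<eta> k0(3)])
    also have "\<dots> \<le> ennreal (exp (C * A))"
    proof (rule ennreal_leI)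
      have "real k0 powr (- (2 * \<alpha>)) \<le> x powr (- (2 * \<alpha>))"
        using k0 dim(1) assms(4) by (intro powr_mono2') auto
      then have "real n * real k0 powr (- (2 * \<alpha>)) \<le> real n * x powr (- (2 * \<alpha>))" by (intro mult_left_mono) auto
      then have bias: "real n * real k0 powr (- (2 * \<alpha>)) \<le> A" using dim(6) by simp
      have "1 + R\<^sup>2 * (real n * real k0 powr (- (2 * \<alpha>))) \<le> 2 * A + R\<^sup>2 * A"
        using bias LA dim(4) by (intro add_mono mult_left_mono) auto
      then have "C0 * (1 + R\<^sup>2 * (real n * real k0 powr (- (2 * \<alpha>)))) \<le> C0 * (2 * A + R\<^sup>2 * A)"
        using C0 by (intro mult_left_mono) auto
      moreover have "((real n)\<^sup>2 / \<kappa>) ^ k0 = exp (real k0 * (2 * ln (real n) - ln \<kappa>))"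
      proof -
        have "(real n)\<^sup>2 / \<kappa> = exp (2 * ln (real n) - ln \<kappa>)"
          using n0 C0 by (simp add: exp_diff exp_of_nat_mult[of 2, simplified] exp_ln)
        then show ?thesis by (simp add: exp_of_nat_mult)
      qed
      moreover have "real k0 * (2 * ln (real n) - ln \<kappa>) \<le> 4 * A + 4 * \<bar>ln \<kappa>\<bar> * A"
      proof -
        have "real k0 * (2 * ln (real n) - ln \<kappa>) \<le> real k0 * (2 * ln (real n) + \<bar>ln \<kappa>\<bar> * (2 * ln (real n)))"
        proof (intro mult_left_mono)
          have "\<bar>ln \<kappa>\<bar> * 1 \<le> \<bar>ln \<kappa>\<bar> * (2 * ln (real n))" using dim(4) by (intro mult_left_mono) auto
          then show "2 * ln (real n) - ln \<kappa> \<le> 2 * ln (real n) + \<bar>ln \<kappa>\<bar> * (2 * ln (real n))" by linarith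
        qed simp
        also have "\<dots> \<le> 2 * x * (2 * ln (real n) + \<bar>ln \<kappa>\<bar> * (2 * ln (real n)))"
          using k0(2) dim(4) by (intro mult_right_mono) auto
        also have "\<dots> = 4 * A + 4 * \<bar>ln \<kappa>\<bar> * A" by (simp add: A_def algebra_simps)
        finally show ?thesis .
      qed
      ultimately have "exp (C0 * (1 + R\<^sup>2 * (real n * real k0 powr (- (2 * \<alpha>))))) * ((real n)\<^sup>2 / \<kappa>) ^ k0
          \<le> exp (C0 * (2 * A + R\<^sup>2 * A)) * exp (4 * A + 4 * \<bar>ln \<kappa>\<bar> * A)"
        by (intro mult_mono) auto
      also have "\<dots> = exp (C * A)" by (simp add: C_def algebra_simps flip: exp_add)
      finally show "exp (C0 * (1 + R\<^sup>2 * (real n * real k0 powr (- (2 * \<alpha>))))) * ((real n)\<^sup>2 / \<kappa>) ^ k0 \<le> exp (C * A)" .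
    qed
    finally have inv: "(\<integral>\<^sup>+X. inverse (ennreal (model_weight \<tau> k0) * ratio_integral \<sigma> n \<eta> k0 UNIV X) \<partial>sample_law n \<eta>)
        \<le> ennreal (exp (C * A))" .
    have qx: "(2 * \<tau> + C + 2) * A \<le> q * (x * ln x)"
    proof -
      have "(2 * \<tau> + C + 2) * A = q * (1 / (2 * (2 * \<alpha> + 1)) * A)" using assms(4) by (simp add: q_def)
      also have "\<dots> \<le> q * (x * ln x)" using dim(5) q by (intro mult_left_mono) auto
      finally show ?thesis .
    qed
    have nc: "real n * c = (7 * q + C + 3) * A" by (simp add: c_def dim(7))
    \<comment> \<open>Since A \<ge> ln n, the remainder is at most of order 1 / n, and 1 \<le> 2 A =
      2 n r puts 1 / n below twice the rate.\<close>
    have "exp (- A) \<le> 2 * r"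
    proof -
      have "exp (- A) \<le> exp (- ln (real n))" using LA by simp
      also have "\<dots> = 1 / real n" using n0 by (simp add: exp_minus inverse_eq_divide)
      also have "\<dots> \<le> 2 * r"
        using LA dim(4,7) n0 by (simp add: pos_divide_le_eq mult_ac)
      finally show ?thesis .
    qed
    have "(\<integral>\<^sup>+ X. (\<integral>\<^sup>+ \<theta>. ennreal ((hellinger unit_lborel (expfam \<theta>) (expfam \<eta>))\<^sup>2)
              \<partial>posterior \<sigma> n X (k_hat \<sigma> \<tau> n X)) \<partial>sample_law n \<eta>)
      \<le> ennreal (c + exp (C * A) / t
        + (\<Sum>k\<in>Ks. real ((8 * n ^ 3 + 1) ^ k) * (sqrt (t * (model_weight \<tau> k * exp 1)) * exp (- (real n * c))))
        + t * ((\<Sum>k\<in>Ks. model_weight \<tau> k * (real k * (sqrt 2 * exp (- (real n)\<^sup>2 / (4 * \<sigma>\<^sup>2)))))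
          + (\<Sum>k\<in>{1..n} - Ks. model_weight \<tau> k)))"
      using n q C r
      by (intro expected_posterior_hellinger_le[OF assms(1,2) _ sobolev_ball_l1(1)[OF assms(4) \<eta>] k0(3) _ _ _ _ inv])
        (auto simp: Ks_def c_def t_def)
    also have "\<dots> \<le> ennreal (c + E * exp (- A))"
      using posterior_remainder_le[OF assms(1,2) n dim(1) A_def dim(3,4) C q qx Ks_def t_def nc]
      by (intro ennreal_leI) (simp add: E_def)
    also have "\<dots> \<le> ennreal (M * r)"
    proof (rule ennreal_leI)
      have "E * exp (- A) \<le> E * (2 * r)" using \<open>exp (- A) \<le> 2 * r\<close> E by (intro mult_left_mono) auto
      then show "c + E * exp (- A) \<le> M * r" by (simp add: c_def M_def algebra_simps)
    qed
    finally show ?thesis by (simp add: r_def mult.assoc)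
  qed
  ultimately show ?thesis by blast
qed

end
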